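(* Let $F:\mathbb{R}^2\to\mathbb{R}^2$ be a quadratic map $$F(x,y)=(a_0x^2+a_1xy+a_2y^2+a_3x+a_4y+a_5,\; b_0x^2+b_1xy+b_2y^2+b_3x+b_4y+b_5)$$ with real coefficients, at least one of the six quadratic coefficients $a_0,a_1,a_2,b_0,b_1,b_2$ being nonzero. Let $J_0=\{(x,y)\in\mathbb{R}^2 : \det DF(x,y)=0\}$ be its critical set and $J_1=F(J_0)$ its critical image. Then $J_0$ and $J_1$ take on one of the following forms: \begin{enumerate} \item $J_0$ is empty; $J_1$ is empty. \item $J_0$ is a point; $J_1$ is a point. \item $J_0$ is an ellipse; $J_1$ is a closed curve with three cusp points. \item $J_0$ is a hyperbola; $J_1$ consists of two curves, one smooth, and the other smooth except for a single cusp; each of the two curves is the image of one branch of the hyperbola. \item $J_0$ is a pair of intersecting lines; $J_1$ is one of the following: (a) the union of two rays emanating from the same point; (b) the union of a ray and a parabola sharing a common point. \item $J_0$ is a parabola; $J_1$ is a curve with a single cusp. \item $J_0$ is a pair of parallel lines: (a) if the lines are distinct, then $J_1$ is the union of a line and a point, where one of the lines in $J_0$ maps to the line in $J_1$ and the other line in $J_0$ maps to the point in $J_1$; (b) if the lines are coincident, then $J_1$ is a point. \item $J_0$ is a simple line; $J_1$ is one of the following: (a) a point; (b) a line; (c) a parabola. \item $J_0$ is all of $\mathbb{R}^2$; $J_1$ is one of the following: (a) a line; (b) a ray; (c) a parabola. \end{enumerate}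
   Context: Here $DF(x,y)$ is the $2\times 2$ Jacobian matrix of $F$. Its determinant is a polynomial of degree at most two in $(x,y)$, so $J_0$ is a (possibly degenerate) conic section. Conventions on $J_0$: ellipse (circles included), hyperbola and parabola mean nondegenerate real conics, and a pair of intersecting lines means two distinct lines crossing at one point. The forms of $J_0$ are distinguished as zero sets counted with multiplicity: "a pair of coincident (parallel) lines" means that $\det DF$ is a nonzero constant times the square of a nonconstant affine function of $(x,y)$ (so that as a set $J_0$ is one line), whereas "a simple line" means that $\det DF$ has no quadratic terms and is itself a nonconstant affine function of $(x,y)$. Conventions on $J_1$: a ray is a closed half-line; a parabola is nondegenerate. When $J_0$ is an ellipse, hyperbola or parabola, $J_1$ is regarded as the plane curve (or, for a hyperbola, the two plane curves) parametrized by $\boldsymbol\alpha=F\circ\gamma$, where $\gamma$ is a smooth regular parametrization of $J_0$ (respectively, of each of the two branches of the hyperbola). Such a curve is smooth at a parameter value $t$ if $\boldsymbol\alpha'(t)\neq(0,0)$. A cusp is a non-smooth point of the curve at which the parts of the curve on the two sides have a common tangent line and the tangent vector switches direction as one passes through the point; cusps here are of order $3/2$, i.e. of the type of the curve $t\mapsto(at^2,bt^3)$ with $a,b\neq 0$ at $t=0$: at a cusp parameter $t_0$, after translating $t_0$ to $0$ and applying an invertible affine map of the plane, the curve has the form $t\mapsto(at^2+O(t^3),\,bt^3+O(t^4))$ with $a,b\neq0$. A curve "with three cusp points" (respectively "with a single cusp") has exactly three cusps (respectively one cusp) and is smooth at all other parameter values (for a closed curve, over one period). *)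

theory Defs
  imports "HOL-Analysis.Analysis" "HOL-Library.Landau_Symbols"
begin

definition quadratic_map :: "(nat \<Rightarrow> real) \<Rightarrow> (nat \<Rightarrow> real) \<Rightarrow> real^2 \<Rightarrow> real^2" where
  "quadratic_map a b p = (let x = p $ 1; y = p $ 2 in vector
     [a 0 * x\<^sup>2 + a 1 * x * y + a 2 * y\<^sup>2 + a 3 * x + a 4 * y + a 5,
      b 0 * x\<^sup>2 + b 1 * x * y + b 2 * y\<^sup>2 + b 3 * x + b 4 * y + b 5])"

definition jacobian_det :: "(real^2 \<Rightarrow> real^2) \<Rightarrow> real^2 \<Rightarrow> real" where
  "jacobian_det F p = det (jacobian F (at p))"

definition critical_set :: "(real^2 \<Rightarrow> real^2) \<Rightarrow> (real^2) set" where
  "critical_set F = {p. jacobian_det F p = 0}"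

definition critical_image :: "(real^2 \<Rightarrow> real^2) \<Rightarrow> (real^2) set" where
  "critical_image F = F ` critical_set F"

definition is_line :: "(real^2) set \<Rightarrow> bool" where
  "is_line S \<longleftrightarrow> (\<exists>p v. v \<noteq> 0 \<and> S = {p + t *\<^sub>R v | t. True})"

definition is_ray_from :: "real^2 \<Rightarrow> (real^2) set \<Rightarrow> bool" where
  "is_ray_from p S \<longleftrightarrow> (\<exists>v. v \<noteq> 0 \<and> S = {p + t *\<^sub>R v | t. t \<ge> 0})"

definition is_ray :: "(real^2) set \<Rightarrow> bool" where
  "is_ray S \<longleftrightarrow> (\<exists>p. is_ray_from p S)"

definition conic :: "real \<Rightarrow> real \<Rightarrow> real \<Rightarrow> real \<Rightarrow> real \<Rightarrow> real \<Rightarrow> (real^2) set" where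
  "conic A B C D E G =
     {p. A * (p $ 1)\<^sup>2 + B * (p $ 1) * (p $ 2) + C * (p $ 2)\<^sup>2 + D * (p $ 1) + E * (p $ 2) + G = 0}"

text \<open>
  The matrix of the homogenized quadratic form; the conic is nondegenerate iff it is invertible.
\<close>

definition conic_matrix :: "real \<Rightarrow> real \<Rightarrow> real \<Rightarrow> real \<Rightarrow> real \<Rightarrow> real \<Rightarrow> real^3^3" where
  "conic_matrix A B C D E G =
     vector [vector [A, B / 2, D / 2], vector [B / 2, C, E / 2], vector [D / 2, E / 2, G]]"

text \<open>
  Nonemptiness excludes the imaginary ellipses, such as \<open>x\<^sup>2 + y\<^sup>2 + 1 = 0\<close>; nondegenerate
  hyperbolas and parabolas always have real points.
\<close>

definition is_ellipse :: "(real^2) set \<Rightarrow> bool" where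
  "is_ellipse S \<longleftrightarrow> S \<noteq> {} \<and> (\<exists>A B C D E G. S = conic A B C D E G \<and>
     det (conic_matrix A B C D E G) \<noteq> 0 \<and> B\<^sup>2 - 4 * A * C < 0)"

definition is_hyperbola :: "(real^2) set \<Rightarrow> bool" where
  "is_hyperbola S \<longleftrightarrow> (\<exists>A B C D E G. S = conic A B C D E G \<and>
     det (conic_matrix A B C D E G) \<noteq> 0 \<and> B\<^sup>2 - 4 * A * C > 0)"

definition is_parabola :: "(real^2) set \<Rightarrow> bool" where
  "is_parabola S \<longleftrightarrow> (\<exists>A B C D E G. S = conic A B C D E G \<and>
     det (conic_matrix A B C D E G) \<noteq> 0 \<and> B\<^sup>2 - 4 * A * C = 0)"

definition crosses_as_two_lines :: "(real^2) set \<Rightarrow> (real^2) set \<Rightarrow> (real^2) set \<Rightarrow> bool" where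
  "crosses_as_two_lines L\<^sub>1 L\<^sub>2 S \<longleftrightarrow>
     is_line L\<^sub>1 \<and> is_line L\<^sub>2 \<and> (\<exists>p. L\<^sub>1 \<inter> L\<^sub>2 = {p}) \<and> S = L\<^sub>1 \<union> L\<^sub>2"

definition parallel_as_two_lines :: "(real^2) set \<Rightarrow> (real^2) set \<Rightarrow> (real^2) set \<Rightarrow> bool" where
  "parallel_as_two_lines L\<^sub>1 L\<^sub>2 S \<longleftrightarrow>
     is_line L\<^sub>1 \<and> is_line L\<^sub>2 \<and> L\<^sub>1 \<inter> L\<^sub>2 = {} \<and> S = L\<^sub>1 \<union> L\<^sub>2"

text \<open>
  The next two notions concern the zero set counted with multiplicity, so they are properties of
  the defining function \<open>h\<close> rather than of the set \<open>{p. h p = 0}\<close>.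
\<close>

definition zero_set_is_coincident_lines :: "(real^2 \<Rightarrow> real) \<Rightarrow> bool" where
  "zero_set_is_coincident_lines h \<longleftrightarrow>
     (\<exists>k u c. k \<noteq> 0 \<and> u \<noteq> 0 \<and> (\<forall>p. h p = k * (u \<bullet> p + c)\<^sup>2))"

definition zero_set_is_simple_line :: "(real^2 \<Rightarrow> real) \<Rightarrow> bool" where
  "zero_set_is_simple_line h \<longleftrightarrow> (\<exists>u c. u \<noteq> 0 \<and> (\<forall>p. h p = u \<bullet> p + c))"

definition velocity :: "(real \<Rightarrow> real^2) \<Rightarrow> real \<Rightarrow> real^2" where
  "velocity \<alpha> t = vector_derivative \<alpha> (at t)"

definition infinitely_differentiable :: "(real \<Rightarrow> real^2) \<Rightarrow> bool" where
  "infinitely_differentiable \<gamma> \<longleftrightarrow> (\<forall>n t. (velocity ^^ n) \<gamma> differentiable (at t))"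

definition smooth_at :: "(real \<Rightarrow> real^2) \<Rightarrow> real \<Rightarrow> bool" where
  "smooth_at \<alpha> t \<longleftrightarrow> velocity \<alpha> t \<noteq> 0"

definition smooth_regular :: "(real \<Rightarrow> real^2) \<Rightarrow> bool" where
  "smooth_regular \<gamma> \<longleftrightarrow> infinitely_differentiable \<gamma> \<and> (\<forall>t. velocity \<gamma> t \<noteq> 0)"

text \<open>
  Parametrizations traverse the curve once: an open curve is parametrized bijectively by the whole
  real line, a closed one bijectively by each period.
\<close>

definition open_parametrization :: "(real \<Rightarrow> real^2) \<Rightarrow> (real^2) set \<Rightarrow> bool" where
  "open_parametrization \<gamma> S \<longleftrightarrow> smooth_regular \<gamma> \<and> inj \<gamma> \<and> range \<gamma> = S"

definition closed_parametrization :: "(real \<Rightarrow> real^2) \<Rightarrow> real \<Rightarrow> (real^2) set \<Rightarrow> bool" where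
  "closed_parametrization \<gamma> T S \<longleftrightarrow> smooth_regular \<gamma> \<and> T > 0 \<and> (\<forall>t. \<gamma> (t + T) = \<gamma> t) \<and>
     inj_on \<gamma> {0..<T} \<and> range \<gamma> = S"

text \<open>
  The unit tangent vector has opposite one-sided limits, so the two parts of the curve have a common
  tangent line and the direction of travel along it is reversed.
\<close>

definition tangent_switches_at :: "(real \<Rightarrow> real^2) \<Rightarrow> real \<Rightarrow> bool" where
  "tangent_switches_at \<alpha> t\<^sub>0 \<longleftrightarrow> (\<exists>v. v \<noteq> 0 \<and>
     ((\<lambda>t. sgn (velocity \<alpha> t)) \<longlongrightarrow> v) (at_right t\<^sub>0) \<and>
     ((\<lambda>t. sgn (velocity \<alpha> t)) \<longlongrightarrow> - v) (at_left t\<^sub>0))"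

definition order_three_halves_at :: "(real \<Rightarrow> real^2) \<Rightarrow> real \<Rightarrow> bool" where
  "order_three_halves_at \<alpha> t\<^sub>0 \<longleftrightarrow> (\<exists>(M :: real^2^2) w a b. invertible M \<and> a \<noteq> 0 \<and> b \<noteq> 0 \<and>
     (\<lambda>t. (M *v \<alpha> (t\<^sub>0 + t) + w) $ 1 - a * t ^ 2) \<in> O[at 0](\<lambda>t. t ^ 3) \<and>
     (\<lambda>t. (M *v \<alpha> (t\<^sub>0 + t) + w) $ 2 - b * t ^ 3) \<in> O[at 0](\<lambda>t. t ^ 4))"

definition is_cusp :: "(real \<Rightarrow> real^2) \<Rightarrow> real \<Rightarrow> bool" where
  "is_cusp \<alpha> t\<^sub>0 \<longleftrightarrow>
     \<not> smooth_at \<alpha> t\<^sub>0 \<and> tangent_switches_at \<alpha> t\<^sub>0 \<and> order_three_halves_at \<alpha> t\<^sub>0"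

definition smooth_curve :: "(real \<Rightarrow> real^2) \<Rightarrow> bool" where
  "smooth_curve \<alpha> \<longleftrightarrow> (\<forall>t. smooth_at \<alpha> t)"

definition single_cusp_curve :: "(real \<Rightarrow> real^2) \<Rightarrow> bool" where
  "single_cusp_curve \<alpha> \<longleftrightarrow> (\<exists>t\<^sub>0. is_cusp \<alpha> t\<^sub>0 \<and> (\<forall>t. t \<noteq> t\<^sub>0 \<longrightarrow> smooth_at \<alpha> t))"

text \<open>
  Injectivity on the cusp parameters says that the three cusps are three different points.
\<close>

definition closed_three_cusp_curve :: "(real \<Rightarrow> real^2) \<Rightarrow> real \<Rightarrow> bool" where
  "closed_three_cusp_curve \<alpha> T \<longleftrightarrow> (\<forall>t. \<alpha> (t + T) = \<alpha> t) \<and>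
     (\<exists>C \<subseteq> {0..<T}. card C = 3 \<and> inj_on \<alpha> C \<and> (\<forall>t \<in> C. is_cusp \<alpha> t) \<and>
        (\<forall>t \<in> {0..<T} - C. smooth_at \<alpha> t))"

text \<open>
  The image under \<open>F\<close> of a curve \<open>S\<close>, regarded as a parametrized curve \<open>F \<circ> \<gamma>\<close>, has property
  \<open>P\<close>. As \<open>P\<close> should not depend on the parametrization, it is required of every parametrization
  \<open>\<gamma>\<close> of \<open>S\<close>; the existential conjunct makes sure that there is one.
\<close>

definition open_image_curve ::
    "((real \<Rightarrow> real^2) \<Rightarrow> bool) \<Rightarrow> (real^2 \<Rightarrow> real^2) \<Rightarrow> (real^2) set \<Rightarrow> bool" where
  "open_image_curve P F S \<longleftrightarrow> (\<exists>\<gamma>. open_parametrization \<gamma> S) \<and>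
     (\<forall>\<gamma>. open_parametrization \<gamma> S \<longrightarrow> P (F \<circ> \<gamma>))"

definition closed_image_curve ::
    "((real \<Rightarrow> real^2) \<Rightarrow> real \<Rightarrow> bool) \<Rightarrow> (real^2 \<Rightarrow> real^2) \<Rightarrow> (real^2) set \<Rightarrow> bool" where
  "closed_image_curve P F S \<longleftrightarrow> (\<exists>\<gamma> T. closed_parametrization \<gamma> T S) \<and>
     (\<forall>\<gamma> T. closed_parametrization \<gamma> T S \<longrightarrow> P (F \<circ> \<gamma>) T)"

end

theory Submission
  imports Defs
begin

text \<open>
  Everything in the classification is unchanged when \<open>F\<close> is replaced by \<open>A \<circ> F \<circ> B\<close> with affine
  isomorphisms \<open>A\<close> and \<open>B\<close> of the plane: \<open>J\<^sub>0\<close> is pulled back by \<open>B\<close>, \<open>J\<^sub>1\<close> is mapped by \<open>A\<close>, and lines,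
  rays, nondegenerate conics, components, smooth points and cusps go to objects of the same kind
  (lemma \<open>has_listed_form_affine\<close>). So it suffices to look at one map in each orbit, and there are
  only finitely many orbits.

  To find them, consider the leading forms \<open>(q\<^sub>1, q\<^sub>2)\<close> of the two components. If they are linearly
  independent, their Jacobian determinant is a nonzero binary quadratic form, and it determines the
  plane spanned by \<open>q\<^sub>1\<close> and \<open>q\<^sub>2\<close>, because its coefficients are, up to factors, the Pluecker
  coordinates of this plane.
  A linear substitution makes the Jacobian a multiple of \<open>x\<^sup>2 + y\<^sup>2\<close>, \<open>x y\<close> or \<open>x\<^sup>2\<close>
  (lemma \<open>binary_form_normal_form\<close>); after a linear change of the target, \<open>(q\<^sub>1, q\<^sub>2)\<close> is then
  \<open>(x\<^sup>2 - y\<^sup>2, x y)\<close>, \<open>(x\<^sup>2, y\<^sup>2)\<close> or \<open>(x\<^sup>2, x y)\<close>. Translations, scalings and shears remove most of the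
  linear terms. What is left in the three cases is, up to factors:
  \<^item> the complex maps \<open>z\<^sup>2\<close> and \<open>z\<^sup>2 + 2 cnj z\<close>; the second maps the unit circle to a deltoid;
  \<^item> \<open>(x\<^sup>2, y\<^sup>2)\<close>, \<open>(x\<^sup>2 + y, y\<^sup>2)\<close> and \<open>(x\<^sup>2 + 2 y, y\<^sup>2 + 2 x)\<close>; the last one is critical on the
  hyperbola \<open>x y = 1\<close>;
  \<^item> \<open>(x\<^sup>2, x y)\<close>, \<open>(x\<^sup>2 + x, x y)\<close> and \<open>(x\<^sup>2 + y, x y)\<close>; the last one is critical on a parabola.

  If \<open>q\<^sub>1\<close> and \<open>q\<^sub>2\<close> are dependent, one component can be made affine, and ten further maps remain, whose
  critical set is empty, a line or the plane.

  The three maps with a curved critical set are where cusps occur. There \<open>F \<circ> \<gamma>\<close> has velocity \<open>k u\<close>,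
  where the scalar \<open>k\<close> never vanishes and \<open>u\<close> depends on \<open>\<gamma>\<close> polynomially, and moreover \<open>u' = k v\<close> and
  \<open>v' = k w\<close> with such \<open>v\<close> and \<open>w\<close>. A zero of \<open>u\<close> at which \<open>v\<close> and \<open>w\<close> are linearly independent
  is a cusp of order \<open>3/2\<close> (lemma \<open>is_cusp_if_time_changed\<close>). This works for
  every regular parametrization \<open>\<gamma>\<close> at once, without comparing it to a standard one.
\<close>

section \<open>Derivatives of plane curves\<close>

lemma plane_eq_iff: "p = q \<longleftrightarrow> p $ 1 = q $ 1 \<and> p $ 2 = (q $ 2 :: real)" for p q :: "real^2"
  by (simp add: vec_eq_iff forall_2)

lemma plane_eta: "vector [p $ 1, p $ 2] = (p :: real^2)"
  by (simp add: plane_eq_iff)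

lemma has_vector_derivative_plane:
  fixes \<alpha> :: "real \<Rightarrow> real^2"
  shows "(\<alpha> has_vector_derivative d) (at t) \<longleftrightarrow>
    ((\<lambda>t. \<alpha> t $ 1) has_real_derivative d $ 1) (at t) \<and>
    ((\<lambda>t. \<alpha> t $ 2) has_real_derivative d $ 2) (at t)"
proof
  assume "(\<alpha> has_vector_derivative d) (at t)"
  then have "((\<lambda>t. \<alpha> t $ i) has_vector_derivative d $ i) (at t)" for i
    by (rule bounded_linear.has_vector_derivative[OF bounded_linear_vec_nth])
  then show "((\<lambda>t. \<alpha> t $ 1) has_real_derivative d $ 1) (at t) \<and>
    ((\<lambda>t. \<alpha> t $ 2) has_real_derivative d $ 2) (at t)"
    by (simp add: has_real_derivative_iff_has_vector_derivative)
next
  assume *: "((\<lambda>t. \<alpha> t $ 1) has_real_derivative d $ 1) (at t) \<and>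
    ((\<lambda>t. \<alpha> t $ 2) has_real_derivative d $ 2) (at t)"
  have combine: "(p $ 1) *\<^sub>R vector [1, 0] + (p $ 2) *\<^sub>R vector [0, 1] = p" for p :: "real^2"
    by (simp add: plane_eq_iff)
  have "((\<lambda>t. (\<alpha> t $ 1) *\<^sub>R vector [1, 0] + (\<alpha> t $ 2) *\<^sub>R vector [0, 1]) has_vector_derivative
      (d $ 1) *\<^sub>R vector [1, 0] + (d $ 2) *\<^sub>R (vector [0, 1] :: real^2)) (at t)"
    using * by (auto intro!: derivative_eq_intros)
  then show "(\<alpha> has_vector_derivative d) (at t)"
    by (simp add: combine)
qed

text \<open>
  A whole sequence of derivatives is easier to transform and to exhibit than the iterated \<open>velocity\<close>
  operator, which is only meaningful once differentiability is known.
\<close>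

lemma infinitely_differentiable_iff:
  "infinitely_differentiable \<gamma> \<longleftrightarrow>
    (\<exists>g. g 0 = \<gamma> \<and> (\<forall>n t. (g n has_vector_derivative g (Suc n) t) (at t)))"
proof
  assume "infinitely_differentiable \<gamma>"
  then have "\<forall>n t. ((velocity ^^ n) \<gamma> has_vector_derivative (velocity ^^ Suc n) \<gamma> t) (at t)"
    by (simp add: infinitely_differentiable_def velocity_def vector_derivative_works[symmetric])
  then show "\<exists>g. g 0 = \<gamma> \<and> (\<forall>n t. (g n has_vector_derivative g (Suc n) t) (at t))"
    by (intro exI[of _ "\<lambda>n. (velocity ^^ n) \<gamma>"]) auto
next
  assume "\<exists>g. g 0 = \<gamma> \<and> (\<forall>n t. (g n has_vector_derivative g (Suc n) t) (at t))"
  then obtain g where g: "g 0 = \<gamma>" "\<And>n t. (g n has_vector_derivative g (Suc n) t) (at t)"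
    by blast
  have "(velocity ^^ n) \<gamma> = g n" for n
  proof (induction n)
    case (Suc n)
    have "velocity (g n) = g (Suc n)"
      using g(2) by (auto simp: velocity_def fun_eq_iff vector_derivative_at)
    with Suc show ?case by simp
  qed (simp add: g)
  then show "infinitely_differentiable \<gamma>"
    unfolding infinitely_differentiable_def
    using g(2) by (metis differentiableI_vector)
qed

lemma velocity_eq: "(\<alpha> has_vector_derivative d) (at t) \<Longrightarrow> velocity \<alpha> t = d"
  by (simp add: velocity_def vector_derivative_at)

text \<open>
  The mean value theorem turns a bound on the derivative into a bound of one order higher.
\<close>

lemma bigo_primitive:
  fixes f f' :: "real \<Rightarrow> real"
  assumes der: "\<And>t. (f has_real_derivative f' t) (at t)"
    and f': "f' \<in> O[at 0](\<lambda>t. t ^ n)" and "f 0 = 0"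
  shows "f \<in> O[at 0](\<lambda>t. t ^ Suc n)"
proof -
  from f' obtain c where c: "c > 0" "\<forall>\<^sub>F t in at 0. \<bar>f' t\<bar> \<le> c * \<bar>t\<bar> ^ n"
    by (elim landau_o.bigE) (auto simp: power_abs)
  then obtain e where e: "e > 0" "\<And>t. t \<noteq> 0 \<Longrightarrow> \<bar>t\<bar> < e \<Longrightarrow> \<bar>f' t\<bar> \<le> c * \<bar>t\<bar> ^ n"
    by (auto simp: eventually_at dist_norm)
  have "\<bar>f t\<bar> \<le> c * \<bar>t\<bar> ^ Suc n" if t: "t \<noteq> 0" "\<bar>t\<bar> < e" for t
  proof -
    obtain z where z: "z \<noteq> 0" "\<bar>z\<bar> \<le> \<bar>t\<bar>" "f t = t * f' z"
    proof (cases "t > 0")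
      case True
      then obtain z where "0 < z" "z < t" "f t - f 0 = (t - 0) * f' z"
        using MVT2[of 0 t f f'] der by blast
      then show ?thesis using that[of z] \<open>f 0 = 0\<close> by auto
    next
      case False
      then obtain z where "t < z" "z < 0" "f 0 - f t = (0 - t) * f' z"
        using MVT2[of t 0 f f'] der t by force
      then show ?thesis using that[of z] \<open>f 0 = 0\<close> by auto
    qed
    have "\<bar>f t\<bar> = \<bar>t\<bar> * \<bar>f' z\<bar>" by (simp add: z abs_mult)
    also have "\<dots> \<le> \<bar>t\<bar> * (c * \<bar>z\<bar> ^ n)"
      using e(2)[of z] z t by (intro mult_left_mono) auto
    also have "\<dots> \<le> \<bar>t\<bar> * (c * \<bar>t\<bar> ^ n)"
      using z c(1) by (intro mult_left_mono power_mono) auto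
    finally show ?thesis by (simp add: mult_ac)
  qed
  then show ?thesis
    using e(1) by (intro landau_o.bigI[OF c(1)]) (auto simp: eventually_at dist_norm power_abs abs_mult)
qed

text \<open>
  The remainder has order four although the third derivative is only differentiable at the
  expansion point: its increment is \<open>O(t)\<close>, and three integrations raise the order by three.
\<close>

lemma taylor_order_three:
  fixes f f1 f2 f3 :: "real \<Rightarrow> real"
  assumes "\<And>t. (f has_real_derivative f1 t) (at t)"
    and "\<And>t. (f1 has_real_derivative f2 t) (at t)"
    and "\<And>t. (f2 has_real_derivative f3 t) (at t)"
    and "f3 differentiable (at 0)"
  shows "(\<lambda>t. f t - (f 0 + f1 0 * t + f2 0 * t ^ 2 / 2 + f3 0 * t ^ 3 / 6)) \<in> O[at 0](\<lambda>t. t ^ 4)"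
proof -
  obtain d where "(f3 has_real_derivative d) (at 0)"
    using assms(4) by (auto simp: real_differentiable_def)
  then have "((\<lambda>t. (f3 t - f3 0) / t) \<longlongrightarrow> d) (at 0)"
    by (simp add: has_field_derivative_iff)
  then have "(\<lambda>t. (f3 t - f3 0) / t) \<in> O[at 0](\<lambda>t. 1)"
    by (intro bigoI_tendsto[of _ _ d]) auto
  then have "(\<lambda>t. (f3 t - f3 0) / t * t) \<in> O[at 0](\<lambda>t. 1 * t)"
    by (rule landau_o.big.mult) simp
  moreover have "\<forall>\<^sub>F t in at 0. (f3 t - f3 0) / t * t = f3 t - f3 0"
    by (auto simp: eventually_at intro: exI[of _ 1])
  ultimately have "(\<lambda>t. f3 t - f3 0) \<in> O[at 0](\<lambda>t. t ^ 1)"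
    by (simp add: landau_o.big.in_cong)
  then have "(\<lambda>t. f2 t - (f2 0 + f3 0 * t)) \<in> O[at 0](\<lambda>t. t ^ Suc 1)"
    by (rule bigo_primitive[rotated]) (auto intro!: derivative_eq_intros assms)
  then have "(\<lambda>t. f1 t - (f1 0 + f2 0 * t + f3 0 * t ^ 2 / 2)) \<in> O[at 0](\<lambda>t. t ^ Suc (Suc 1))"
    by (rule bigo_primitive[rotated]) (auto intro!: derivative_eq_intros assms)
  then have "(\<lambda>t. f t - (f 0 + f1 0 * t + f2 0 * t ^ 2 / 2 + f3 0 * t ^ 3 / 6))
      \<in> O[at 0](\<lambda>t. t ^ Suc (Suc (Suc 1)))"
    by (rule bigo_primitive[rotated]) (auto intro!: derivative_eq_intros assms simp: field_simps power2_eq_square)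
  then show ?thesis
    by (simp add: numeral_eq_Suc)
qed

definition wedge :: "real^2 \<Rightarrow> real^2 \<Rightarrow> real" where
  "wedge v w = v $ 1 * w $ 2 - v $ 2 * w $ 1"

lemma has_vector_derivative_shift:
  assumes "(\<alpha> has_vector_derivative d) (at (t0 + t))"
  shows "((\<lambda>t. \<alpha> (t0 + t)) has_vector_derivative d) (at t)"
proof -
  have "((\<lambda>t. t0 + t) has_vector_derivative 1) (at t)"
    by (auto intro!: derivative_eq_intros)
  from vector_diff_chain_at[OF this assms] show ?thesis
    by (simp add: o_def)
qed

text \<open>
  Near \<open>t0\<close> the velocity is \<open>(t - t0) (d + o(1))\<close>, so its direction is that of \<open>d\<close> on the right and
  the opposite one on the left.
\<close>

lemma tangent_switches_if_simple_zero:
  assumes \<alpha>: "\<And>t. (\<alpha> has_vector_derivative \<alpha>1 t) (at t)"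
    and \<alpha>1: "(\<alpha>1 has_vector_derivative d) (at t0)"
    and "\<alpha>1 t0 = 0" "d \<noteq> 0"
  shows "tangent_switches_at \<alpha> t0"
proof -
  have lim: "((\<lambda>t. sgn ((1 / (t - t0)) *\<^sub>R \<alpha>1 t)) \<longlongrightarrow> sgn d) (at t0)"
  proof (rule tendsto_sgn[OF vec_tendstoI \<open>d \<noteq> 0\<close>])
    fix i :: 2
    show "((\<lambda>t. ((1 / (t - t0)) *\<^sub>R \<alpha>1 t) $ i) \<longlongrightarrow> d $ i) (at t0)"
      using \<alpha>1 \<open>\<alpha>1 t0 = 0\<close> exhaust_2[of i]
      by (auto simp: has_vector_derivative_plane has_field_derivative_iff)
  qed
  have "((\<lambda>t. sgn (\<alpha>1 t)) \<longlongrightarrow> sgn d) (at_right t0)"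
    using filterlim_mono[OF lim order_refl at_le[of _ UNIV]]
    by (rule Lim_transform_eventually) (auto simp: eventually_at_filter sgn_scaleR)
  moreover have "((\<lambda>t. sgn (\<alpha>1 t)) \<longlongrightarrow> - sgn d) (at_left t0)"
    using tendsto_minus[OF filterlim_mono[OF lim order_refl at_le[of _ UNIV]]]
    by (rule Lim_transform_eventually) (auto simp: eventually_at_filter sgn_scaleR)
  moreover have "velocity \<alpha> = \<alpha>1"
    using \<alpha> velocity_eq by blast
  ultimately show ?thesis
    unfolding tangent_switches_at_def using \<open>d \<noteq> 0\<close>
    by (intro exI[of _ "sgn d"]) (simp add: sgn_zero_iff)
qed

text \<open>
  In the basis formed by the second and the third derivative at \<open>t0\<close>, the Taylor expansion of the
  curve is \<open>(t\<^sup>2 / 2, t\<^sup>3 / 6)\<close> up to terms of order four.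
\<close>

lemma is_cusp_if_wedge_nonzero:
  assumes \<alpha>: "\<And>t. (\<alpha> has_vector_derivative \<alpha>1 t) (at t)"
    and \<alpha>1: "\<And>t. (\<alpha>1 has_vector_derivative \<alpha>2 t) (at t)"
    and \<alpha>2: "\<And>t. (\<alpha>2 has_vector_derivative \<alpha>3 t) (at t)"
    and \<alpha>3: "\<alpha>3 differentiable (at t0)"
    and zero: "\<alpha>1 t0 = 0" and nz: "wedge (\<alpha>2 t0) (\<alpha>3 t0) \<noteq> 0"
  shows "is_cusp \<alpha> t0"
proof -
  define D where "D = wedge (\<alpha>2 t0) (\<alpha>3 t0)"
  define M :: "real^2^2" where
    "M = vector [vector [\<alpha>3 t0 $ 2 / D, - \<alpha>3 t0 $ 1 / D], vector [- \<alpha>2 t0 $ 2 / D, \<alpha>2 t0 $ 1 / D]]"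
  have M: "(M *v p) $ 1 = wedge p (\<alpha>3 t0) / D" "(M *v p) $ 2 = wedge (\<alpha>2 t0) p / D" for p
    by (simp_all add: M_def wedge_def matrix_vector_mult_def sum_2 diff_divide_distrib mult.commute)
  have "D \<noteq> 0" using nz by (simp add: D_def)
  have "det M = 1 / D"
    using \<open>D \<noteq> 0\<close> by (simp add: M_def det_2 field_simps) (simp add: D_def wedge_def algebra_simps)
  then have inv: "invertible M"
    using \<open>D \<noteq> 0\<close> by (simp add: invertible_det_nz)
  have M2: "(M *v \<alpha>2 t0) $ 1 = 1" "(M *v \<alpha>2 t0) $ 2 = 0"
    and M3: "(M *v \<alpha>3 t0) $ 1 = 0" "(M *v \<alpha>3 t0) $ 2 = 1"
    using \<open>D \<noteq> 0\<close> by (auto simp: M D_def[symmetric]) (auto simp: wedge_def)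
  have comp: "((\<lambda>t. (M *v \<beta> (t0 + t)) $ i) has_real_derivative (M *v \<beta>' (t0 + t)) $ i) (at t)"
    if "\<And>t. (\<beta> has_vector_derivative \<beta>' t) (at t)" for \<beta> \<beta>' i t
  proof -
    have "bounded_linear (\<lambda>p. (M *v p) $ i)"
      by (rule bounded_linear_compose[OF bounded_linear_vec_nth matrix_vector_mul_bounded_linear])
    from bounded_linear.has_vector_derivative[OF this has_vector_derivative_shift[OF that]]
    show ?thesis by (simp add: has_real_derivative_iff_has_vector_derivative)
  qed
  have diff: "(\<lambda>t. (M *v \<alpha>3 (t0 + t)) $ i) differentiable (at 0)" for i
  proof -
    obtain d where "(\<alpha>3 has_vector_derivative d) (at (t0 + 0))"
      using \<alpha>3 by (auto simp: vector_derivative_works)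
    note * = has_vector_derivative_shift[OF this]
    have "bounded_linear (\<lambda>p. (M *v p) $ i)"
      by (rule bounded_linear_compose[OF bounded_linear_vec_nth matrix_vector_mul_bounded_linear])
    from bounded_linear.has_vector_derivative[OF this *]
    show ?thesis by (rule differentiableI_vector)
  qed
  note taylor = taylor_order_three[OF comp[OF \<alpha>] comp[OF \<alpha>1] comp[OF \<alpha>2] diff, unfolded add_0_right]
  define w where "w = - (M *v \<alpha> t0)"
  have "(\<lambda>t. (M *v \<alpha> (t0 + t) + w) $ 1 - 1 / 2 * t ^ 2) \<in> O[at 0](\<lambda>t. t ^ 4)"
    using taylor[of 1] by (simp add: zero M2 M3 w_def algebra_simps)
  also have "(\<lambda>t::real. t ^ 4) \<in> O[at 0](\<lambda>t. t ^ 3)"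
    by (intro landau_o.bigI[of 1]) (auto simp: eventually_at power_abs abs_mult numeral_eq_Suc intro!: exI[of _ 1] mult_left_le_one_le)
  finally have 1: "(\<lambda>t. (M *v \<alpha> (t0 + t) + w) $ 1 - 1 / 2 * t ^ 2) \<in> O[at 0](\<lambda>t. t ^ 3)" .
  have 2: "(\<lambda>t. (M *v \<alpha> (t0 + t) + w) $ 2 - 1 / 6 * t ^ 3) \<in> O[at 0](\<lambda>t. t ^ 4)"
    using taylor[of 2] by (simp add: zero M2 M3 w_def algebra_simps)
  have "order_three_halves_at \<alpha> t0"
    unfolding order_three_halves_at_def
    by (intro exI[of _ M] exI[of _ w] exI[of _ "1/2"] exI[of _ "1/6"] conjI inv 1 2) auto
  moreover have "\<alpha>2 t0 \<noteq> 0"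
    using nz by (auto simp: wedge_def)
  then have "tangent_switches_at \<alpha> t0"
    using tangent_switches_if_simple_zero \<alpha> \<alpha>1 zero by blast
  ultimately show ?thesis
    using velocity_eq[OF \<alpha>] zero by (simp add: is_cusp_def smooth_at_def)
qed

text \<open>
  A cusp does not depend on the speed at which the curve is traversed. With \<open>u\<close>, \<open>v\<close> and \<open>w\<close> as the
  derivatives with respect to a parameter of speed \<open>k\<close>, the second and the third derivative of the
  curve at a zero of \<open>u\<close> are \<open>k\<^sup>2 v\<close> and \<open>3 k k1 v + k\<^sup>3 w\<close>; their determinant is \<open>k\<^sup>5\<close> times that of
  \<open>v\<close> and \<open>w\<close>.
\<close>

lemma is_cusp_if_time_changed:
  assumes \<alpha>: "\<And>t. (\<alpha> has_vector_derivative k t *\<^sub>R u t) (at t)"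
    and u: "\<And>t. (u has_vector_derivative k t *\<^sub>R v t) (at t)"
    and v: "\<And>t. (v has_vector_derivative k t *\<^sub>R w t) (at t)"
    and w: "w differentiable (at t0)"
    and k: "\<And>t. (k has_real_derivative k1 t) (at t)"
    and k1: "\<And>t. (k1 has_real_derivative k2 t) (at t)"
    and k2: "k2 differentiable (at t0)"
    and "k t0 \<noteq> 0" "u t0 = 0" "wedge (v t0) (w t0) \<noteq> 0"
  shows "is_cusp \<alpha> t0"
proof (rule is_cusp_if_wedge_nonzero[OF \<alpha>])
  show "((\<lambda>t. k t *\<^sub>R u t) has_vector_derivative k1 t *\<^sub>R u t + (k t)\<^sup>2 *\<^sub>R v t) (at t)" for t
    by (rule derivative_eq_intros k u refl)+ (simp add: power2_eq_square algebra_simps)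
  show "((\<lambda>t. k1 t *\<^sub>R u t + (k t)\<^sup>2 *\<^sub>R v t) has_vector_derivative
      k2 t *\<^sub>R u t + (3 * k t * k1 t) *\<^sub>R v t + (k t) ^ 3 *\<^sub>R w t) (at t)" for t
    by (rule derivative_eq_intros k k1 u v refl)+
      (simp add: power2_eq_square power3_eq_cube algebra_simps flip: scaleR_add_left)
  have "k differentiable (at t0)" "k1 differentiable (at t0)"
    using k k1 real_differentiable_def by blast+
  moreover have "u differentiable (at t0)" "v differentiable (at t0)"
    using u v differentiableI_vector by blast+
  ultimately show "(\<lambda>t. k2 t *\<^sub>R u t + (3 * k t * k1 t) *\<^sub>R v t + (k t) ^ 3 *\<^sub>R w t) differentiable (at t0)"
    using k2 w by (intro derivative_intros) auto
  show "k t0 *\<^sub>R u t0 = 0" using \<open>u t0 = 0\<close> by simp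
  have "wedge (k1 t0 *\<^sub>R u t0 + (k t0)\<^sup>2 *\<^sub>R v t0)
      (k2 t0 *\<^sub>R u t0 + (3 * k t0 * k1 t0) *\<^sub>R v t0 + (k t0) ^ 3 *\<^sub>R w t0) =
      (k t0) ^ 5 * wedge (v t0) (w t0)"
    using \<open>u t0 = 0\<close> by (simp add: wedge_def algebra_simps eval_nat_numeral)
  then show "wedge (k1 t0 *\<^sub>R u t0 + (k t0)\<^sup>2 *\<^sub>R v t0)
      (k2 t0 *\<^sub>R u t0 + (3 * k t0 * k1 t0) *\<^sub>R v t0 + (k t0) ^ 3 *\<^sub>R w t0) \<noteq> 0"
    using assms by simp
qed

section \<open>Affine isomorphisms of the plane\<close>

definition affine_iso :: "(real^2 \<Rightarrow> real^2) \<Rightarrow> bool" where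
  "affine_iso f \<longleftrightarrow> (\<exists>L w. invertible L \<and> f = (\<lambda>p. L *v p + w))"

lemma affine_isoE:
  assumes "affine_iso f"
  obtains L w where "invertible L" "f = (\<lambda>p. L *v p + w)"
  using assms unfolding affine_iso_def by blast

lemma affine_iso_planeI:
  assumes "l11 * l22 - l12 * l21 \<noteq> 0"
  shows "affine_iso (\<lambda>p. vector [l11 * p $ 1 + l12 * p $ 2 + w1, l21 * p $ 1 + l22 * p $ 2 + w2])"
proof -
  let ?L = "vector [vector [l11, l12], vector [l21, l22]] :: real^2^2"
  have "invertible ?L"
    using assms by (simp add: invertible_det_nz det_2)
  moreover have "?L *v p + vector [w1, w2] =
      vector [l11 * p $ 1 + l12 * p $ 2 + w1, l21 * p $ 1 + l22 * p $ 2 + w2]" for p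
    by (simp add: plane_eq_iff matrix_vector_mult_def sum_2)
  ultimately show ?thesis
    unfolding affine_iso_def by metis
qed

lemma affine_iso_bij_inv:
  assumes "affine_iso f"
  shows "bij f \<and> affine_iso (inv f)"
proof -
  from assms obtain L w where L: "invertible L" and f: "f = (\<lambda>p. L *v p + w)"
    by (rule affine_isoE)
  from L obtain L' where L': "L ** L' = mat 1" "L' ** L = mat 1"
    unfolding invertible_def by blast
  define g where "g = (\<lambda>p. L' *v p + - (L' *v w))"
  have "g (f p) = p" "f (g p) = p" for p
    by (simp_all add: f g_def matrix_vector_right_distrib matrix_vector_mult_diff_distrib matrix_vector_mul_assoc L')
  then have "bij f" "inv f = g"
    by (metis bij_iff, metis inv_equality)
  moreover have "affine_iso g"
    using L' unfolding g_def affine_iso_def invertible_def by blast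
  ultimately show ?thesis by simp
qed

lemmas affine_iso_bij = affine_iso_bij_inv[THEN conjunct1]
  and affine_iso_inv = affine_iso_bij_inv[THEN conjunct2]

lemma affine_iso_continuous: "affine_iso f \<Longrightarrow> continuous_on S f"
  using continuous_on_add[OF linear_continuous_on[OF matrix_vector_mul_bounded_linear] continuous_on_const]
  unfolding affine_iso_def by blast

lemma is_line_affine_image:
  assumes "affine_iso f" "is_line S"
  shows "is_line (f ` S)"
proof -
  from assms obtain L w p v where L: "invertible L" and f: "f = (\<lambda>p. L *v p + w)"
    and v: "v \<noteq> 0" and S: "S = {p + t *\<^sub>R v | t. True}"
    by (auto elim!: affine_isoE simp: is_line_def)
  have "L *v v \<noteq> 0"
    using L v by (metis invertible_def matrix_left_invertible_ker)
  moreover have "f (p + t *\<^sub>R v) = f p + t *\<^sub>R (L *v v)" for t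
    by (simp add: f matrix_vector_right_distrib matrix_vector_mult_scaleR)
  then have "f ` S = {f p + t *\<^sub>R (L *v v) | t. True}"
    unfolding S image_def by force
  ultimately show ?thesis
    unfolding is_line_def by blast
qed

lemma is_ray_from_affine_image:
  assumes "affine_iso f" "is_ray_from p S"
  shows "is_ray_from (f p) (f ` S)"
proof -
  from assms obtain L w v where L: "invertible L" and f: "f = (\<lambda>p. L *v p + w)"
    and v: "v \<noteq> 0" and S: "S = {p + t *\<^sub>R v | t. t \<ge> 0}"
    by (auto elim!: affine_isoE simp: is_ray_from_def)
  have "L *v v \<noteq> 0"
    using L v by (metis invertible_def matrix_left_invertible_ker)
  moreover have "f (p + t *\<^sub>R v) = f p + t *\<^sub>R (L *v v)" for t
    by (simp add: f matrix_vector_right_distrib matrix_vector_mult_scaleR)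
  then have "f ` S = {f p + t *\<^sub>R (L *v v) | t. t \<ge> 0}"
    unfolding S image_def by force
  ultimately show ?thesis
    unfolding is_ray_from_def by blast
qed

text \<open>
  In homogeneous coordinates the affine map is a \<open>3 \<times> 3\<close> matrix \<open>P\<close> whose determinant is that of its
  linear part, and pulling back the conic replaces its matrix \<open>M\<close> by the congruent matrix
  \<open>P\<^sup>T M P\<close>. The discriminant is a multiple of the determinant of the upper left block, which changes
  by congruence with the linear part.
\<close>

lemma conic_affine_preimage:
  assumes "affine_iso f"
  obtains d A' B' C' D' E' G' where "d \<noteq> 0"
    and "f -` conic A B C D E G = conic A' B' C' D' E' G'"
    and "det (conic_matrix A' B' C' D' E' G') = d\<^sup>2 * det (conic_matrix A B C D E G)"
    and "B'\<^sup>2 - 4 * A' * C' = d\<^sup>2 * (B\<^sup>2 - 4 * A * C)"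
proof -
  from assms obtain L w where L: "invertible L" and f: "f = (\<lambda>p. L *v p + w)"
    by (rule affine_isoE)
  define p q r s u v where "p = L $ 1 $ 1" and "q = L $ 1 $ 2" and "r = L $ 2 $ 1" and "s = L $ 2 $ 2"
    and "u = w $ 1" and "v = w $ 2"
  have fxy: "f z $ 1 = p * z $ 1 + q * z $ 2 + u" "f z $ 2 = r * z $ 1 + s * z $ 2 + v" for z
    by (simp_all add: f p_def q_def r_def s_def u_def v_def matrix_vector_mult_def sum_2)
  define A' B' C' D' E' G' where
    "A' = A * p\<^sup>2 + B * p * r + C * r\<^sup>2" and
    "B' = 2 * A * p * q + B * (p * s + q * r) + 2 * C * r * s" and
    "C' = A * q\<^sup>2 + B * q * s + C * s\<^sup>2" and
    "D' = 2 * A * p * u + B * (p * v + r * u) + 2 * C * r * v + D * p + E * r" and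
    "E' = 2 * A * q * u + B * (q * v + s * u) + 2 * C * s * v + D * q + E * s" and
    "G' = A * u\<^sup>2 + B * u * v + C * v\<^sup>2 + D * u + E * v + G"
  note defs = A'_def B'_def C'_def D'_def E'_def G'_def
  have "p * s - q * r \<noteq> 0"
    using L by (simp add: invertible_det_nz det_2 p_def q_def r_def s_def)
  moreover have "f -` conic A B C D E G = conic A' B' C' D' E' G'"
    by (auto simp: conic_def fxy defs power2_eq_square algebra_simps)
  moreover have "det (conic_matrix A' B' C' D' E' G') = (p * s - q * r)\<^sup>2 * det (conic_matrix A B C D E G)"
  proof -
    define P :: "real^3^3" where "P = vector [vector [p, q, u], vector [r, s, v], vector [0, 0, 1]]"
    have "conic_matrix A' B' C' D' E' G' = transpose P ** conic_matrix A B C D E G ** P"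
      by (simp add: vec_eq_iff forall_3 matrix_matrix_mult_def sum_3 transpose_def P_def conic_matrix_def
          defs field_simps power2_eq_square)
    moreover have "det P = p * s - q * r"
      by (simp add: P_def det_3)
    ultimately show ?thesis
      by (simp add: det_mul det_transpose power2_eq_square)
  qed
  moreover have "B'\<^sup>2 - 4 * A' * C' = (p * s - q * r)\<^sup>2 * (B\<^sup>2 - 4 * A * C)"
    unfolding defs power2_eq_square by (simp add: algebra_simps)
  ultimately show ?thesis using that by blast
qed

lemma affine_image_eq_vimage: "affine_iso f \<Longrightarrow> f ` S = inv f -` S"
  using bij_vimage_eq_inv_image[OF affine_iso_bij[OF affine_iso_inv]] inv_inv_eq[OF affine_iso_bij]
  by metis

lemma is_ellipse_affine_image:
  assumes f: "affine_iso f" and S: "is_ellipse S"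
  shows "is_ellipse (f ` S)"
proof -
  from S obtain A B C D E G where "S \<noteq> {}" "S = conic A B C D E G"
    "det (conic_matrix A B C D E G) \<noteq> 0" "B\<^sup>2 - 4 * A * C < 0"
    unfolding is_ellipse_def by blast
  note S = this
  obtain d A' B' C' D' E' G' where "d \<noteq> 0"
    and "inv f -` conic A B C D E G = conic A' B' C' D' E' G'"
    and "det (conic_matrix A' B' C' D' E' G') = d\<^sup>2 * det (conic_matrix A B C D E G)"
    and "B'\<^sup>2 - 4 * A' * C' = d\<^sup>2 * (B\<^sup>2 - 4 * A * C)"
    by (rule conic_affine_preimage[OF affine_iso_inv[OF f]])
  moreover have "f ` S \<noteq> {}"
    using S(1) by simp
  ultimately have "f ` S \<noteq> {}" "f ` S = conic A' B' C' D' E' G'"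
    "det (conic_matrix A' B' C' D' E' G') \<noteq> 0" "B'\<^sup>2 - 4 * A' * C' < 0"
    using S(2-) by (simp_all add: mult_pos_neg affine_image_eq_vimage[OF f])
  then show ?thesis
    unfolding is_ellipse_def by blast
qed

lemma is_hyperbola_affine_image:
  assumes f: "affine_iso f" and S: "is_hyperbola S"
  shows "is_hyperbola (f ` S)"
proof -
  from S obtain A B C D E G where "S = conic A B C D E G"
    "det (conic_matrix A B C D E G) \<noteq> 0" "B\<^sup>2 - 4 * A * C > 0"
    unfolding is_hyperbola_def by blast
  note S = this
  obtain d A' B' C' D' E' G' where "d \<noteq> 0"
    and "inv f -` conic A B C D E G = conic A' B' C' D' E' G'"
    and "det (conic_matrix A' B' C' D' E' G') = d\<^sup>2 * det (conic_matrix A B C D E G)"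
    and "B'\<^sup>2 - 4 * A' * C' = d\<^sup>2 * (B\<^sup>2 - 4 * A * C)"
    by (rule conic_affine_preimage[OF affine_iso_inv[OF f]])
  with S have "f ` S = conic A' B' C' D' E' G'"
    "det (conic_matrix A' B' C' D' E' G') \<noteq> 0" "B'\<^sup>2 - 4 * A' * C' > 0"
    by (auto simp: affine_image_eq_vimage[OF f])
  then show ?thesis
    unfolding is_hyperbola_def by blast
qed

lemma is_parabola_affine_image:
  assumes f: "affine_iso f" and S: "is_parabola S"
  shows "is_parabola (f ` S)"
proof -
  from S obtain A B C D E G where "S = conic A B C D E G"
    "det (conic_matrix A B C D E G) \<noteq> 0" "B\<^sup>2 - 4 * A * C = 0"
    unfolding is_parabola_def by blast
  note S = this
  obtain d A' B' C' D' E' G' where "d \<noteq> 0"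
    and "inv f -` conic A B C D E G = conic A' B' C' D' E' G'"
    and "det (conic_matrix A' B' C' D' E' G') = d\<^sup>2 * det (conic_matrix A B C D E G)"
    and "B'\<^sup>2 - 4 * A' * C' = d\<^sup>2 * (B\<^sup>2 - 4 * A * C)"
    by (rule conic_affine_preimage[OF affine_iso_inv[OF f]])
  with S have "f ` S = conic A' B' C' D' E' G'"
    "det (conic_matrix A' B' C' D' E' G') \<noteq> 0" "B'\<^sup>2 - 4 * A' * C' = 0"
    by (auto simp: affine_image_eq_vimage[OF f])
  then show ?thesis
    unfolding is_parabola_def by blast
qed

lemma components_affine_image:
  assumes f: "affine_iso f"
  shows "components (f ` S) = (`) f ` components S"
proof -
  have sub: "g ` c \<in> components (g ` S)" if g: "affine_iso g" and c: "c \<in> components S" for g c S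
  proof -
    have "d = g ` c" if d: "d \<noteq> {}" "g ` c \<subseteq> d" "d \<subseteq> g ` S" "connected d" for d
    proof -
      have "connected (inv g ` d)"
        using connected_continuous_image affine_iso_continuous affine_iso_inv g d by blast
      moreover have "c \<subseteq> inv g ` d" "inv g ` d \<subseteq> S"
        using d affine_iso_bij[OF g]
        by (metis bij_def image_inv_f_f image_mono)+
      ultimately have "inv g ` d = c"
        using c d by (auto simp: in_components_maximal)
      then show ?thesis
        using affine_iso_bij[OF g] by (metis bij_def image_f_inv_f)
    qed
    moreover have "connected (g ` c)"
      using connected_continuous_image affine_iso_continuous[OF g] in_components_connected[OF c] by blast
    moreover have "g ` c \<noteq> {}" "g ` c \<subseteq> g ` S"
      using in_components_nonempty[OF c] in_components_subset[OF c] by blast+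
    ultimately show ?thesis
      unfolding in_components_maximal by blast
  qed
  have "c \<in> (`) f ` components S" if "c \<in> components (f ` S)" for c
  proof -
    have "inv f ` c \<in> components (inv f ` f ` S)"
      using sub affine_iso_inv f that by blast
    then have "inv f ` c \<in> components S" "c = f ` inv f ` c"
      using affine_iso_bij[OF f] by (simp_all add: bij_def image_inv_f_f image_f_inv_f)
    then show ?thesis by blast
  qed
  then show ?thesis
    using sub f by blast
qed

lemma affine_iso_has_vector_derivative:
  fixes L :: "real^2^2"
  assumes "(\<alpha> has_vector_derivative d) (at t)"
  shows "((\<lambda>t. L *v \<alpha> t + w) has_vector_derivative L *v d) (at t)"
  using has_vector_derivative_add[OF
      bounded_linear.has_vector_derivative[OF matrix_vector_mul_bounded_linear assms]
      has_vector_derivative_const[of w]]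
  by simp

lemma smooth_regular_affine:
  assumes "affine_iso f" "smooth_regular \<gamma>"
  shows "smooth_regular (f \<circ> \<gamma>)"
proof -
  from assms(1) obtain L w where L: "invertible L" and f: "f = (\<lambda>p. L *v p + w)"
    by (rule affine_isoE)
  from assms(2) obtain g where g: "g 0 = \<gamma>" "\<And>n t. (g n has_vector_derivative g (Suc n) t) (at t)"
    by (auto simp: smooth_regular_def infinitely_differentiable_iff)
  have f\<gamma>: "((f \<circ> \<gamma>) has_vector_derivative L *v g 1 t) (at t)" for t
    using affine_iso_has_vector_derivative[OF g(2)[of 0]] g(1) by (simp add: f o_def)
  define h where "h n = (case n of 0 \<Rightarrow> f \<circ> \<gamma> | Suc m \<Rightarrow> \<lambda>t. L *v g n t)" for n
  have "(h n has_vector_derivative h (Suc n) t) (at t)" for n t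
    using f\<gamma> affine_iso_has_vector_derivative[OF g(2), where w = 0]
    by (simp add: h_def split: nat.split)
  then have "infinitely_differentiable (f \<circ> \<gamma>)"
    unfolding infinitely_differentiable_iff by (intro exI[of _ h]) (simp add: h_def)
  moreover have "velocity \<gamma> t = g 1 t" for t
    using g(1) g(2)[of 0 t] by (intro velocity_eq) simp
  then have "g 1 t \<noteq> 0" for t
    using assms(2) unfolding smooth_regular_def by metis
  then have "velocity (f \<circ> \<gamma>) t \<noteq> 0" for t
    using L velocity_eq[OF f\<gamma>] by (metis invertible_def matrix_left_invertible_ker)
  ultimately show ?thesis
    by (simp add: smooth_regular_def)
qed

lemma open_parametrization_affine:
  assumes "affine_iso f" "open_parametrization \<gamma> S"
  shows "open_parametrization (f \<circ> \<gamma>) (f ` S)"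
proof -
  have "inj f" using affine_iso_bij[OF assms(1)] by (rule bij_is_inj)
  then have "inj (f \<circ> \<gamma>)" "range (f \<circ> \<gamma>) = f ` S"
    using assms(2) by (auto simp: open_parametrization_def intro: inj_compose)
  then show ?thesis
    using assms smooth_regular_affine by (simp add: open_parametrization_def)
qed

lemma closed_parametrization_affine:
  assumes "affine_iso f" "closed_parametrization \<gamma> T S"
  shows "closed_parametrization (f \<circ> \<gamma>) T (f ` S)"
proof -
  have "inj f" using affine_iso_bij[OF assms(1)] by (rule bij_is_inj)
  then have "inj_on f (\<gamma> ` {0..<T})" by (rule inj_on_subset) simp
  then have "inj_on (f \<circ> \<gamma>) {0..<T}" "range (f \<circ> \<gamma>) = f ` S"
    using assms(2) by (auto simp: closed_parametrization_def intro: comp_inj_on)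
  then show ?thesis
    using assms smooth_regular_affine by (simp add: closed_parametrization_def)
qed

lemma smooth_at_affine:
  assumes "affine_iso f" "\<alpha> differentiable (at t)"
  shows "smooth_at (f \<circ> \<alpha>) t \<longleftrightarrow> smooth_at \<alpha> t"
proof -
  from assms(1) obtain L w where L: "invertible L" and f: "f = (\<lambda>p. L *v p + w)"
    by (rule affine_isoE)
  have "velocity (f \<circ> \<alpha>) t = L *v velocity \<alpha> t"
    using affine_iso_has_vector_derivative[of \<alpha> "velocity \<alpha> t" t L w] assms
    by (intro velocity_eq) (simp add: f o_def velocity_def vector_derivative_works[symmetric])
  then show ?thesis
    unfolding smooth_at_def using L
    by (metis invertible_def matrix_left_invertible_ker matrix_vector_mult_0_right)
qed

text \<open>
  The linear part maps the limiting tangent direction to a limiting tangent direction, and its inverse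
  can be absorbed into the affine map that straightens the cusp.
\<close>

lemma is_cusp_affine:
  assumes iso: "affine_iso f" and \<alpha>: "\<And>t. \<alpha> differentiable (at t)" and cusp: "is_cusp \<alpha> t0"
  shows "is_cusp (f \<circ> \<alpha>) t0"
proof -
  from iso obtain L w where L: "invertible L" and f: "f = (\<lambda>p. L *v p + w)"
    by (rule affine_isoE)
  have vel: "velocity (f \<circ> \<alpha>) t = L *v velocity \<alpha> t" for t
    using affine_iso_has_vector_derivative[of \<alpha> "velocity \<alpha> t" t L w] \<alpha>
    by (intro velocity_eq) (simp add: f o_def velocity_def vector_derivative_works[symmetric])
  have sgn: "sgn (L *v v) = sgn (L *v sgn v)" for v :: "real^2"
    by (cases "v = 0") (simp_all add: sgn_div_norm matrix_vector_mult_scaleR)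
  from cusp obtain v where v: "v \<noteq> 0" "((\<lambda>t. sgn (velocity \<alpha> t)) \<longlongrightarrow> v) (at_right t0)"
     "((\<lambda>t. sgn (velocity \<alpha> t)) \<longlongrightarrow> - v) (at_left t0)"
    by (auto simp: is_cusp_def tangent_switches_at_def)
  have "L *v v \<noteq> 0"
    using L v by (metis invertible_def matrix_left_invertible_ker)
  moreover have neg: "L *v (- v) = - (L *v v)"
    by (metis diff_0 matrix_vector_mult_0_right matrix_vector_mult_diff_distrib)
  ultimately have "((\<lambda>t. sgn (L *v sgn (velocity \<alpha> t))) \<longlongrightarrow> sgn (L *v v)) (at_right t0)"
    "((\<lambda>t. sgn (L *v sgn (velocity \<alpha> t))) \<longlongrightarrow> sgn (L *v (- v))) (at_left t0)"
    using v by (intro tendsto_sgn bounded_linear.tendsto[OF matrix_vector_mul_bounded_linear]; simp)+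
  then have "tangent_switches_at (f \<circ> \<alpha>) t0"
    using \<open>L *v v \<noteq> 0\<close> unfolding tangent_switches_at_def vel sgn[of "velocity _ _"] neg
    by (intro exI[of _ "sgn (L *v v)"]) (simp add: sgn_minus sgn_zero_iff)
  moreover have "order_three_halves_at (f \<circ> \<alpha>) t0"
  proof -
    obtain M :: "real^2^2" and u a b where M: "invertible M" "a \<noteq> 0" "b \<noteq> 0"
      "(\<lambda>t. (M *v \<alpha> (t0 + t) + u) $ 1 - a * t ^ 2) \<in> O[at 0](\<lambda>t. t ^ 3)"
      "(\<lambda>t. (M *v \<alpha> (t0 + t) + u) $ 2 - b * t ^ 3) \<in> O[at 0](\<lambda>t. t ^ 4)"
      using cusp by (auto simp: is_cusp_def order_three_halves_at_def)
    obtain L' where L': "L ** L' = mat 1" "L' ** L = mat 1"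
      using L unfolding invertible_def by blast
    have "invertible (M ** L')"
      using M L' by (meson invertible_def invertible_mult)
    moreover have "(M ** L') *v (f \<circ> \<alpha>) t + (u - (M ** L') *v w) = M *v \<alpha> t + u" for t
      by (simp add: f matrix_vector_right_distrib matrix_vector_mul_assoc matrix_mul_assoc[symmetric] L')
    ultimately show ?thesis
      unfolding order_three_halves_at_def using M
      by - (rule exI[of _ "M ** L'"], rule exI[of _ "u - (M ** L') *v w"], rule exI[of _ a], rule exI[of _ b],
          simp only: simp_thms)
  qed
  ultimately show ?thesis
    using cusp smooth_at_affine[OF iso \<alpha>] by (simp add: is_cusp_def)
qed

lemma jacobian_det_eq:
  assumes "(F has_derivative (*v) M) (at p)"
  shows "jacobian_det F p = det M"
proof -
  have "jacobian F (at p) = matrix ((*v) M)"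
    unfolding jacobian_def frechet_derivative_at[OF assms, symmetric] ..
  then show ?thesis
    by (simp add: jacobian_det_def)
qed

text \<open>
  The constant \<open>d\<close> is the product of the determinants of the two linear parts; it is the same for all
  maps \<open>G\<close>.
\<close>

lemma jacobian_det_affine:
  assumes A: "affine_iso A" and B: "affine_iso B"
  obtains d where "d \<noteq> 0"
    and "\<And>G p. G differentiable (at (B p)) \<Longrightarrow> jacobian_det (A \<circ> G \<circ> B) p = d * jacobian_det G (B p)"
proof -
  from A obtain L w where L: "invertible L" and Aeq: "A = (\<lambda>p. L *v p + w)"
    by (rule affine_isoE)
  from B obtain M v where M: "invertible M" and Beq: "B = (\<lambda>p. M *v p + v)"
    by (rule affine_isoE)
  have "jacobian_det (A \<circ> G \<circ> B) p = det L * det M * jacobian_det G (B p)"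
    if G: "G differentiable (at (B p))" for G p
  proof -
    let ?J = "jacobian G (at (B p))"
    have dB: "(B has_derivative (*v) M) (at p)"
      unfolding Beq by (rule derivative_eq_intros bounded_linear_imp_has_derivative matrix_vector_mul_bounded_linear | simp)+
    have dA: "(A has_derivative (*v) L) (at q)" for q
      unfolding Aeq by (rule derivative_eq_intros bounded_linear_imp_has_derivative matrix_vector_mul_bounded_linear | simp)+
    have "(G has_derivative (*v) ?J) (at (B p))"
      using G jacobian_works by blast
    from diff_chain_at[OF dB diff_chain_at[OF this dA]]
    have "(A \<circ> G \<circ> B has_derivative (*v) (L ** ?J ** M)) (at p)"
      by (simp add: o_def matrix_vector_mul_assoc matrix_mul_assoc)
    then show ?thesis
      by (simp add: jacobian_det_eq det_mul) (simp add: jacobian_det_def)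
  qed
  moreover have "det L * det M \<noteq> 0"
    using L M by (simp add: invertible_det_nz)
  ultimately show ?thesis using that by blast
qed

section \<open>The classification as an affine invariant\<close>

text \<open>
  The classification as a property of the map alone, so that it can be transported along affine
  changes of coordinates.
\<close>

definition has_listed_form :: "(real^2 \<Rightarrow> real^2) \<Rightarrow> bool" where
  "has_listed_form F \<longleftrightarrow> (let J\<^sub>0 = critical_set F; J\<^sub>1 = critical_image F in
     (J\<^sub>0 = {} \<and> J\<^sub>1 = {}) \<or>
     ((\<exists>p. J\<^sub>0 = {p}) \<and> (\<exists>q. J\<^sub>1 = {q})) \<or>
     (is_ellipse J\<^sub>0 \<and> closed_image_curve closed_three_cusp_curve F J\<^sub>0) \<or>
     (is_hyperbola J\<^sub>0 \<and>
        (\<exists>B\<^sub>1 B\<^sub>2. components J\<^sub>0 = {B\<^sub>1, B\<^sub>2} \<and> B\<^sub>1 \<noteq> B\<^sub>2 \<and> J\<^sub>1 = F ` B\<^sub>1 \<union> F ` B\<^sub>2 \<and>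
           open_image_curve smooth_curve F B\<^sub>1 \<and> open_image_curve single_cusp_curve F B\<^sub>2)) \<or>
     ((\<exists>L\<^sub>1 L\<^sub>2. crosses_as_two_lines L\<^sub>1 L\<^sub>2 J\<^sub>0) \<and>
        ((\<exists>p R\<^sub>1 R\<^sub>2. is_ray_from p R\<^sub>1 \<and> is_ray_from p R\<^sub>2 \<and> R\<^sub>1 \<noteq> R\<^sub>2 \<and> J\<^sub>1 = R\<^sub>1 \<union> R\<^sub>2) \<or>
         (\<exists>R P p. is_ray R \<and> is_parabola P \<and> R \<inter> P = {p} \<and> J\<^sub>1 = R \<union> P))) \<or>
     (is_parabola J\<^sub>0 \<and> open_image_curve single_cusp_curve F J\<^sub>0) \<or>
     ((\<exists>L\<^sub>1 L\<^sub>2. parallel_as_two_lines L\<^sub>1 L\<^sub>2 J\<^sub>0 \<and>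
         (\<exists>L q. is_line L \<and> q \<notin> L \<and> F ` L\<^sub>1 = L \<and> F ` L\<^sub>2 = {q} \<and> J\<^sub>1 = L \<union> {q})) \<or>
      (zero_set_is_coincident_lines (jacobian_det F) \<and> (\<exists>q. J\<^sub>1 = {q}))) \<or>
     (zero_set_is_simple_line (jacobian_det F) \<and>
        ((\<exists>q. J\<^sub>1 = {q}) \<or> is_line J\<^sub>1 \<or> is_parabola J\<^sub>1)) \<or>
     (J\<^sub>0 = UNIV \<and> (is_line J\<^sub>1 \<or> is_ray J\<^sub>1 \<or> is_parabola J\<^sub>1)))"

lemma listed_empty:
  "critical_set F = {} \<Longrightarrow> has_listed_form F"
  unfolding has_listed_form_def Let_def critical_image_def by (rule disjI1) simp

lemma listed_point:
  "critical_set F = {p} \<Longrightarrow> has_listed_form F"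
  unfolding has_listed_form_def Let_def critical_image_def by (rule disjI2, rule disjI1) simp

lemma listed_ellipse:
  "is_ellipse (critical_set F) \<Longrightarrow> closed_image_curve closed_three_cusp_curve F (critical_set F) \<Longrightarrow>
    has_listed_form F"
  unfolding has_listed_form_def Let_def by (rule disjI2, rule disjI2, rule disjI1, rule conjI)

lemma listed_hyperbola:
  "is_hyperbola (critical_set F) \<Longrightarrow> components (critical_set F) = {B1, B2} \<Longrightarrow> B1 \<noteq> B2 \<Longrightarrow>
    open_image_curve smooth_curve F B1 \<Longrightarrow> open_image_curve single_cusp_curve F B2 \<Longrightarrow>
    has_listed_form F"
  unfolding has_listed_form_def Let_def critical_image_def
  apply (rule disjI2, rule disjI2, rule disjI2, rule disjI1, rule conjI, assumption)
  apply (rule exI[of _ B1], rule exI[of _ B2])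
  using Union_components[of "critical_set F"] by (metis Union_insert Union_empty Un_empty_right image_Un)

lemma listed_crossing_rays:
  "crosses_as_two_lines L1 L2 (critical_set F) \<Longrightarrow> is_ray_from p R1 \<Longrightarrow> is_ray_from p R2 \<Longrightarrow>
    R1 \<noteq> R2 \<Longrightarrow> critical_image F = R1 \<union> R2 \<Longrightarrow> has_listed_form F"
  unfolding has_listed_form_def Let_def
  by (rule disjI2, rule disjI2, rule disjI2, rule disjI2, rule disjI1) metis

lemma listed_crossing_ray_parabola:
  "crosses_as_two_lines L1 L2 (critical_set F) \<Longrightarrow> is_ray R \<Longrightarrow> is_parabola P \<Longrightarrow>
    R \<inter> P = {p} \<Longrightarrow> critical_image F = R \<union> P \<Longrightarrow> has_listed_form F"
  unfolding has_listed_form_def Let_def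
  by (rule disjI2, rule disjI2, rule disjI2, rule disjI2, rule disjI1) metis

lemma listed_parabola:
  "is_parabola (critical_set F) \<Longrightarrow> open_image_curve single_cusp_curve F (critical_set F) \<Longrightarrow>
    has_listed_form F"
  unfolding has_listed_form_def Let_def
  by (rule disjI2, rule disjI2, rule disjI2, rule disjI2, rule disjI2, rule disjI1, rule conjI)

lemma listed_parallel:
  "parallel_as_two_lines L1 L2 (critical_set F) \<Longrightarrow> is_line (F ` L1) \<Longrightarrow> F ` L2 = {q} \<Longrightarrow>
    q \<notin> F ` L1 \<Longrightarrow> has_listed_form F"
  unfolding has_listed_form_def Let_def critical_image_def parallel_as_two_lines_def
  by (rule disjI2, rule disjI2, rule disjI2, rule disjI2, rule disjI2, rule disjI2, rule disjI1, rule disjI1)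
    (metis image_Un)

lemma listed_coincident:
  "zero_set_is_coincident_lines (jacobian_det F) \<Longrightarrow> critical_image F = {q} \<Longrightarrow> has_listed_form F"
  unfolding has_listed_form_def Let_def
  by (rule disjI2, rule disjI2, rule disjI2, rule disjI2, rule disjI2, rule disjI2, rule disjI1, rule disjI2) blast

lemma listed_simple_line:
  "zero_set_is_simple_line (jacobian_det F) \<Longrightarrow>
    (\<exists>q. critical_image F = {q}) \<or> is_line (critical_image F) \<or> is_parabola (critical_image F) \<Longrightarrow>
    has_listed_form F"
  unfolding has_listed_form_def Let_def
  by (rule disjI2, rule disjI2, rule disjI2, rule disjI2, rule disjI2, rule disjI2, rule disjI2, rule disjI1, rule conjI)

lemma listed_plane:
  "critical_set F = UNIV \<Longrightarrow>
    is_line (critical_image F) \<or> is_ray (critical_image F) \<or> is_parabola (critical_image F) \<Longrightarrow>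
    has_listed_form F"
  unfolding has_listed_form_def Let_def
  by (rule disjI2, rule disjI2, rule disjI2, rule disjI2, rule disjI2, rule disjI2, rule disjI2, rule disjI2, rule conjI)

lemma param_differentiable:
  assumes "smooth_regular \<gamma>" and "\<And>p. G differentiable (at p)"
  shows "G \<circ> \<gamma> differentiable (at t)"
proof (rule differentiable_chain_at)
  show "\<gamma> differentiable (at t)"
    using assms(1) unfolding smooth_regular_def infinitely_differentiable_def
    by (metis funpow_0)
qed (rule assms(2))

text \<open>
  The parametrizations \<open>\<gamma>\<close> of \<open>inv B ` S\<close> correspond to the parametrizations \<open>B \<circ> \<gamma>\<close> of \<open>S\<close>.
  Differentiability of \<open>\<alpha>\<close> is made available to \<open>P\<close> because \<open>velocity\<close> commutes with affine maps
  only along differentiable curves.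
\<close>

lemma open_image_curve_affine:
  assumes A: "affine_iso A" and B: "affine_iso B" and G: "\<And>p. G differentiable (at p)"
    and P: "\<And>\<alpha>. (\<And>t. \<alpha> differentiable (at t)) \<Longrightarrow> P \<alpha> \<Longrightarrow> P (A \<circ> \<alpha>)"
    and curve: "open_image_curve P G S"
  shows "open_image_curve P (A \<circ> G \<circ> B) (inv B ` S)"
  unfolding open_image_curve_def
proof (intro conjI allI impI)
  show "\<exists>\<gamma>. open_parametrization \<gamma> (inv B ` S)"
    using curve open_parametrization_affine[OF affine_iso_inv[OF B]]
    by (auto simp: open_image_curve_def)
next
  fix \<gamma> assume "open_parametrization \<gamma> (inv B ` S)"
  then have "open_parametrization (B \<circ> \<gamma>) (B ` inv B ` S)"
    by (rule open_parametrization_affine[OF B])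
  then have "open_parametrization (B \<circ> \<gamma>) S"
    using affine_iso_bij[OF B] by (simp add: bij_is_surj image_f_inv_f)
  then have "P (G \<circ> (B \<circ> \<gamma>))" "smooth_regular (B \<circ> \<gamma>)"
    using curve by (auto simp: open_image_curve_def open_parametrization_def)
  then have "P (A \<circ> (G \<circ> (B \<circ> \<gamma>)))"
    using P param_differentiable G by blast
  then show "P (A \<circ> G \<circ> B \<circ> \<gamma>)"
    by (simp add: comp_assoc)
qed

lemma closed_image_curve_affine:
  assumes A: "affine_iso A" and B: "affine_iso B" and G: "\<And>p. G differentiable (at p)"
    and P: "\<And>\<alpha> T. (\<And>t. \<alpha> differentiable (at t)) \<Longrightarrow> P \<alpha> T \<Longrightarrow> P (A \<circ> \<alpha>) T"
    and curve: "closed_image_curve P G S"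
  shows "closed_image_curve P (A \<circ> G \<circ> B) (inv B ` S)"
  unfolding closed_image_curve_def
proof (intro conjI allI impI)
  show "\<exists>\<gamma> T. closed_parametrization \<gamma> T (inv B ` S)"
    using curve closed_parametrization_affine[OF affine_iso_inv[OF B]]
    unfolding closed_image_curve_def by blast
next
  fix \<gamma> T assume "closed_parametrization \<gamma> T (inv B ` S)"
  then have "closed_parametrization (B \<circ> \<gamma>) T (B ` inv B ` S)"
    by (rule closed_parametrization_affine[OF B])
  then have "closed_parametrization (B \<circ> \<gamma>) T S"
    using affine_iso_bij[OF B] by (simp add: bij_is_surj image_f_inv_f)
  then have "P (G \<circ> (B \<circ> \<gamma>)) T" "smooth_regular (B \<circ> \<gamma>)"
    using curve by (auto simp: closed_image_curve_def closed_parametrization_def)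
  then have "P (A \<circ> (G \<circ> (B \<circ> \<gamma>))) T"
    using P param_differentiable G by blast
  then show "P (A \<circ> G \<circ> B \<circ> \<gamma>) T"
    by (simp add: comp_assoc)
qed

lemma smooth_curve_affine:
  assumes "affine_iso A" "\<And>t. \<alpha> differentiable (at t)" "smooth_curve \<alpha>"
  shows "smooth_curve (A \<circ> \<alpha>)"
  using assms(3) smooth_at_affine[OF assms(1,2)] by (simp add: smooth_curve_def)

lemma single_cusp_curve_affine:
  assumes "affine_iso A" "\<And>t. \<alpha> differentiable (at t)" "single_cusp_curve \<alpha>"
  shows "single_cusp_curve (A \<circ> \<alpha>)"
  using assms(3) smooth_at_affine[OF assms(1,2)] is_cusp_affine[OF assms(1,2)]
  unfolding single_cusp_curve_def by metis

lemma closed_three_cusp_curve_affine: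
  assumes "affine_iso A" "\<And>t. \<alpha> differentiable (at t)" "closed_three_cusp_curve \<alpha> T"
  shows "closed_three_cusp_curve (A \<circ> \<alpha>) T"
proof -
  from assms(3) obtain C where C: "C \<subseteq> {0..<T}" "card C = 3" "inj_on \<alpha> C" "\<forall>t \<in> C. is_cusp \<alpha> t"
    "\<forall>t \<in> {0..<T} - C. smooth_at \<alpha> t" and per: "\<forall>t. \<alpha> (t + T) = \<alpha> t"
    unfolding closed_three_cusp_curve_def by blast
  have "inj_on (A \<circ> \<alpha>) C"
    using C(3) affine_iso_bij[OF assms(1)] by (meson bij_is_inj comp_inj_on inj_on_subset subset_UNIV)
  moreover have "\<forall>t \<in> C. is_cusp (A \<circ> \<alpha>) t" "\<forall>t \<in> {0..<T} - C. smooth_at (A \<circ> \<alpha>) t"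
    using C is_cusp_affine[OF assms(1,2)] smooth_at_affine[OF assms(1,2)] by blast+
  ultimately show ?thesis
    unfolding closed_three_cusp_curve_def using C(1,2) per by (intro conjI exI[of _ C]) auto
qed

text \<open>
  With \<open>F = A \<circ> G \<circ> B\<close> and \<open>C = inv B\<close>, the chain rule gives \<open>J\<^sub>0(F) = C(J\<^sub>0(G))\<close>, and then
  \<open>F \<circ> C = A \<circ> G\<close> gives \<open>J\<^sub>1(F) = A(J\<^sub>1(G))\<close>. Each kind of set in the list is preserved by \<open>A\<close> and \<open>C\<close>.
\<close>

lemma has_listed_form_affine:
  assumes A: "affine_iso A" and B: "affine_iso B" and G: "\<And>p. G differentiable (at p)"
    and form: "has_listed_form G"
  shows "has_listed_form (A \<circ> G \<circ> B)"
proof -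
  define F where "F = A \<circ> G \<circ> B"
  define C where "C = inv B"
  have bij: "bij A" "bij B" using A B affine_iso_bij by auto
  have C: "affine_iso C" using B affine_iso_inv by (simp add: C_def)
  have injC: "inj C" using affine_iso_bij[OF C] by (rule bij_is_inj)
  have BC: "B (C p) = p" for p
    using bij(2) by (simp add: C_def bij_is_surj surj_f_inv_f)
  obtain d where d: "d \<noteq> 0"
    "\<And>G p. G differentiable (at (B p)) \<Longrightarrow> jacobian_det (A \<circ> G \<circ> B) p = d * jacobian_det G (B p)"
    by (rule jacobian_det_affine[OF A B]) blast
  have jac: "jacobian_det F p = d * jacobian_det G (B p)" for p
    using d(2) G by (simp add: F_def)
  have "critical_set F = B -` critical_set G"
    using d(1) by (auto simp: critical_set_def jac)
  then have J0: "critical_set F = C ` critical_set G"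
    unfolding C_def using bij_vimage_eq_inv_image[OF bij(2)] by simp
  have FC: "F ` C ` S = A ` G ` S" for S
    by (simp add: F_def image_image BC)
  have J1: "critical_image F = A ` critical_image G"
    by (simp add: critical_image_def J0 FC)
  let ?J0 = "critical_set G" and ?J1 = "critical_image G"
  have point: "\<exists>q. f ` S = {q}" if "\<exists>q. S = {q}" for S and f :: "real^2 \<Rightarrow> real^2"
    using that by auto
  from form[unfolded has_listed_form_def Let_def] have "has_listed_form F"
  proof (elim disjE)
    assume "?J0 = {} \<and> ?J1 = {}"
    then show ?thesis by (intro listed_empty) (simp add: J0)
  next
    assume "(\<exists>p. ?J0 = {p}) \<and> (\<exists>q. ?J1 = {q})"
    then show ?thesis using listed_point[of F] by (auto simp: J0)
  next
    assume *: "is_ellipse ?J0 \<and> closed_image_curve closed_three_cusp_curve G ?J0"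
    have "closed_image_curve closed_three_cusp_curve F (C ` ?J0)"
      unfolding F_def C_def using A B G * closed_three_cusp_curve_affine[OF A]
      by (intro closed_image_curve_affine) blast+
    with * show ?thesis
      using is_ellipse_affine_image[OF C] listed_ellipse[of F] by (simp add: J0)
  next
    assume *: "is_hyperbola ?J0 \<and>
        (\<exists>B\<^sub>1 B\<^sub>2. components ?J0 = {B\<^sub>1, B\<^sub>2} \<and> B\<^sub>1 \<noteq> B\<^sub>2 \<and> ?J1 = G ` B\<^sub>1 \<union> G ` B\<^sub>2 \<and>
           open_image_curve smooth_curve G B\<^sub>1 \<and> open_image_curve single_cusp_curve G B\<^sub>2)"
    then obtain B1 B2 where comp: "components ?J0 = {B1, B2}" "B1 \<noteq> B2" "?J1 = G ` B1 \<union> G ` B2"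
      and curve: "open_image_curve smooth_curve G B1" "open_image_curve single_cusp_curve G B2"
      by blast
    have "components (critical_set F) = {C ` B1, C ` B2}"
      unfolding J0 components_affine_image[OF C] comp by simp
    moreover have "C ` B1 \<noteq> C ` B2"
      using comp(2) injC by (simp add: inj_image_eq_iff)
    moreover have "open_image_curve smooth_curve F (C ` B1)"
      unfolding F_def C_def using A B G curve smooth_curve_affine[OF A]
      by (intro open_image_curve_affine) blast+
    moreover have "open_image_curve single_cusp_curve F (C ` B2)"
      unfolding F_def C_def using A B G curve single_cusp_curve_affine[OF A]
      by (intro open_image_curve_affine) blast+
    moreover have "is_hyperbola (critical_set F)"
      unfolding J0 using * is_hyperbola_affine_image[OF C] by blast
    ultimately show ?thesis using listed_hyperbola[of F "C ` B1" "C ` B2"] by blast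
  next
    assume *: "(\<exists>L\<^sub>1 L\<^sub>2. crosses_as_two_lines L\<^sub>1 L\<^sub>2 ?J0) \<and>
        ((\<exists>p R\<^sub>1 R\<^sub>2. is_ray_from p R\<^sub>1 \<and> is_ray_from p R\<^sub>2 \<and> R\<^sub>1 \<noteq> R\<^sub>2 \<and> ?J1 = R\<^sub>1 \<union> R\<^sub>2) \<or>
         (\<exists>R P p. is_ray R \<and> is_parabola P \<and> R \<inter> P = {p} \<and> ?J1 = R \<union> P))"
    then obtain L1 L2 p where "is_line L1" "is_line L2" "L1 \<inter> L2 = {p}" "?J0 = L1 \<union> L2"
      unfolding crosses_as_two_lines_def by blast
    then have cross: "crosses_as_two_lines (C ` L1) (C ` L2) (critical_set F)"
      unfolding crosses_as_two_lines_def J0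
      using is_line_affine_image[OF C] image_Int[OF injC, of L1 L2]
      by (simp add: image_Un) (metis image_empty image_insert)
    from * show ?thesis
    proof (elim conjE disjE exE)
      fix p R\<^sub>1 R\<^sub>2
      assume "is_ray_from p R\<^sub>1" "is_ray_from p R\<^sub>2" "R\<^sub>1 \<noteq> R\<^sub>2" "?J1 = R\<^sub>1 \<union> R\<^sub>2"
      then have "is_ray_from (A p) (A ` R\<^sub>1)" "is_ray_from (A p) (A ` R\<^sub>2)" "A ` R\<^sub>1 \<noteq> A ` R\<^sub>2"
        "critical_image F = A ` R\<^sub>1 \<union> A ` R\<^sub>2"
        using is_ray_from_affine_image[OF A] bij(1)
        by (auto simp: J1 image_Un inj_image_eq_iff bij_is_inj)
      then show ?thesis by (rule listed_crossing_rays[OF cross])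
    next
      fix R P p
      assume "is_ray R" "is_parabola P" "R \<inter> P = {p}" "?J1 = R \<union> P"
      then have "is_ray (A ` R)" "is_parabola (A ` P)" "A ` R \<inter> A ` P = {A p}"
        "critical_image F = A ` R \<union> A ` P"
        using is_ray_from_affine_image[OF A] is_parabola_affine_image[OF A]
          image_Int[OF bij_is_inj[OF bij(1)], of R P]
        unfolding J1 is_ray_def by (blast, blast, simp_all add: image_Un)
      then show ?thesis by (rule listed_crossing_ray_parabola[OF cross])
    qed
  next
    assume *: "is_parabola ?J0 \<and> open_image_curve single_cusp_curve G ?J0"
    have "open_image_curve single_cusp_curve F (C ` ?J0)"
      unfolding F_def C_def using A B G * single_cusp_curve_affine[OF A]
      by (intro open_image_curve_affine) blast+
    with * show ?thesis
      using is_parabola_affine_image[OF C] listed_parabola[of F] by (simp add: J0)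
  next
    assume "\<exists>L\<^sub>1 L\<^sub>2. parallel_as_two_lines L\<^sub>1 L\<^sub>2 ?J0 \<and>
         (\<exists>L q. is_line L \<and> q \<notin> L \<and> G ` L\<^sub>1 = L \<and> G ` L\<^sub>2 = {q} \<and> ?J1 = L \<union> {q})"
    then obtain L1 L2 L q where L: "is_line L1" "is_line L2" "L1 \<inter> L2 = {}" "?J0 = L1 \<union> L2"
      "is_line L" "q \<notin> L" "G ` L1 = L" "G ` L2 = {q}" "?J1 = L \<union> {q}"
      unfolding parallel_as_two_lines_def by blast
    then have "parallel_as_two_lines (C ` L1) (C ` L2) (critical_set F)"
      unfolding parallel_as_two_lines_def J0
      using is_line_affine_image[OF C] image_Int[OF injC, of L1 L2] by (auto simp: image_Un)
    moreover have "is_line (A ` L)" "A q \<notin> A ` L" "F ` C ` L1 = A ` L" "F ` C ` L2 = {A q}"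
      "critical_image F = A ` L \<union> {A q}"
      using L is_line_affine_image[OF A] bij(1)
      by (auto simp: FC J1 bij_is_inj inj_image_mem_iff)
    ultimately show ?thesis using listed_parallel[of "C ` L1" "C ` L2" F "A q"] by simp
  next
    assume *: "zero_set_is_coincident_lines (jacobian_det G) \<and> (\<exists>q. ?J1 = {q})"
    then obtain k u c where k: "k \<noteq> 0" "u \<noteq> 0" "\<And>p. jacobian_det G p = k * (u \<bullet> p + c)\<^sup>2"
      unfolding zero_set_is_coincident_lines_def by blast
    obtain M v where M: "invertible M" "B = (\<lambda>p. M *v p + v)"
      using B by (rule affine_isoE)
    have "u v* M \<noteq> 0"
      using k(2) M(1) by (metis invertible_def vector_matrix_mul_assoc vector_matrix_mul_rid vector_matrix_mult_0)
    moreover have "jacobian_det F p = (d * k) * ((u v* M) \<bullet> p + (u \<bullet> v + c))\<^sup>2" for p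
      by (simp add: jac k(3) M(2) dot_lmul_matrix inner_add_right add.assoc)
    ultimately have "zero_set_is_coincident_lines (jacobian_det F)"
      unfolding zero_set_is_coincident_lines_def using k(1) d(1) by (metis mult_eq_0_iff)
    moreover obtain q where "critical_image F = {A q}"
      using * by (auto simp: J1)
    ultimately show ?thesis by (rule listed_coincident)
  next
    assume *: "zero_set_is_simple_line (jacobian_det G) \<and>
        ((\<exists>q. ?J1 = {q}) \<or> is_line ?J1 \<or> is_parabola ?J1)"
    then obtain u c where u: "u \<noteq> 0" "\<And>p. jacobian_det G p = u \<bullet> p + c"
      unfolding zero_set_is_simple_line_def by blast
    obtain M v where M: "invertible M" "B = (\<lambda>p. M *v p + v)"
      using B by (rule affine_isoE)
    have "u v* M \<noteq> 0"
      using u(1) M(1) by (metis invertible_def vector_matrix_mul_assoc vector_matrix_mul_rid vector_matrix_mult_0)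
    moreover have "jacobian_det F p = (d *\<^sub>R (u v* M)) \<bullet> p + d * (u \<bullet> v + c)" for p
      by (simp add: jac u(2) M(2) dot_lmul_matrix inner_add_right algebra_simps)
    ultimately have "zero_set_is_simple_line (jacobian_det F)"
      unfolding zero_set_is_simple_line_def using d(1) by (metis scaleR_eq_0_iff)
    moreover have "(\<exists>q. critical_image F = {q}) \<or> is_line (critical_image F) \<or> is_parabola (critical_image F)"
      unfolding J1 using * point is_line_affine_image[OF A] is_parabola_affine_image[OF A] by blast
    ultimately show ?thesis by (rule listed_simple_line)
  next
    assume *: "?J0 = UNIV \<and> (is_line ?J1 \<or> is_ray ?J1 \<or> is_parabola ?J1)"
    then have "critical_set F = UNIV"
      using affine_iso_bij[OF C] by (simp add: J0 bij_is_surj)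
    moreover have "is_line (critical_image F) \<or> is_ray (critical_image F) \<or> is_parabola (critical_image F)"
      unfolding J1 using * is_line_affine_image[OF A] is_parabola_affine_image[OF A]
        is_ray_from_affine_image[OF A] unfolding is_ray_def by blast
    ultimately show ?thesis by (rule listed_plane)
  qed
  then show ?thesis by (simp add: F_def)
qed

section \<open>Normal forms without curved critical sets\<close>

lemma quadratic_map_nth:
  "quadratic_map a b p $ 1 =
    a 0 * (p $ 1)\<^sup>2 + a 1 * p $ 1 * p $ 2 + a 2 * (p $ 2)\<^sup>2 + a 3 * p $ 1 + a 4 * p $ 2 + a 5"
  "quadratic_map a b p $ 2 =
    b 0 * (p $ 1)\<^sup>2 + b 1 * p $ 1 * p $ 2 + b 2 * (p $ 2)\<^sup>2 + b 3 * p $ 1 + b 4 * p $ 2 + b 5"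
  by (simp_all add: quadratic_map_def Let_def)

lemma quadratic_map_has_derivative:
  "(quadratic_map a b has_derivative (*v) (vector
     [vector [2 * a 0 * p $ 1 + a 1 * p $ 2 + a 3, a 1 * p $ 1 + 2 * a 2 * p $ 2 + a 4],
      vector [2 * b 0 * p $ 1 + b 1 * p $ 2 + b 3, b 1 * p $ 1 + 2 * b 2 * p $ 2 + b 4]])) (at p)"
    (is "(_ has_derivative (*v) ?M) _")
proof -
  have nth: "((\<lambda>q. q $ i) has_derivative (\<lambda>h. h $ i)) (at p)" for i :: 2
    by (rule bounded_linear_imp_has_derivative[OF bounded_linear_vec_nth])
  have poly: "((\<lambda>q. c 0 * (q $ 1)\<^sup>2 + c 1 * q $ 1 * q $ 2 + c 2 * (q $ 2)\<^sup>2 + c 3 * q $ 1 + c 4 * q $ 2 + c 5)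
      has_derivative (\<lambda>h. (2 * c 0 * p $ 1 + c 1 * p $ 2 + c 3) * h $ 1 +
        (c 1 * p $ 1 + 2 * c 2 * p $ 2 + c 4) * h $ 2)) (at p)" for c :: "nat \<Rightarrow> real"
    by (rule derivative_eq_intros nth refl)+ (simp add: algebra_simps)
  have combine: "(q $ 1) *\<^sub>R vector [1, 0] + (q $ 2) *\<^sub>R vector [0, 1] = q" for q :: "real^2"
    by (simp add: plane_eq_iff)
  have "((\<lambda>q. (quadratic_map a b q $ 1) *\<^sub>R vector [1, 0] + (quadratic_map a b q $ 2) *\<^sub>R (vector [0, 1] :: real^2))
     has_derivative (\<lambda>h. ((?M *v h) $ 1) *\<^sub>R vector [1, 0] + ((?M *v h) $ 2) *\<^sub>R vector [0, 1])) (at p)"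
    unfolding quadratic_map_nth
    by (rule has_derivative_eq_rhs[OF has_derivative_add[OF
          has_derivative_scaleR_left[OF poly[of a]] has_derivative_scaleR_left[OF poly[of b]]]])
      (simp add: matrix_vector_mult_def sum_2 fun_eq_iff)
  then show ?thesis
    unfolding combine by (simp add: eta_contract_eq)
qed

lemma quadratic_map_differentiable: "quadratic_map a b differentiable (at p)"
  using quadratic_map_has_derivative by (rule differentiableI)

lemma jacobian_det_quadratic_map:
  "jacobian_det (quadratic_map a b) p =
    (2 * a 0 * p $ 1 + a 1 * p $ 2 + a 3) * (b 1 * p $ 1 + 2 * b 2 * p $ 2 + b 4) -
    (a 1 * p $ 1 + 2 * a 2 * p $ 2 + a 4) * (2 * b 0 * p $ 1 + b 1 * p $ 2 + b 3)"
  unfolding jacobian_det_eq[OF quadratic_map_has_derivative] by (simp add: det_2)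

text \<open>
  Concrete quadratic maps are given by their lists of coefficients, in the order
  \<open>x\<^sup>2\<close>, \<open>x y\<close>, \<open>y\<^sup>2\<close>, \<open>x\<close>, \<open>y\<close>, \<open>1\<close>.
\<close>

lemma quadratic_map_eq_vector:
  "quadratic_map ((!) [a0, a1, a2, a3, a4, a5]) ((!) [b0, b1, b2, b3, b4, b5]) p = vector
    [a0 * (p $ 1)\<^sup>2 + a1 * p $ 1 * p $ 2 + a2 * (p $ 2)\<^sup>2 + a3 * p $ 1 + a4 * p $ 2 + a5,
     b0 * (p $ 1)\<^sup>2 + b1 * p $ 1 * p $ 2 + b2 * (p $ 2)\<^sup>2 + b3 * p $ 1 + b4 * p $ 2 + b5]"
  by (simp add: quadratic_map_def Let_def)

lemma jacobian_det_quadratic_map_list: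
  "jacobian_det (quadratic_map ((!) [a0, a1, a2, a3, a4, a5]) ((!) [b0, b1, b2, b3, b4, b5])) p =
    (2 * a0 * p $ 1 + a1 * p $ 2 + a3) * (b1 * p $ 1 + 2 * b2 * p $ 2 + b4) -
    (a1 * p $ 1 + 2 * a2 * p $ 2 + a4) * (2 * b0 * p $ 1 + b1 * p $ 2 + b3)"
  by (simp add: jacobian_det_quadratic_map)

lemmas critical_simps = critical_image_def critical_set_def jacobian_det_quadratic_map_list
  quadratic_map_eq_vector

lemma is_line_vertical: "is_line {p. p $ 1 = c}"
proof -
  have "{p :: real^2. p $ 1 = c} = {vector [c, 0] + t *\<^sub>R vector [0, 1] | t. True}"
    by (auto simp: plane_eq_iff intro: exI[of _ "x $ 2" for x :: "real^2"])
  then show ?thesis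
    unfolding is_line_def by (intro exI[of _ "vector [c, 0]"] exI[of _ "vector [0, 1]"]) (simp add: plane_eq_iff)
qed

lemma is_line_horizontal: "is_line {p. p $ 2 = c}"
proof -
  have "{p :: real^2. p $ 2 = c} = {vector [0, c] + t *\<^sub>R vector [1, 0] | t. True}"
    by (auto simp: plane_eq_iff intro: exI[of _ "x $ 1" for x :: "real^2"])
  then show ?thesis
    unfolding is_line_def by (intro exI[of _ "vector [0, c]"] exI[of _ "vector [1, 0]"]) (simp add: plane_eq_iff)
qed

lemma is_ray_from_right: "is_ray_from 0 {p. p $ 1 \<ge> 0 \<and> p $ 2 = 0}"
proof -
  have "{p :: real^2. p $ 1 \<ge> 0 \<and> p $ 2 = 0} = {0 + t *\<^sub>R vector [1, 0] | t. t \<ge> 0}"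
    by (auto simp: plane_eq_iff intro: exI[of _ "x $ 1" for x :: "real^2"])
  then show ?thesis
    unfolding is_ray_from_def by (intro exI[of _ "vector [1, 0]"]) (simp add: plane_eq_iff)
qed

lemma is_ray_from_up: "is_ray_from 0 {p. p $ 1 = 0 \<and> p $ 2 \<ge> 0}"
proof -
  have "{p :: real^2. p $ 1 = 0 \<and> p $ 2 \<ge> 0} = {0 + t *\<^sub>R vector [0, 1] | t. t \<ge> 0}"
    by (auto simp: plane_eq_iff intro: exI[of _ "x $ 2" for x :: "real^2"])
  then show ?thesis
    unfolding is_ray_from_def by (intro exI[of _ "vector [0, 1]"]) (simp add: plane_eq_iff)
qed

lemma is_parabola_graph:
  assumes "c \<noteq> 0"
  shows "is_parabola {p. p $ 2 = c * (p $ 1)\<^sup>2}" and "is_parabola {p. p $ 1 = c * (p $ 2)\<^sup>2}"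
proof -
  show "is_parabola {p. p $ 2 = c * (p $ 1)\<^sup>2}"
    unfolding is_parabola_def using assms
    by (intro exI[of _ c] exI[of _ 0] exI[of _ "-1::real"])
      (auto simp: conic_def conic_matrix_def det_3)
  show "is_parabola {p. p $ 1 = c * (p $ 2)\<^sup>2}"
    unfolding is_parabola_def using assms
    by - (rule exI[of _ 0], rule exI[of _ 0], rule exI[of _ c], rule exI[of _ "-1"], rule exI[of _ 0],
        rule exI[of _ 0], auto simp: conic_def conic_matrix_def det_3)
qed

lemma image_eq_singleton: "S \<noteq> {} \<Longrightarrow> (\<And>p. p \<in> S \<Longrightarrow> f p = q) \<Longrightarrow> f ` S = {q}"
  by force

lemma listed_complex_square:
  "has_listed_form (quadratic_map ((!) [1, 0, -1, 0, 0, 0]) ((!) [0, 1, 0, 0, 0, 0]))" (is "has_listed_form ?F")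
proof (rule listed_point[of _ 0])
  have "jacobian_det ?F p = 2 * (p $ 1 * p $ 1 + p $ 2 * p $ 2)" for p
    by (simp add: jacobian_det_quadratic_map_list)
  then have "jacobian_det ?F p = 0 \<longleftrightarrow> p = 0" for p
    by (simp only: mult_eq_0_iff sum_squares_eq_zero_iff plane_eq_iff zero_index) simp
  then show "critical_set ?F = {0}"
    by (simp add: critical_set_def)
qed

lemma listed_squares:
  "has_listed_form (quadratic_map ((!) [1, 0, 0, 0, 0, 0]) ((!) [0, 0, 1, 0, 0, 0]))" (is "has_listed_form ?F")
proof (rule listed_crossing_rays[OF _ is_ray_from_right is_ray_from_up])
  have J0: "critical_set ?F = {p. p $ 1 = 0} \<union> {p. p $ 2 = 0}"
    by (auto simp: critical_simps)
  have "{p :: real^2. p $ 1 = 0} \<inter> {p. p $ 2 = 0} = {0}"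
    by (auto simp: plane_eq_iff)
  then show "crosses_as_two_lines {p. p $ 1 = 0} {p. p $ 2 = 0} (critical_set ?F)"
    unfolding crosses_as_two_lines_def J0 using is_line_vertical is_line_horizontal by blast
  have "q \<in> critical_image ?F" if "q $ 1 \<ge> 0 \<and> q $ 2 = 0 \<or> q $ 1 = 0 \<and> q $ 2 \<ge> 0" for q
    unfolding critical_image_def J0 using that
    by (intro image_eqI[of _ _ "vector [sqrt (q $ 1), sqrt (q $ 2)]"])
      (auto simp: quadratic_map_eq_vector plane_eq_iff)
  then show "critical_image ?F = {p. p $ 1 \<ge> 0 \<and> p $ 2 = 0} \<union> {p. p $ 1 = 0 \<and> p $ 2 \<ge> 0}"
    by (auto simp: critical_simps)
  have "vector [1, 0] \<in> {p :: real^2. p $ 1 \<ge> 0 \<and> p $ 2 = 0}"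
    "vector [1, 0] \<notin> {p :: real^2. p $ 1 = 0 \<and> p $ 2 \<ge> 0}"
    by simp_all
  then show "{p :: real^2. p $ 1 \<ge> 0 \<and> p $ 2 = 0} \<noteq> {p. p $ 1 = 0 \<and> p $ 2 \<ge> 0}"
    by metis
qed

lemma listed_squares_sheared:
  "has_listed_form (quadratic_map ((!) [1, 0, 0, 0, 1, 0]) ((!) [0, 0, 1, 0, 0, 0]))" (is "has_listed_form ?F")
proof (rule listed_crossing_ray_parabola)
  have J0: "critical_set ?F = {p. p $ 1 = 0} \<union> {p. p $ 2 = 0}"
    by (auto simp: critical_simps)
  have "{p :: real^2. p $ 1 = 0} \<inter> {p. p $ 2 = 0} = {0}"
    by (auto simp: plane_eq_iff)
  then show "crosses_as_two_lines {p. p $ 1 = 0} {p. p $ 2 = 0} (critical_set ?F)"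
    unfolding crosses_as_two_lines_def J0 using is_line_vertical is_line_horizontal by blast
  have "q \<in> critical_image ?F" if "q $ 1 \<ge> 0 \<and> q $ 2 = 0" for q
    unfolding critical_image_def J0 using that
    by (intro image_eqI[of _ _ "vector [sqrt (q $ 1), 0]"])
      (auto simp: quadratic_map_eq_vector plane_eq_iff)
  moreover have "q \<in> critical_image ?F" if "q $ 2 = 1 * (q $ 1)\<^sup>2" for q
    unfolding critical_image_def J0 using that
    by (intro image_eqI[of _ _ "vector [0, q $ 1]"])
      (auto simp: quadratic_map_eq_vector plane_eq_iff)
  ultimately show "critical_image ?F = {p. p $ 1 \<ge> 0 \<and> p $ 2 = 0} \<union> {p. p $ 2 = 1 * (p $ 1)\<^sup>2}"
    by (auto simp: critical_simps)
  show "is_ray {p. p $ 1 \<ge> 0 \<and> p $ 2 = 0}"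
    unfolding is_ray_def using is_ray_from_right by blast
  show "is_parabola {p. p $ 2 = 1 * (p $ 1)\<^sup>2}"
    by (rule is_parabola_graph) simp
  show "{p :: real^2. p $ 1 \<ge> 0 \<and> p $ 2 = 0} \<inter> {p. p $ 2 = 1 * (p $ 1)\<^sup>2} = {0}"
    by (auto simp: plane_eq_iff)
qed

lemma listed_parallel_lines:
  "has_listed_form (quadratic_map ((!) [1, 0, 0, 1, 0, 0]) ((!) [0, 1, 0, 0, 0, 0]))" (is "has_listed_form ?F")
proof (rule listed_parallel)
  show "parallel_as_two_lines {p. p $ 1 = - 1 / 2} {p. p $ 1 = 0} (critical_set ?F)"
    using is_line_vertical unfolding parallel_as_two_lines_def by (auto simp: critical_simps)
  have "q \<in> ?F ` {p. p $ 1 = - 1 / 2}" if "q $ 1 = - 1 / 4" for q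
    using that by (intro image_eqI[of _ _ "vector [- 1 / 2, - 2 * q $ 2]"])
      (auto simp: quadratic_map_eq_vector plane_eq_iff power2_eq_square)
  then have image: "?F ` {p. p $ 1 = - 1 / 2} = {q. q $ 1 = - 1 / 4}"
    by (auto simp: quadratic_map_eq_vector power2_eq_square)
  then show "is_line (?F ` {p. p $ 1 = - 1 / 2})"
    using is_line_vertical by metis
  have "?F p = 0" if "p $ 1 = 0" for p
    using that by (simp add: quadratic_map_eq_vector plane_eq_iff)
  moreover have "(0 :: real^2) $ 1 = 0" by simp
  ultimately show "?F ` {p. p $ 1 = 0} = {0}"
    by (intro image_eq_singleton) blast+
  show "0 \<notin> ?F ` {p. p $ 1 = - 1 / 2}"
    unfolding image by simp
qed

lemma listed_coincident_lines:
  "has_listed_form (quadratic_map ((!) [1, 0, 0, 0, 0, 0]) ((!) [0, 1, 0, 0, 0, 0]))" (is "has_listed_form ?F")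
proof (rule listed_coincident)
  have "jacobian_det ?F p = 2 * (vector [1, 0] \<bullet> p + 0)\<^sup>2" for p
    by (simp add: jacobian_det_quadratic_map_list inner_vec_def sum_2 power2_eq_square)
  then show "zero_set_is_coincident_lines (jacobian_det ?F)"
    unfolding zero_set_is_coincident_lines_def
    by (intro exI[of _ "2 :: real"] exI[of _ "vector [1, 0]"] exI[of _ "0 :: real"]) (simp add: plane_eq_iff)
  have "?F p = 0" if "p $ 1 = 0" for p
    using that by (simp add: quadratic_map_eq_vector plane_eq_iff)
  moreover have "critical_set ?F = {p. p $ 1 = 0}"
    by (auto simp: critical_simps)
  moreover have "(0 :: real^2) $ 1 = 0" by simp
  ultimately show "critical_image ?F = {0}"
    unfolding critical_image_def by (intro image_eq_singleton) blast+
qed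

lemma zero_set_is_simple_lineI:
  assumes "\<And>p. h p = r * p $ 1 + s * p $ 2" "r \<noteq> 0 \<or> s \<noteq> 0"
  shows "zero_set_is_simple_line h"
  unfolding zero_set_is_simple_line_def using assms
  by (intro exI[of _ "vector [r, s]"] exI[of _ "0 :: real"]) (auto simp: plane_eq_iff inner_vec_def sum_2)

text \<open>
  The image of each of these maps lies on a line or a parabola, so every point is critical.
\<close>

lemma listed_rank_one_plane:
  "has_listed_form (quadratic_map ((!) [1, 0, 1, 0, 0, 0]) ((!) [0, 0, 0, 0, 0, 0]))" (is "has_listed_form ?F1")
  "has_listed_form (quadratic_map ((!) [0, 1, 0, 0, 0, 0]) ((!) [0, 0, 0, 0, 0, 0]))" (is "has_listed_form ?F2")
  "has_listed_form (quadratic_map ((!) [1, 0, 0, 0, 0, 0]) ((!) [0, 0, 0, 1, 0, 0]))" (is "has_listed_form ?F3")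
  "has_listed_form (quadratic_map ((!) [1, 0, 0, 0, 0, 0]) ((!) [0, 0, 0, 0, 0, 0]))" (is "has_listed_form ?F4")
  "has_listed_form (quadratic_map ((!) [1, 0, 0, 0, 1, 0]) ((!) [0, 0, 0, 0, 0, 0]))" (is "has_listed_form ?F5")
proof -
  let ?ray = "{q :: real^2. q $ 1 \<ge> 0 \<and> q $ 2 = 0}" and ?line = "{q :: real^2. q $ 2 = 0}"
    and ?parabola = "{q :: real^2. q $ 1 = 1 * (q $ 2)\<^sup>2}"
  have ray: "is_ray ?ray" unfolding is_ray_def using is_ray_from_right by blast
  have J0: "critical_set ?F1 = UNIV" "critical_set ?F2 = UNIV" "critical_set ?F3 = UNIV"
    "critical_set ?F4 = UNIV" "critical_set ?F5 = UNIV"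
    by (auto simp: critical_simps)
  have "q \<in> range ?F1" "q \<in> range ?F4" if "q \<in> ?ray" for q
    using that by (auto intro!: image_eqI[of _ _ "vector [sqrt (q $ 1), 0]"]
        simp: quadratic_map_eq_vector plane_eq_iff)
  then have "critical_image ?F1 = ?ray" "critical_image ?F4 = ?ray"
    unfolding critical_image_def J0 by (auto simp: quadratic_map_eq_vector)
  then show "has_listed_form ?F1" "has_listed_form ?F4"
    using listed_plane J0 ray by simp_all
  have "q \<in> range ?F2" if "q \<in> ?line" for q
    using that by (auto intro!: image_eqI[of _ _ "vector [1, q $ 1]"]
        simp: quadratic_map_eq_vector plane_eq_iff)
  moreover have "q \<in> range ?F5" if "q \<in> ?line" for q
    using that by (auto intro!: image_eqI[of _ _ "vector [0, q $ 1]"]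
        simp: quadratic_map_eq_vector plane_eq_iff)
  ultimately have "critical_image ?F2 = ?line" "critical_image ?F5 = ?line"
    unfolding critical_image_def J0 by (auto simp: quadratic_map_eq_vector)
  then show "has_listed_form ?F2" "has_listed_form ?F5"
    using listed_plane J0 is_line_horizontal by simp_all
  have "q \<in> range ?F3" if "q \<in> ?parabola" for q
    using that by (auto intro!: image_eqI[of _ _ "vector [q $ 2, 0]"]
        simp: quadratic_map_eq_vector plane_eq_iff)
  then have "critical_image ?F3 = ?parabola"
    unfolding critical_image_def J0 by (auto simp: quadratic_map_eq_vector)
  then show "has_listed_form ?F3"
    using listed_plane J0 is_parabola_graph(2)[of 1] by simp
qed

lemma listed_rank_one_simple_line:
  "has_listed_form (quadratic_map ((!) [1, 0, 1, 0, 0, 0]) ((!) [0, 0, 0, 0, 1, 0]))" (is "has_listed_form ?F1")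
  "has_listed_form (quadratic_map ((!) [0, 1, 0, 0, 0, 0]) ((!) [0, 0, 0, 1, 1, 0]))" (is "has_listed_form ?F2")
  "has_listed_form (quadratic_map ((!) [0, 1, 0, 0, 0, 0]) ((!) [0, 0, 0, 1, 0, 0]))" (is "has_listed_form ?F3")
  "has_listed_form (quadratic_map ((!) [1, 0, 0, 0, 0, 0]) ((!) [0, 0, 0, 0, 1, 0]))" (is "has_listed_form ?F4")
proof -
  have simple: "zero_set_is_simple_line (jacobian_det ?F1)" "zero_set_is_simple_line (jacobian_det ?F3)"
      "zero_set_is_simple_line (jacobian_det ?F4)"
    by (rule zero_set_is_simple_lineI[of _ "2" 0] zero_set_is_simple_lineI[of _ "-1" 0];
        simp add: jacobian_det_quadratic_map_list)+
  have simple2: "zero_set_is_simple_line (jacobian_det ?F2)"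
    by (rule zero_set_is_simple_lineI[of _ "-1" 1]; simp add: jacobian_det_quadratic_map_list)
  have J0: "critical_set ?F1 = {p. p $ 1 = 0}" "critical_set ?F3 = {p. p $ 1 = 0}"
      "critical_set ?F4 = {p. p $ 1 = 0}" "critical_set ?F2 = {p. p $ 1 = p $ 2}"
    by (auto simp: critical_simps)
  have "q \<in> critical_image ?F1" if "q $ 1 = 1 * (q $ 2)\<^sup>2" for q
    using that unfolding critical_image_def J0
    by (intro image_eqI[of _ _ "vector [0, q $ 2]"]) (auto simp: quadratic_map_eq_vector plane_eq_iff)
  then have "critical_image ?F1 = {q. q $ 1 = 1 * (q $ 2)\<^sup>2}"
    by (auto simp: critical_simps)
  then show "has_listed_form ?F1"
    using listed_simple_line[OF simple(1)] is_parabola_graph(2)[of 1] by simp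
  have "q \<in> critical_image ?F2" if "q $ 1 = 1 / 4 * (q $ 2)\<^sup>2" for q
    using that unfolding critical_image_def J0
    by (intro image_eqI[of _ _ "vector [q $ 2 / 2, q $ 2 / 2]"])
      (auto simp: quadratic_map_eq_vector plane_eq_iff power2_eq_square)
  then have "critical_image ?F2 = {q. q $ 1 = 1 / 4 * (q $ 2)\<^sup>2}"
    by (auto simp: critical_simps power2_eq_square)
  then show "has_listed_form ?F2"
    using listed_simple_line[OF simple2] is_parabola_graph(2)[of "1 / 4"] by simp
  have "?F3 p = 0" if "p $ 1 = 0" for p
    using that by (simp add: quadratic_map_eq_vector plane_eq_iff)
  moreover have "(0 :: real^2) $ 1 = 0" by simp
  ultimately have "critical_image ?F3 = {0}"
    unfolding critical_image_def J0 by (intro image_eq_singleton) blast+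
  then show "has_listed_form ?F3"
    using listed_simple_line[OF simple(2)] by blast
  have "q \<in> critical_image ?F4" if "q $ 1 = 0" for q
    using that unfolding critical_image_def J0
    by (intro image_eqI[of _ _ "vector [0, q $ 2]"]) (auto simp: quadratic_map_eq_vector plane_eq_iff)
  then have "critical_image ?F4 = {q. q $ 1 = 0}"
    by (auto simp: critical_simps)
  then show "has_listed_form ?F4"
    using listed_simple_line[OF simple(3)] is_line_vertical[of 0] by simp
qed

lemma listed_regular_shear:
  "has_listed_form (quadratic_map ((!) [1, 0, 0, 0, 1, 0]) ((!) [0, 0, 0, 1, 0, 0]))"
  by (rule listed_empty) (auto simp: critical_simps)

section \<open>Normal forms with a parabola or a hyperbola\<close>

text \<open>
  Three derivatives of the coordinate functions, the third one again differentiable: this is what the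
  cusp criterion needs.
\<close>

lemma smooth_regular_coordinates:
  assumes "smooth_regular \<gamma>"
  obtains x1 x2 x3 y1 y2 y3 where
    "\<And>t. ((\<lambda>t. \<gamma> t $ 1) has_real_derivative x1 t) (at t)"
    "\<And>t. (x1 has_real_derivative x2 t) (at t)" "\<And>t. (x2 has_real_derivative x3 t) (at t)"
    "\<And>t. x3 differentiable (at t)"
    "\<And>t. ((\<lambda>t. \<gamma> t $ 2) has_real_derivative y1 t) (at t)"
    "\<And>t. (y1 has_real_derivative y2 t) (at t)" "\<And>t. (y2 has_real_derivative y3 t) (at t)"
    "\<And>t. y3 differentiable (at t)"
    "\<And>t. x1 t \<noteq> 0 \<or> y1 t \<noteq> 0"
proof -
  from assms obtain g where g: "g 0 = \<gamma>" "\<And>n t. (g n has_vector_derivative g (Suc n) t) (at t)"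
    by (auto simp: smooth_regular_def infinitely_differentiable_iff)
  have "velocity \<gamma> t = g 1 t" for t
    using g(1) g(2)[of 0 t] by (intro velocity_eq) simp
  then have "g 1 t \<noteq> 0" for t
    using assms unfolding smooth_regular_def by metis
  then have "g 1 t $ 1 \<noteq> 0 \<or> g 1 t $ 2 \<noteq> 0" for t
    by (metis plane_eq_iff zero_index)
  moreover have der: "((\<lambda>t. g n t $ 1) has_real_derivative g (Suc n) t $ 1) (at t)"
      "((\<lambda>t. g n t $ 2) has_real_derivative g (Suc n) t $ 2) (at t)" for n t
    using g(2) by (auto simp: has_vector_derivative_plane)
  moreover from der have "(\<lambda>t. g n t $ 1) differentiable (at t)" "(\<lambda>t. g n t $ 2) differentiable (at t)" for n t
    using real_differentiable_def by blast+
  ultimately show ?thesis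
    using der[of 0] der[of 1] der[of 2] g(1)
    by (intro that[of "\<lambda>t. g 1 t $ 1" "\<lambda>t. g 2 t $ 1" "\<lambda>t. g 3 t $ 1"
          "\<lambda>t. g 1 t $ 2" "\<lambda>t. g 2 t $ 2" "\<lambda>t. g 3 t $ 2"]) (simp_all add: eval_nat_numeral)
qed

lemma smooth_regularI:
  assumes "\<And>n t. ((\<lambda>t. x n t) has_real_derivative x (Suc n) t) (at t)"
    and "\<And>n t. ((\<lambda>t. y n t) has_real_derivative y (Suc n) t) (at t)"
    and "\<And>t. x 1 t \<noteq> 0 \<or> y 1 t \<noteq> 0"
  shows "smooth_regular (\<lambda>t. vector [x 0 t, y 0 t])"
proof -
  let ?g = "\<lambda>n t. vector [x n t, y n t] :: real^2"
  have g: "(?g n has_vector_derivative ?g (Suc n) t) (at t)" for n t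
    using assms by (simp add: has_vector_derivative_plane)
  then have "infinitely_differentiable (?g 0)"
    unfolding infinitely_differentiable_iff by (intro exI[of _ ?g]) blast
  moreover have "velocity (?g 0) t \<noteq> 0" for t
    using velocity_eq[OF g[of 0 t]] assms(3)[of t] by (auto simp: plane_eq_iff)
  ultimately show ?thesis
    by (simp add: smooth_regular_def)
qed

lemma smooth_at_time_changed:
  "(\<alpha> has_vector_derivative k *\<^sub>R u) (at t) \<Longrightarrow> k \<noteq> 0 \<Longrightarrow> smooth_at \<alpha> t \<longleftrightarrow> u \<noteq> 0"
  by (simp add: smooth_at_def velocity_eq)

lemma single_cusp_curveI:
  assumes "open_parametrization \<gamma> S" and "p0 \<in> S"
    and "\<And>t. \<gamma> t = p0 \<Longrightarrow> is_cusp \<alpha> t" and "\<And>t. \<gamma> t \<noteq> p0 \<Longrightarrow> smooth_at \<alpha> t"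
  shows "single_cusp_curve \<alpha>"
proof -
  obtain t0 where "\<gamma> t0 = p0" using assms(1,2) by (auto simp: open_parametrization_def)
  moreover have "\<gamma> t \<noteq> p0" if "t \<noteq> t0" for t
    using that assms(1) \<open>\<gamma> t0 = p0\<close> by (auto simp: open_parametrization_def inj_def)
  ultimately show ?thesis
    unfolding single_cusp_curve_def using assms by blast
qed

text \<open>
  On the critical parabola \<open>y = 2 x\<^sup>2\<close> the map \<open>(x\<^sup>2 + y, x y)\<close> becomes \<open>(3 x\<^sup>2, 2 x\<^sup>3)\<close>, the semicubical
  parabola. Any regular parametrization has \<open>x' \<noteq> 0\<close>, so \<open>x\<close> itself can play the role of the
  standard parameter.
\<close>

lemma listed_cuspidal_parabola:
  "has_listed_form (quadratic_map ((!) [1, 0, 0, 0, 1, 0]) ((!) [0, 1, 0, 0, 0, 0]))" (is "has_listed_form ?F")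
proof (rule listed_parabola)
  let ?S = "{p :: real^2. p $ 2 = 2 * (p $ 1)\<^sup>2}"
  have J0: "critical_set ?F = ?S"
    by (auto simp: critical_simps power2_eq_square)
  show "is_parabola (critical_set ?F)"
    unfolding J0 by (rule is_parabola_graph) simp
  show "open_image_curve single_cusp_curve ?F (critical_set ?F)"
    unfolding J0 open_image_curve_def
  proof (intro conjI allI impI)
    let ?x = "\<lambda>(n :: nat) (t :: real). if n = 0 then t else if n = 1 then 1 else 0"
    let ?y = "\<lambda>(n :: nat) (t :: real). if n = 0 then 2 * t\<^sup>2 else if n = 1 then 4 * t else if n = 2 then 4 else 0"
    have "smooth_regular (\<lambda>t. vector [?x 0 t, ?y 0 t])"
    proof (rule smooth_regularI[of ?x ?y])
      fix n :: nat and t :: real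
      consider "n = 0" | "n = 1" | "n \<ge> 2" by linarith
      then show "(?x n has_real_derivative ?x (Suc n) t) (at t)" "(?y n has_real_derivative ?y (Suc n) t) (at t)"
        by cases (auto intro!: derivative_eq_intros)
    qed simp
    moreover have "p \<in> range (\<lambda>t. vector [t, 2 * t\<^sup>2])" if "p \<in> ?S" for p
      using that by (intro image_eqI[of _ _ "p $ 1"]) (auto simp: plane_eq_iff)
    then have "range (\<lambda>t. vector [t, 2 * t\<^sup>2]) = ?S" by auto
    moreover have "inj (\<lambda>t. vector [t, 2 * t\<^sup>2] :: real^2)"
      by (auto simp: inj_def plane_eq_iff)
    ultimately show "\<exists>\<gamma>. open_parametrization \<gamma> ?S"
      unfolding open_parametrization_def by (intro exI[of _ "\<lambda>t. vector [t, 2 * t\<^sup>2]"]) simp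
  next
    fix \<gamma> assume \<gamma>: "open_parametrization \<gamma> ?S"
    then have "smooth_regular \<gamma>" by (simp add: open_parametrization_def)
    from smooth_regular_coordinates[OF this] obtain x1 x2 x3 y1 where
      x: "\<And>t. ((\<lambda>t. \<gamma> t $ 1) has_real_derivative x1 t) (at t)"
        "\<And>t. (x1 has_real_derivative x2 t) (at t)" "\<And>t. (x2 has_real_derivative x3 t) (at t)"
        "\<And>t. x3 differentiable (at t)"
      and y: "\<And>t. ((\<lambda>t. \<gamma> t $ 2) has_real_derivative y1 t) (at t)"
      and nz: "\<And>t. x1 t \<noteq> 0 \<or> y1 t \<noteq> 0"
      by metis
    have Y: "\<gamma> t $ 2 = 2 * (\<gamma> t $ 1)\<^sup>2" for t
      using \<gamma> by (auto simp: open_parametrization_def)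
    have "((\<lambda>t. 2 * (\<gamma> t $ 1)\<^sup>2) has_real_derivative 4 * \<gamma> t $ 1 * x1 t) (at t)" for t
      by (rule derivative_eq_intros x refl)+ simp
    then have y1: "y1 t = 4 * \<gamma> t $ 1 * x1 t" for t
      using DERIV_unique[OF y] unfolding Y by blast
    then have k: "x1 t \<noteq> 0" for t
      using nz[of t] by auto
    let ?u = "\<lambda>t. vector [6 * \<gamma> t $ 1, 6 * (\<gamma> t $ 1)\<^sup>2] :: real^2"
    have \<alpha>: "((?F \<circ> \<gamma>) has_vector_derivative x1 t *\<^sub>R ?u t) (at t)" for t
      unfolding has_vector_derivative_plane o_def quadratic_map_eq_vector
      by (auto intro!: derivative_eq_intros x y simp: Y y1 power2_eq_square algebra_simps)
    show "single_cusp_curve (?F \<circ> \<gamma>)"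
    proof (rule single_cusp_curveI[OF \<gamma>])
      show "0 \<in> ?S" by simp
    next
      fix t assume "\<gamma> t = 0"
      show "is_cusp (?F \<circ> \<gamma>) t"
      proof (rule is_cusp_if_time_changed[OF \<alpha> _ _ _ x(2,3,4) k])
        show "(?u has_vector_derivative x1 t *\<^sub>R vector [6, 12 * \<gamma> t $ 1]) (at t)" for t
          unfolding has_vector_derivative_plane
          by (auto intro!: derivative_eq_intros x simp: algebra_simps)
        show "((\<lambda>t. vector [6, 12 * \<gamma> t $ 1] :: real^2) has_vector_derivative x1 t *\<^sub>R vector [0, 12]) (at t)" for t
          unfolding has_vector_derivative_plane
          by (auto intro!: derivative_eq_intros x simp: algebra_simps)
      qed (use \<open>\<gamma> t = 0\<close> in \<open>simp_all add: plane_eq_iff wedge_def\<close>)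
    next
      fix t assume "\<gamma> t \<noteq> 0"
      then have "?u t \<noteq> 0" by (auto simp: plane_eq_iff Y)
      then show "smooth_at (?F \<circ> \<gamma>) t"
        using smooth_at_time_changed[OF \<alpha> k] by blast
    qed
  qed
qed

text \<open>
  A connected set that contains \<open>U\<close> meets \<open>A\<close>, hence avoids \<open>B\<close> and with it \<open>V\<close>.
\<close>

lemma components_eq_pair:
  assumes "connected U" "connected V" "U \<noteq> {}" "V \<noteq> {}"
    and "open A" "open B" "A \<inter> B = {}" "U \<subseteq> A" "V \<subseteq> B"
  shows "components (U \<union> V) = {U, V}"
proof -
  have maximal: "U \<in> components (U \<union> V)"
    if "connected U" "U \<noteq> {}" "open A" "open B" "A \<inter> B = {}" "U \<subseteq> A" "V \<subseteq> B" for U V A B :: "'a set"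
  proof -
    have "D = U" if D: "U \<subseteq> D" "D \<subseteq> U \<union> V" "connected D" for D
    proof -
      have "A \<inter> D = {} \<or> B \<inter> D = {}"
      proof (rule connectedD[OF D(3) \<open>open A\<close> \<open>open B\<close>])
        show "A \<inter> B \<inter> D = {}" using \<open>A \<inter> B = {}\<close> by simp
        show "D \<subseteq> A \<union> B" using D(2) \<open>U \<subseteq> A\<close> \<open>V \<subseteq> B\<close> by blast
      qed
      moreover have "A \<inter> D \<noteq> {}"
        using \<open>U \<noteq> {}\<close> \<open>U \<subseteq> A\<close> D(1) by blast
      ultimately show "D = U"
        using D \<open>V \<subseteq> B\<close> by blast
    qed
    then show ?thesis
      using \<open>connected U\<close> \<open>U \<noteq> {}\<close> by (auto simp: in_components_maximal)
  qed
  have "U \<in> components (U \<union> V)" "V \<in> components (U \<union> V)"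
    using maximal[of U A B V] maximal[of V B A U] assms by (auto simp: Un_commute Int_commute)
  moreover have "c = U \<or> c = V" if c: "c \<in> components (U \<union> V)" for c
  proof -
    have "c \<inter> U \<noteq> {} \<or> c \<inter> V \<noteq> {}"
      using in_components_nonempty[OF c] in_components_subset[OF c] by blast
    then show ?thesis
      using components_nonoverlap[OF c] calculation by blast
  qed
  ultimately show ?thesis by blast
qed

lemma hyperbola_branch_parametrization:
  fixes \<epsilon> :: real
  assumes "\<epsilon> = 1 \<or> \<epsilon> = - 1"
  shows "open_parametrization (\<lambda>t. vector [\<epsilon> * exp t, \<epsilon> * exp (- t)]) {p. p $ 1 * p $ 2 = 1 \<and> \<epsilon> * p $ 1 > 0}"
    (is "open_parametrization ?\<gamma> ?S")
proof -
  have "smooth_regular (\<lambda>t. vector [\<epsilon> * exp t, \<epsilon> * (- 1) ^ 0 * exp (- t)])"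
    using assms by (intro smooth_regularI[of "\<lambda>n t. \<epsilon> * exp t" "\<lambda>n t. \<epsilon> * (- 1) ^ n * exp (- t)"])
      (auto intro!: derivative_eq_intros)
  moreover have "inj ?\<gamma>"
    using assms by (auto simp: inj_def plane_eq_iff)
  moreover have "p \<in> range ?\<gamma>" if "p \<in> ?S" for p
    using that assms by (intro image_eqI[of _ _ "ln (\<epsilon> * p $ 1)"])
      (auto simp: plane_eq_iff exp_minus field_simps)
  then have "range ?\<gamma> = ?S"
    using assms by (auto simp flip: exp_add)
  ultimately show ?thesis
    by (simp add: open_parametrization_def)
qed

text \<open>
  On \<open>x y = 1\<close>, with the parameter for which \<open>x' = x\<close> and \<open>y' = - y\<close>, the velocity of
  \<open>(x\<^sup>2 + 2 y, y\<^sup>2 + 2 x)\<close> is \<open>(2 x\<^sup>2 - 2 y, 2 x - 2 y\<^sup>2)\<close>. It vanishes where \<open>x\<^sup>3 = 1\<close>, that is, at \<open>(1, 1)\<close>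
  only, so the cusp lies on the positive branch.
\<close>

lemma listed_cuspidal_hyperbola:
  "has_listed_form (quadratic_map ((!) [1, 0, 0, 0, 2, 0]) ((!) [0, 0, 1, 2, 0, 0]))" (is "has_listed_form ?F")
proof -
  define S where "S \<epsilon> = {p :: real^2. p $ 1 * p $ 2 = 1 \<and> \<epsilon> * p $ 1 > 0}" for \<epsilon> :: real
  have cases: "p $ 1 * p $ 2 = 1 \<Longrightarrow> p $ 1 > 0 \<or> p $ 1 < 0" for p :: "real^2"
    by (metis linorder_neqE_linordered_idom mult_zero_left zero_neq_one)
  have J0: "critical_set ?F = {p. p $ 1 * p $ 2 = 1}"
    by (auto simp: critical_simps)
  have J0S: "critical_set ?F = S (- 1) \<union> S 1"
    unfolding J0 S_def using cases by auto
  have param: "\<exists>\<gamma>. open_parametrization \<gamma> (S \<epsilon>)" if "\<epsilon> = 1 \<or> \<epsilon> = - 1" for \<epsilon>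
    unfolding S_def using hyperbola_branch_parametrization[OF that] by blast
  have conn: "connected (S \<epsilon>) \<and> S \<epsilon> \<noteq> {}" if \<epsilon>: "\<epsilon> = 1 \<or> \<epsilon> = - 1" for \<epsilon>
  proof -
    obtain \<gamma> where \<gamma>: "smooth_regular \<gamma>" "range \<gamma> = S \<epsilon>"
      using param[OF \<epsilon>] by (auto simp: open_parametrization_def)
    have "\<gamma> differentiable (at t)" for t
      using \<gamma>(1) unfolding smooth_regular_def infinitely_differentiable_def by (metis funpow_0)
    then have "continuous_on UNIV \<gamma>"
      by (simp add: continuous_at_imp_continuous_on differentiable_imp_continuous_within)
    then show ?thesis
      using \<gamma>(2) connected_continuous_image[of UNIV \<gamma>] connected_UNIV by (metis UNIV_not_empty image_is_empty)
  qed
  have comp: "components (critical_set ?F) = {S (- 1), S 1}"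
    unfolding J0S
  proof (intro components_eq_pair[where A = "{p. p $ 1 < 0}" and B = "{p. p $ 1 > 0}"])
    show "S (- 1) \<subseteq> {p. p $ 1 < 0}" "S 1 \<subseteq> {p. p $ 1 > 0}"
      by (auto simp: S_def)
  qed (use conn[of 1] conn[of "- 1"] in \<open>auto intro!: open_Collect_less continuous_intros\<close>)
  have \<alpha>: "\<exists>k k1 k2. (\<forall>t. ((?F \<circ> \<gamma>) has_vector_derivative k t *\<^sub>R
        vector [2 * (\<gamma> t $ 1)\<^sup>2 - 2 * \<gamma> t $ 2, 2 * \<gamma> t $ 1 - 2 * (\<gamma> t $ 2)\<^sup>2]) (at t) \<and>
      ((\<lambda>t. \<gamma> t $ 1) has_real_derivative k t * \<gamma> t $ 1) (at t) \<and>
      ((\<lambda>t. \<gamma> t $ 2) has_real_derivative - k t * \<gamma> t $ 2) (at t) \<and>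
      (k has_real_derivative k1 t) (at t) \<and> (k1 has_real_derivative k2 t) (at t) \<and>
      k2 differentiable (at t) \<and> k t \<noteq> 0)"
    if \<gamma>: "open_parametrization \<gamma> (S \<epsilon>)" for \<gamma> \<epsilon>
  proof -
    from \<gamma> have "smooth_regular \<gamma>" by (simp add: open_parametrization_def)
    then obtain x1 x2 x3 y1 y2 y3 where
      x: "\<And>t. ((\<lambda>t. \<gamma> t $ 1) has_real_derivative x1 t) (at t)"
        "\<And>t. (x1 has_real_derivative x2 t) (at t)" "\<And>t. (x2 has_real_derivative x3 t) (at t)"
        "\<And>t. x3 differentiable (at t)"
      and y: "\<And>t. ((\<lambda>t. \<gamma> t $ 2) has_real_derivative y1 t) (at t)"
        "\<And>t. (y1 has_real_derivative y2 t) (at t)" "\<And>t. (y2 has_real_derivative y3 t) (at t)"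
        "\<And>t. y3 differentiable (at t)"
      and nz: "\<And>t. x1 t \<noteq> 0 \<or> y1 t \<noteq> 0"
      by (rule smooth_regular_coordinates) blast
    have "\<gamma> t \<in> S \<epsilon>" for t
      using \<gamma> by (auto simp: open_parametrization_def)
    then have one: "\<gamma> t $ 1 * \<gamma> t $ 2 = 1" for t
      by (auto simp: S_def)
    have "((\<lambda>t. \<gamma> t $ 1 * \<gamma> t $ 2) has_real_derivative x1 t * \<gamma> t $ 2 + y1 t * \<gamma> t $ 1) (at t)" for t
      by (rule derivative_eq_intros x y refl)+
    then have rel: "x1 t * \<gamma> t $ 2 + y1 t * \<gamma> t $ 1 = 0" for t
      using DERIV_unique[OF DERIV_const] unfolding one by (metis (full_types))
    \<comment> \<open>The logarithmic derivative of the first coordinate, since \<open>y = 1 / x\<close>.\<close>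
    define k where "k t = x1 t * \<gamma> t $ 2" for t
    have x1: "x1 t = k t * \<gamma> t $ 1" for t
      using one[of t] by (simp add: k_def algebra_simps)
    have y1: "y1 t = - k t * \<gamma> t $ 2" for t
      using one[of t] rel[of t] unfolding k_def by algebra
    have k: "k t \<noteq> 0" for t
      using nz[of t] x1[of t] y1[of t] by auto
    have k1: "(k has_real_derivative x2 t * \<gamma> t $ 2 + x1 t * y1 t) (at t)" for t
      unfolding k_def by (rule derivative_eq_intros x y refl)+ simp
    have k2: "((\<lambda>t. x2 t * \<gamma> t $ 2 + x1 t * y1 t) has_real_derivative
        x3 t * \<gamma> t $ 2 + x2 t * y1 t + (x2 t * y1 t + x1 t * y2 t)) (at t)" for t
      by (rule derivative_eq_intros x y refl)+ simp
    have "x1 differentiable (at t)" "x2 differentiable (at t)" "y1 differentiable (at t)" "y2 differentiable (at t)"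
      "(\<lambda>t. \<gamma> t $ 2) differentiable (at t)" for t
      using x y real_differentiable_def by blast+
    then have k3: "(\<lambda>t. x3 t * \<gamma> t $ 2 + x2 t * y1 t + (x2 t * y1 t + x1 t * y2 t)) differentiable (at t)" for t
      using x(4) by (intro derivative_intros) auto
    have "((?F \<circ> \<gamma>) has_vector_derivative k t *\<^sub>R
        vector [2 * (\<gamma> t $ 1)\<^sup>2 - 2 * \<gamma> t $ 2, 2 * \<gamma> t $ 1 - 2 * (\<gamma> t $ 2)\<^sup>2]) (at t)" for t
      unfolding has_vector_derivative_plane o_def quadratic_map_eq_vector
      by (auto intro!: derivative_eq_intros x y simp: x1 y1 power2_eq_square algebra_simps)
    then show ?thesis
      using k k1 k2 k3 x(1)[unfolded x1] y(1)[unfolded y1]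
      by - (rule exI[of _ k], rule exI[of _ "\<lambda>t. x2 t * \<gamma> t $ 2 + x1 t * y1 t"],
          rule exI[of _ "\<lambda>t. x3 t * \<gamma> t $ 2 + x2 t * y1 t + (x2 t * y1 t + x1 t * y2 t)"], simp)
  qed
  show ?thesis
  proof (rule listed_hyperbola[OF _ comp])
    show "is_hyperbola (critical_set ?F)"
      unfolding is_hyperbola_def J0
      by (rule exI[of _ 0], rule exI[of _ 1], rule exI[of _ 0], rule exI[of _ 0], rule exI[of _ 0], rule exI[of _ "- 1"])
        (auto simp: conic_def conic_matrix_def det_3)
    have "vector [1, 1] \<in> S 1" "vector [1, 1] \<notin> S (- 1)"
      by (simp_all add: S_def)
    then show "S (- 1) \<noteq> S 1" by metis
    show "open_image_curve smooth_curve ?F (S (- 1))"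
      unfolding open_image_curve_def
    proof (intro conjI allI impI)
      show "\<exists>\<gamma>. open_parametrization \<gamma> (S (- 1))" by (rule param) simp
    next
      fix \<gamma> assume \<gamma>: "open_parametrization \<gamma> (S (- 1))"
      obtain k where k: "\<And>t. ((?F \<circ> \<gamma>) has_vector_derivative k t *\<^sub>R
        vector [2 * (\<gamma> t $ 1)\<^sup>2 - 2 * \<gamma> t $ 2, 2 * \<gamma> t $ 1 - 2 * (\<gamma> t $ 2)\<^sup>2]) (at t)" "\<And>t. k t \<noteq> 0"
        using \<alpha>[OF \<gamma>] by blast
      have "\<gamma> t $ 1 < 0" for t
        using \<gamma> by (auto simp: open_parametrization_def S_def)
      then have "2 * \<gamma> t $ 1 - 2 * (\<gamma> t $ 2)\<^sup>2 < 0" for t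
        by (smt (verit) zero_le_power2)
      then show "smooth_curve (?F \<circ> \<gamma>)"
        unfolding smooth_curve_def using smooth_at_time_changed[OF k]
        by (metis less_irrefl vector_2(2) zero_index)
    qed
    show "open_image_curve single_cusp_curve ?F (S 1)"
      unfolding open_image_curve_def
    proof (intro conjI allI impI)
      show "\<exists>\<gamma>. open_parametrization \<gamma> (S 1)" by (rule param) simp
    next
      fix \<gamma> assume \<gamma>: "open_parametrization \<gamma> (S 1)"
      let ?u = "\<lambda>t. vector [2 * (\<gamma> t $ 1)\<^sup>2 - 2 * \<gamma> t $ 2, 2 * \<gamma> t $ 1 - 2 * (\<gamma> t $ 2)\<^sup>2] :: real^2"
      obtain k k1 k2 where F\<gamma>: "\<And>t. ((?F \<circ> \<gamma>) has_vector_derivative k t *\<^sub>R ?u t) (at t)"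
        and x: "\<And>t. ((\<lambda>t. \<gamma> t $ 1) has_real_derivative k t * \<gamma> t $ 1) (at t)"
        and y: "\<And>t. ((\<lambda>t. \<gamma> t $ 2) has_real_derivative - k t * \<gamma> t $ 2) (at t)"
        and k: "\<And>t. (k has_real_derivative k1 t) (at t)" "\<And>t. (k1 has_real_derivative k2 t) (at t)"
          "\<And>t. k2 differentiable (at t)" "\<And>t. k t \<noteq> 0"
        using \<alpha>[OF \<gamma>] by blast
      show "single_cusp_curve (?F \<circ> \<gamma>)"
      proof (rule single_cusp_curveI[OF \<gamma>])
        show "vector [1, 1] \<in> S 1" by (simp add: S_def)
      next
        fix t assume t: "\<gamma> t = vector [1, 1]"
        let ?v = "\<lambda>t. vector [4 * (\<gamma> t $ 1)\<^sup>2 + 2 * \<gamma> t $ 2, 2 * \<gamma> t $ 1 + 4 * (\<gamma> t $ 2)\<^sup>2] :: real^2"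
        let ?w = "\<lambda>t. vector [8 * (\<gamma> t $ 1)\<^sup>2 - 2 * \<gamma> t $ 2, 2 * \<gamma> t $ 1 - 8 * (\<gamma> t $ 2)\<^sup>2] :: real^2"
        show "is_cusp (?F \<circ> \<gamma>) t"
        proof (rule is_cusp_if_time_changed[OF F\<gamma> _ _ _ k])
          show "(?u has_vector_derivative k t *\<^sub>R ?v t) (at t)" for t
            unfolding has_vector_derivative_plane
            by (auto intro!: derivative_eq_intros x y simp: algebra_simps power2_eq_square)
          show "(?v has_vector_derivative k t *\<^sub>R ?w t) (at t)" for t
            unfolding has_vector_derivative_plane
            by (auto intro!: derivative_eq_intros x y simp: algebra_simps power2_eq_square)
          have "(?w has_vector_derivative k t *\<^sub>R vector [16 * (\<gamma> t $ 1)\<^sup>2 + 2 * \<gamma> t $ 2,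
              2 * \<gamma> t $ 1 + 16 * (\<gamma> t $ 2)\<^sup>2]) (at t)"
            unfolding has_vector_derivative_plane
            by (auto intro!: derivative_eq_intros x y simp: algebra_simps power2_eq_square)
          then show "?w differentiable (at t)" by (rule differentiableI_vector)
        qed (simp_all add: t plane_eq_iff wedge_def)
      next
        fix t assume t: "\<gamma> t \<noteq> vector [1, 1]"
        have S: "\<gamma> t $ 1 * \<gamma> t $ 2 = 1" "\<gamma> t $ 1 > 0"
          using \<gamma> by (auto simp: open_parametrization_def S_def)
        have "?u t \<noteq> 0"
        proof
          assume "?u t = 0"
          then have "?u t $ 1 = 0" by simp
          then have "(\<gamma> t $ 1)\<^sup>2 = \<gamma> t $ 2" by simp
          moreover have "(\<gamma> t $ 1) ^ 3 = \<gamma> t $ 1 * (\<gamma> t $ 1)\<^sup>2"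
            by (simp add: power2_eq_square power3_eq_cube)
          ultimately have "(\<gamma> t $ 1) ^ 3 = 1 ^ 3"
            using S(1) by simp
          then have "\<gamma> t $ 1 = 1"
            using S(2) power_eq_imp_eq_base[of "\<gamma> t $ 1" 3 1] by simp
          then show False using t S(1) by (simp add: plane_eq_iff)
        qed
        then show "smooth_at (?F \<circ> \<gamma>) t"
          using smooth_at_time_changed[OF F\<gamma> k(4)] by blast
      qed
    qed
  qed
qed

section \<open>The normal form with a circle\<close>

lemma is_ellipse_unit_circle: "is_ellipse {p. (p $ 1)\<^sup>2 + (p $ 2)\<^sup>2 = 1}"
proof -
  have "vector [1, 0] \<in> {p :: real^2. (p $ 1)\<^sup>2 + (p $ 2)\<^sup>2 = 1}" by simp
  moreover have "{p. (p $ 1)\<^sup>2 + (p $ 2)\<^sup>2 = 1} = conic 1 0 1 0 0 (- 1)"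
    by (auto simp: conic_def)
  moreover have "det (conic_matrix 1 0 1 0 0 (- 1)) \<noteq> 0"
    by (simp add: conic_matrix_def det_3)
  ultimately show ?thesis
    unfolding is_ellipse_def
    by - (rule conjI, blast, rule exI[of _ 1], rule exI[of _ 0], rule exI[of _ 1], rule exI[of _ 0],
        rule exI[of _ 0], rule exI[of _ "- 1"], simp)
qed

lemma unit_circle_parametrization:
  "closed_parametrization (\<lambda>t. vector [cos t, sin t]) (2 * pi) {p. (p $ 1)\<^sup>2 + (p $ 2)\<^sup>2 = 1}"
    (is "closed_parametrization ?\<gamma> _ ?S")
proof -
  have "smooth_regular (\<lambda>t. vector [cos (t + real 0 * (pi / 2)), sin (t + real 0 * (pi / 2))])"
  proof (rule smooth_regularI[of "\<lambda>n t. cos (t + real n * (pi / 2))" "\<lambda>n t. sin (t + real n * (pi / 2))"])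
    fix n :: nat and t :: real
    have *: "t + real (Suc n) * (pi / 2) = (t + real n * (pi / 2)) + pi / 2"
      by (simp add: algebra_simps)
    show "((\<lambda>t. cos (t + real n * (pi / 2))) has_real_derivative cos (t + real (Suc n) * (pi / 2))) (at t)"
      unfolding * cos_add[of _ "pi / 2"] by (auto intro!: derivative_eq_intros)
    show "((\<lambda>t. sin (t + real n * (pi / 2))) has_real_derivative sin (t + real (Suc n) * (pi / 2))) (at t)"
      unfolding * sin_add[of _ "pi / 2"] by (auto intro!: derivative_eq_intros)
  next
    fix t :: real
    show "cos (t + real 1 * (pi / 2)) \<noteq> 0 \<or> sin (t + real 1 * (pi / 2)) \<noteq> 0"
      by (metis sin_zero_abs_cos_one abs_zero zero_neq_one)
  qed
  moreover have "inj_on ?\<gamma> {0..<2 * pi}"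
  proof (rule inj_onI)
    fix s t :: real assume st: "s \<in> {0..<2 * pi}" "t \<in> {0..<2 * pi}" "?\<gamma> s = ?\<gamma> t"
    then obtain n :: int where n: "s = t + 2 * pi * n"
      using sin_cos_eq_iff[of s t] by (auto simp: plane_eq_iff)
    have "(2 * pi) * real_of_int n < (2 * pi) * real_of_int 1"
        "(2 * pi) * real_of_int (- 1) < (2 * pi) * real_of_int n"
      using st(1,2) n unfolding atLeastLessThan_iff by (simp_all only: of_int_1 of_int_minus) linarith+
    then have "n < 1" "- 1 < n"
      by (simp_all only: mult_less_cancel_left_pos[of "2 * pi"] of_int_less_iff pi_gt_zero
          zero_less_mult_iff zero_less_numeral simp_thms)
    then show "s = t" using n by simp
  qed
  moreover have "p \<in> range ?\<gamma>" if "p \<in> ?S" for p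
  proof -
    obtain t where "p $ 1 = cos t" "p $ 2 = sin t"
      using sincos_total_2pi[of "p $ 1" "p $ 2"] \<open>p \<in> ?S\<close> by auto
    then show ?thesis by (intro image_eqI[of _ _ t]) (simp_all add: plane_eq_iff)
  qed
  then have "range ?\<gamma> = ?S" by auto
  ultimately show ?thesis
    by (simp add: closed_parametrization_def)
qed

lemma closed_parametrization_onto_period:
  assumes "closed_parametrization \<gamma> T S"
  shows "\<gamma> ` {0..<T} = S"
proof -
  have T: "T > 0" and per: "\<And>t. \<gamma> (t + T) = \<gamma> t" and range: "range \<gamma> = S"
    using assms by (auto simp: closed_parametrization_def)
  interpret periodic_fun_simple \<gamma> T
    by unfold_locales (rule per)
  have "\<gamma> t \<in> \<gamma> ` {0..<T}" for t
  proof -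
    define s where "s = t + of_int (- \<lfloor>t / T\<rfloor>) * T"
    have "\<gamma> s = \<gamma> t" unfolding s_def by (rule plus_of_int)
    moreover have "s / T = frac (t / T)"
      using T by (simp add: s_def frac_def field_simps)
    then have "s = frac (t / T) * T" using T by (simp add: field_simps)
    then have "s \<in> {0..<T}"
      using T frac_lt_1[of "t / T"] by (simp add: mult_less_cancel_right2)
    ultimately show ?thesis by (metis imageI)
  qed
  then show ?thesis using range by auto
qed

text \<open>
  A period is mapped bijectively onto the closed curve, so the cusp parameters in it correspond to the
  points of \<open>K\<close>.
\<close>

lemma closed_three_cusp_curveI:
  assumes \<gamma>: "closed_parametrization \<gamma> T S" and K: "K \<subseteq> S" "card K = 3" "inj_on F K"
    and cusp: "\<And>t. \<gamma> t \<in> K \<Longrightarrow> is_cusp (F \<circ> \<gamma>) t"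
    and smooth: "\<And>t. \<gamma> t \<notin> K \<Longrightarrow> smooth_at (F \<circ> \<gamma>) t"
  shows "closed_three_cusp_curve (F \<circ> \<gamma>) T"
proof -
  define C where "C = {t \<in> {0..<T}. \<gamma> t \<in> K}"
  have inj: "inj_on \<gamma> C"
    using \<gamma> unfolding closed_parametrization_def C_def by (auto intro: inj_on_subset)
  have img: "\<gamma> ` C = K"
    using closed_parametrization_onto_period[OF \<gamma>] K(1) unfolding C_def by auto
  have "card C = 3"
    using card_image[OF inj] img K(2) by simp
  moreover have "inj_on (F \<circ> \<gamma>) C"
    using comp_inj_on[OF inj, of F] img K(3) by simp
  moreover have "\<forall>t. (F \<circ> \<gamma>) (t + T) = (F \<circ> \<gamma>) t"
    using \<gamma> by (simp add: closed_parametrization_def)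
  ultimately show ?thesis
    unfolding closed_three_cusp_curve_def
    using cusp smooth by (intro conjI exI[of _ C]) (auto simp: C_def)
qed

text \<open>
  This is the complex map \<open>z\<^sup>2 + 2 cnj z\<close>. Its restriction to the circle \<open>z = exp (i \<theta>)\<close> has the
  derivative \<open>2 i (z\<^sup>2 - cnj z)\<close> with respect to \<open>\<theta>\<close>, which vanishes at the cube roots of unity; the
  image is the deltoid.
\<close>

lemma listed_deltoid:
  "has_listed_form (quadratic_map ((!) [1, 0, -1, 2, 0, 0]) ((!) [0, 2, 0, 0, -2, 0]))" (is "has_listed_form ?F")
proof (rule listed_ellipse)
  let ?S = "{p :: real^2. (p $ 1)\<^sup>2 + (p $ 2)\<^sup>2 = 1}"
  have "jacobian_det ?F p = 4 * ((p $ 1)\<^sup>2 + (p $ 2)\<^sup>2 - 1)" for p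
    by (simp add: jacobian_det_quadratic_map_list power2_eq_square algebra_simps)
  then have J0: "critical_set ?F = ?S"
    by (auto simp: critical_set_def)
  show "is_ellipse (critical_set ?F)"
    unfolding J0 by (rule is_ellipse_unit_circle)
  show "closed_image_curve closed_three_cusp_curve ?F (critical_set ?F)"
    unfolding J0 closed_image_curve_def
  proof (intro conjI allI impI)
    show "\<exists>\<gamma> T. closed_parametrization \<gamma> T ?S"
      using unit_circle_parametrization by blast
  next
    fix \<gamma> T assume \<gamma>: "closed_parametrization \<gamma> T ?S"
    then have "smooth_regular \<gamma>" by (simp add: closed_parametrization_def)
    then obtain x1 x2 x3 y1 y2 y3 where
      x: "\<And>t. ((\<lambda>t. \<gamma> t $ 1) has_real_derivative x1 t) (at t)"
        "\<And>t. (x1 has_real_derivative x2 t) (at t)" "\<And>t. (x2 has_real_derivative x3 t) (at t)"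
        "\<And>t. x3 differentiable (at t)"
      and y: "\<And>t. ((\<lambda>t. \<gamma> t $ 2) has_real_derivative y1 t) (at t)"
        "\<And>t. (y1 has_real_derivative y2 t) (at t)" "\<And>t. (y2 has_real_derivative y3 t) (at t)"
        "\<And>t. y3 differentiable (at t)"
      and nz: "\<And>t. x1 t \<noteq> 0 \<or> y1 t \<noteq> 0"
      by (rule smooth_regular_coordinates) blast
    have one: "(\<gamma> t $ 1)\<^sup>2 + (\<gamma> t $ 2)\<^sup>2 = 1" for t
      using \<gamma> by (auto simp: closed_parametrization_def)
    have "((\<lambda>t. (\<gamma> t $ 1)\<^sup>2 + (\<gamma> t $ 2)\<^sup>2) has_real_derivative
        2 * (x1 t * \<gamma> t $ 1) + 2 * (y1 t * \<gamma> t $ 2)) (at t)" for t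
      by (auto intro!: derivative_eq_intros x y)
    then have "2 * (x1 t * \<gamma> t $ 1) + 2 * (y1 t * \<gamma> t $ 2) = 0" for t
      using DERIV_unique[OF _ DERIV_const] unfolding one by blast
    then have rel: "x1 t * \<gamma> t $ 1 + y1 t * \<gamma> t $ 2 = 0" for t
      by (metis distrib_left mult_eq_0_iff zero_neq_numeral)
    \<comment> \<open>The angular velocity of \<open>\<gamma>\<close>.\<close>
    define k where "k t = \<gamma> t $ 1 * y1 t - \<gamma> t $ 2 * x1 t" for t
    have x1: "x1 t = - k t * \<gamma> t $ 2" and y1: "y1 t = k t * \<gamma> t $ 1" for t
      using one[of t] rel[of t] unfolding k_def by algebra+
    have k: "k t \<noteq> 0" for t
      using nz[of t] x1[of t] y1[of t] by auto
    have k1: "(k has_real_derivative \<gamma> t $ 1 * y2 t - \<gamma> t $ 2 * x2 t) (at t)" for t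
      unfolding k_def by (auto intro!: derivative_eq_intros x y simp: algebra_simps)
    have k2: "((\<lambda>t. \<gamma> t $ 1 * y2 t - \<gamma> t $ 2 * x2 t) has_real_derivative
        x1 t * y2 t + \<gamma> t $ 1 * y3 t - (y1 t * x2 t + \<gamma> t $ 2 * x3 t)) (at t)" for t
      by (auto intro!: derivative_eq_intros x y simp: algebra_simps)
    have "x1 differentiable (at t)" "x2 differentiable (at t)" "y1 differentiable (at t)" "y2 differentiable (at t)"
      "(\<lambda>t. \<gamma> t $ 1) differentiable (at t)" "(\<lambda>t. \<gamma> t $ 2) differentiable (at t)" for t
      using x y real_differentiable_def by blast+
    then have k3: "(\<lambda>t. x1 t * y2 t + \<gamma> t $ 1 * y3 t - (y1 t * x2 t + \<gamma> t $ 2 * x3 t)) differentiable (at t)" for t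
      using x(4) y(4) by (intro derivative_intros) auto
    let ?u = "\<lambda>t. vector [- 4 * \<gamma> t $ 1 * \<gamma> t $ 2 - 2 * \<gamma> t $ 2,
      2 * (\<gamma> t $ 1)\<^sup>2 - 2 * (\<gamma> t $ 2)\<^sup>2 - 2 * \<gamma> t $ 1] :: real^2"
    let ?v = "\<lambda>t. vector [4 * (\<gamma> t $ 2)\<^sup>2 - 4 * (\<gamma> t $ 1)\<^sup>2 - 2 * \<gamma> t $ 1,
      - 8 * \<gamma> t $ 1 * \<gamma> t $ 2 + 2 * \<gamma> t $ 2] :: real^2"
    let ?w = "\<lambda>t. vector [16 * \<gamma> t $ 1 * \<gamma> t $ 2 + 2 * \<gamma> t $ 2,
      8 * (\<gamma> t $ 2)\<^sup>2 - 8 * (\<gamma> t $ 1)\<^sup>2 + 2 * \<gamma> t $ 1] :: real^2"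
    have u: "((?F \<circ> \<gamma>) has_vector_derivative k t *\<^sub>R ?u t) (at t)" for t
      unfolding has_vector_derivative_plane o_def quadratic_map_eq_vector
      by (auto intro!: derivative_eq_intros x(1) y(1) simp: x1 y1 power2_eq_square algebra_simps)
    have v: "(?u has_vector_derivative k t *\<^sub>R ?v t) (at t)" for t
      unfolding has_vector_derivative_plane
      by (auto intro!: derivative_eq_intros x(1) y(1) simp: x1 y1 power2_eq_square algebra_simps)
    have w: "(?v has_vector_derivative k t *\<^sub>R ?w t) (at t)" for t
      unfolding has_vector_derivative_plane
      by (auto intro!: derivative_eq_intros x(1) y(1) simp: x1 y1 power2_eq_square algebra_simps)
    have w': "?w differentiable (at t)" for t
    proof -
      have "(?w has_vector_derivative vector [16 * (x1 t * \<gamma> t $ 2 + \<gamma> t $ 1 * y1 t) + 2 * y1 t,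
          16 * (y1 t * \<gamma> t $ 2) - 16 * (x1 t * \<gamma> t $ 1) + 2 * x1 t]) (at t)"
        unfolding has_vector_derivative_plane
        by (auto intro!: derivative_eq_intros x(1) y(1) simp: algebra_simps)
      then show ?thesis by (rule differentiableI_vector)
    qed
    define r where "r = sqrt 3 / 2"
    have r: "r\<^sup>2 = 3 / 4" "r > 0"
      by (simp_all add: r_def power_divide)
    \<comment> \<open>The cube roots of unity.\<close>
    define K :: "(real^2) set" where "K = {vector [1, 0], vector [- 1 / 2, r], vector [- 1 / 2, - r]}"
    show "closed_three_cusp_curve (?F \<circ> \<gamma>) T"
    proof (rule closed_three_cusp_curveI[OF \<gamma>])
      show "K \<subseteq> ?S"
        using r by (auto simp: K_def power_divide)
      show "card K = 3"
        using r by (simp add: K_def plane_eq_iff)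
      show "inj_on ?F K"
        using r by (auto simp: K_def inj_on_def quadratic_map_eq_vector plane_eq_iff power_divide)
    next
      fix t assume t: "\<gamma> t \<in> K"
      show "is_cusp (?F \<circ> \<gamma>) t"
      proof (rule is_cusp_if_time_changed[OF u v w w' k1 k2 k3 k])
        show "?u t = 0"
          using t r by (auto simp: K_def plane_eq_iff power_divide)
        have pt: "\<gamma> t $ 1 = 1 \<and> \<gamma> t $ 2 = 0 \<or> \<gamma> t $ 1 = - 1 / 2 \<and> (\<gamma> t $ 2)\<^sup>2 = 3 / 4"
          using t r(1) by (auto simp: K_def)
        have "wedge (?v t) (?w t) =
            (4 * (\<gamma> t $ 2)\<^sup>2 - 4 * (\<gamma> t $ 1)\<^sup>2 - 2 * \<gamma> t $ 1) *
            (8 * (\<gamma> t $ 2)\<^sup>2 - 8 * (\<gamma> t $ 1)\<^sup>2 + 2 * \<gamma> t $ 1) -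
            (2 - 8 * \<gamma> t $ 1) * (2 + 16 * \<gamma> t $ 1) * (\<gamma> t $ 2)\<^sup>2"
          unfolding wedge_def vector_2 by (simp add: algebra_simps power2_eq_square)
        also have "\<dots> = 36"
          using pt by (elim disjE conjE; simp only:; simp add: power_divide)
        finally show "wedge (?v t) (?w t) \<noteq> 0" by simp
      qed
    next
      fix t assume t: "\<gamma> t \<notin> K"
      have "?u t \<noteq> 0"
      proof
        assume "?u t = 0"
        then have "?u t $ 1 = 0" "?u t $ 2 = 0" by simp_all
        then have u0: "- 4 * \<gamma> t $ 1 * \<gamma> t $ 2 - 2 * \<gamma> t $ 2 = 0"
          "2 * (\<gamma> t $ 1)\<^sup>2 - 2 * (\<gamma> t $ 2)\<^sup>2 - 2 * \<gamma> t $ 1 = 0"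
          by simp_all
        have "\<gamma> t $ 2 * (2 * \<gamma> t $ 1 + 1) = - (1 / 2) * (- 4 * \<gamma> t $ 1 * \<gamma> t $ 2 - 2 * \<gamma> t $ 2)"
          by (simp add: algebra_simps)
        then have 1: "\<gamma> t $ 2 * (2 * \<gamma> t $ 1 + 1) = 0"
          unfolding u0 by simp
        have 2: "(\<gamma> t $ 1)\<^sup>2 - (\<gamma> t $ 2)\<^sup>2 = \<gamma> t $ 1"
          using u0(2) by linarith
        have "\<gamma> t $ 2 = 0 \<or> 2 * \<gamma> t $ 1 + 1 = 0"
          using 1 by (simp only: mult_eq_0_iff)
        then consider "\<gamma> t $ 2 = 0" | "\<gamma> t $ 1 = - 1 / 2" by linarith
        then have "\<gamma> t \<in> K"
        proof cases
          case 1
          then have "\<gamma> t $ 1 = 1" using one[of t] 2 by simp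
          with 1 show ?thesis by (simp add: K_def plane_eq_iff)
        next
          case 2
          then have "(\<gamma> t $ 2)\<^sup>2 = r\<^sup>2" using one[of t] r by (simp add: power_divide)
          then have "\<gamma> t $ 2 = r \<or> \<gamma> t $ 2 = - r" by (simp add: power2_eq_iff)
          with 2 show ?thesis by (auto simp: K_def plane_eq_iff)
        qed
        with t show False by simp
      qed
      then show "smooth_at (?F \<circ> \<gamma>) t"
        using smooth_at_time_changed[OF u k] by blast
    qed
  qed
qed

section \<open>Reduction to the normal forms\<close>

text \<open>
  A form of affine invariance that is convenient for computations: to bring \<open>F\<close> to the normal form \<open>G\<close>,
  substitute \<open>l(x, y) + w\<close> for the variables of \<open>F\<close> and write the result as \<open>m(G(x, y)) + v\<close>.
\<close>

lemma has_listed_form_transfer: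
  fixes a b a' b' :: "nat \<Rightarrow> real"
  defines "F \<equiv> quadratic_map a b" and "G \<equiv> quadratic_map a' b'"
  assumes G: "has_listed_form G"
    and l: "l11 * l22 - l12 * l21 \<noteq> 0" and m: "m11 * m22 - m12 * m21 \<noteq> 0"
    and eq: "\<And>p. F (vector [l11 * p $ 1 + l12 * p $ 2 + w1, l21 * p $ 1 + l22 * p $ 2 + w2]) =
      vector [m11 * G p $ 1 + m12 * G p $ 2 + v1, m21 * G p $ 1 + m22 * G p $ 2 + v2]"
  shows "has_listed_form F"
proof -
  let ?A = "\<lambda>p :: real^2. vector [m11 * p $ 1 + m12 * p $ 2 + v1, m21 * p $ 1 + m22 * p $ 2 + v2] :: real^2"
  let ?B = "\<lambda>p :: real^2. vector [l11 * p $ 1 + l12 * p $ 2 + w1, l21 * p $ 1 + l22 * p $ 2 + w2] :: real^2"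
  have A: "affine_iso ?A" and B: "affine_iso ?B"
    using affine_iso_planeI l m by blast+
  have "F = ?A \<circ> G \<circ> inv ?B"
  proof
    fix p
    have "?B (inv ?B p) = p"
      using affine_iso_bij[OF B] by (rule surj_f_inv_f[OF bij_is_surj])
    with eq[of "inv ?B p"] have "F p = ?A (G (inv ?B p))"
      by (simp only:)
    then show "F p = (?A \<circ> G \<circ> inv ?B) p"
      by (simp only: o_apply)
  qed
  moreover have "has_listed_form (?A \<circ> G \<circ> inv ?B)"
    by (rule has_listed_form_affine[OF A affine_iso_inv[OF B] _ G])
      (simp add: G_def quadratic_map_differentiable)
  ultimately show ?thesis by (simp only:)
qed

lemma linear_system_solvable:
  fixes m11 :: real
  assumes "m11 * m22 - m12 * m21 \<noteq> 0"
  obtains s t where "m11 * s + m12 * t = u" "m21 * s + m22 * t = v"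
proof
  define D where "D = m11 * m22 - m12 * m21"
  have "D \<noteq> 0" using assms by (simp add: D_def)
  then show "m11 * ((m22 * u - m12 * v) / D) + m12 * ((m11 * v - m21 * u) / D) = u"
    "m21 * ((m22 * u - m12 * v) / D) + m22 * ((m11 * v - m21 * u) / D) = v"
    by (simp_all add: divide_simps) (simp_all add: D_def algebra_simps)
qed

text \<open>
  Doubling the second component gives the complex map \<open>z\<^sup>2 + \<alpha> z + \<beta> cnj z\<close> up to a constant, with
  \<open>\<alpha> = p + i q\<close> and \<open>\<beta> = r + i s\<close>. Translation by \<open>- \<alpha> / 2\<close> removes the term \<open>\<alpha> z\<close>. If \<open>\<beta> \<noteq> 0\<close>, the
  substitution \<open>z = c \<zeta>\<close> gives \<open>c\<^sup>2 (\<zeta>\<^sup>2 + 2 cnj \<zeta>)\<close> provided that \<open>2 c\<^sup>2 = \<beta> cnj c\<close>.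
\<close>

lemma listed_pencil_elliptic_monic:
  "has_listed_form (quadratic_map ((!) [1, 0, -1, a3, a4, a5]) ((!) [0, 1, 0, b3, b4, b5]))"
    (is "has_listed_form ?F")
proof -
  define p q r s where "p = (a3 + 2 * b4) / 2" and "q = (2 * b3 - a4) / 2"
    and "r = (a3 - 2 * b4) / 2" and "s = (2 * b3 + a4) / 2"
  have coeffs: "a3 = p + r" "a4 = s - q" "b3 = (q + s) / 2" "b4 = (p - r) / 2"
    by (simp_all add: p_def q_def r_def s_def field_simps)
  let ?v = "?F (vector [- p / 2, - q / 2])"
  show ?thesis
  proof (cases "r = 0 \<and> s = 0")
    case True
    show ?thesis
    proof (rule has_listed_form_transfer[OF listed_complex_square])
      show "1 * 1 - 0 * 0 \<noteq> (0 :: real)" "1 * 1 - 0 * 0 \<noteq> (0 :: real)" by simp_all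
      show "?F (vector [1 * z $ 1 + 0 * z $ 2 + - p / 2, 0 * z $ 1 + 1 * z $ 2 + - q / 2]) =
        vector [1 * quadratic_map ((!) [1, 0, -1, 0, 0, 0]) ((!) [0, 1, 0, 0, 0, 0]) z $ 1 +
            0 * quadratic_map ((!) [1, 0, -1, 0, 0, 0]) ((!) [0, 1, 0, 0, 0, 0]) z $ 2 + ?v $ 1,
          0 * quadratic_map ((!) [1, 0, -1, 0, 0, 0]) ((!) [0, 1, 0, 0, 0, 0]) z $ 1 +
            1 * quadratic_map ((!) [1, 0, -1, 0, 0, 0]) ((!) [0, 1, 0, 0, 0, 0]) z $ 2 + ?v $ 2]" for z
        using True by (simp add: quadratic_map_eq_vector plane_eq_iff coeffs power2_eq_square field_simps)
    qed
  next
    case False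
    obtain d where d: "Complex r s = d ^ 3"
      using exists_complex_root[of 3 "Complex r s"] by auto
    \<comment> \<open>With \<open>c = t d\<close>, \<open>t\<close> real, the equation \<open>2 c\<^sup>2 = \<beta> cnj c\<close> becomes \<open>2 t d\<^sup>2 = d\<^sup>3 cnj d\<close>.\<close>
    define c where "c = of_real ((cmod d)\<^sup>2 / 2) * d"
    have "d \<noteq> 0" using d False by (auto simp: complex_eq_iff)
    then have "c \<noteq> 0" by (simp add: c_def)
    have "2 * c\<^sup>2 = Complex r s * cnj c"
    proof -
      have "Complex r s * cnj c = d\<^sup>2 * (d * cnj d) * of_real ((cmod d)\<^sup>2 / 2)"
        by (simp add: d c_def power2_eq_square power3_eq_cube)
      also have "\<dots> = 2 * c\<^sup>2"
        by (simp add: c_def complex_norm_square[symmetric] power2_eq_square)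
      finally show ?thesis by simp
    qed
    then have c: "2 * ((Re c)\<^sup>2 - (Im c)\<^sup>2) = r * Re c + s * Im c" "4 * Re c * Im c = s * Re c - r * Im c"
      by (simp_all add: complex_eq_iff power2_eq_square mult_ac)
    have nz: "(Re c)\<^sup>2 + (Im c)\<^sup>2 \<noteq> 0"
      using \<open>c \<noteq> 0\<close> by (auto simp: complex_eq_iff sum_power2_eq_zero_iff)
    let ?G = "quadratic_map ((!) [1, 0, -1, 2, 0, 0]) ((!) [0, 2, 0, 0, -2, 0])"
    show ?thesis
    proof (rule has_listed_form_transfer[OF listed_deltoid])
      show "Re c * Re c - (- Im c) * Im c \<noteq> 0"
        using nz by (simp add: power2_eq_square)
      have "((Re c)\<^sup>2 - (Im c)\<^sup>2) * (((Re c)\<^sup>2 - (Im c)\<^sup>2) / 2) - (- 2 * Re c * Im c) * (Re c * Im c) =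
          ((Re c)\<^sup>2 + (Im c)\<^sup>2)\<^sup>2 / 2"
        by (simp add: power2_eq_square field_simps)
      then show "((Re c)\<^sup>2 - (Im c)\<^sup>2) * (((Re c)\<^sup>2 - (Im c)\<^sup>2) / 2) - (- 2 * Re c * Im c) * (Re c * Im c) \<noteq> 0"
        using nz by (simp only:) simp
      fix z :: "real^2"
      have e1: "r * Re c + s * Im c = 2 * ((Re c)\<^sup>2 - (Im c)\<^sup>2)" and e2: "s * Re c - r * Im c = 4 * Re c * Im c"
        using c by simp_all
      have "?F (vector [Re c * z $ 1 + (- Im c) * z $ 2 + - p / 2, Im c * z $ 1 + Re c * z $ 2 + - q / 2]) $ 1 =
          ((Re c)\<^sup>2 - (Im c)\<^sup>2) * ((z $ 1)\<^sup>2 - (z $ 2)\<^sup>2) - 4 * Re c * Im c * (z $ 1 * z $ 2) +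
          (r * Re c + s * Im c) * z $ 1 + (s * Re c - r * Im c) * z $ 2 + ?v $ 1"
        by (simp add: quadratic_map_eq_vector coeffs power2_eq_square field_simps)
      moreover have "?F (vector [Re c * z $ 1 + (- Im c) * z $ 2 + - p / 2, Im c * z $ 1 + Re c * z $ 2 + - q / 2]) $ 2 =
          Re c * Im c * ((z $ 1)\<^sup>2 - (z $ 2)\<^sup>2) + ((Re c)\<^sup>2 - (Im c)\<^sup>2) * (z $ 1 * z $ 2) +
          ((s * Re c - r * Im c) * z $ 1 - (r * Re c + s * Im c) * z $ 2) / 2 + ?v $ 2"
        by (simp add: quadratic_map_eq_vector coeffs power2_eq_square field_simps)
      ultimately show "?F (vector [Re c * z $ 1 + (- Im c) * z $ 2 + - p / 2, Im c * z $ 1 + Re c * z $ 2 + - q / 2]) =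
          vector [((Re c)\<^sup>2 - (Im c)\<^sup>2) * ?G z $ 1 + (- 2 * Re c * Im c) * ?G z $ 2 + ?v $ 1,
            (Re c * Im c) * ?G z $ 1 + (((Re c)\<^sup>2 - (Im c)\<^sup>2) / 2) * ?G z $ 2 + ?v $ 2]"
        unfolding e1 e2 plane_eq_iff vector_2 quadratic_map_eq_vector[of 1 0 "-1" 2] by (simp add: field_simps)
    qed
  qed
qed

text \<open>
  Completing the squares leaves \<open>(x\<^sup>2 + a4 y, y\<^sup>2 + b3 x)\<close>. If both coefficients are nonzero, scaling
  \<open>x\<close> by \<open>c\<close> and \<open>y\<close> by \<open>d\<close> turns them into \<open>2\<close> when \<open>a4 d = 2 c\<^sup>2\<close> and \<open>b3 c = 2 d\<^sup>2\<close>, which amounts to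
  a cubic equation for \<open>c\<close>.
\<close>

lemma listed_pencil_hyperbolic_monic:
  "has_listed_form (quadratic_map ((!) [1, 0, 0, a3, a4, a5]) ((!) [0, 0, 1, b3, b4, b5]))"
    (is "has_listed_form ?F")
proof -
  define w1 w2 where "w1 = - a3 / 2" and "w2 = - b4 / 2"
  define v where "v = ?F (vector [w1, w2])"
  have F: "?F (vector [x + w1, y + w2]) = vector [x\<^sup>2 + a4 * y + v $ 1, y\<^sup>2 + b3 * x + v $ 2]" for x y
    by (simp add: quadratic_map_eq_vector v_def plane_eq_iff w1_def w2_def power2_eq_square field_simps)
  consider "a4 = 0" "b3 = 0" | "a4 \<noteq> 0" "b3 = 0" | "a4 = 0" "b3 \<noteq> 0" | "a4 \<noteq> 0" "b3 \<noteq> 0" by blast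
  then show ?thesis
  proof cases
    case 1
    show ?thesis
      by (rule has_listed_form_transfer[OF listed_squares,
            where ?l11.0 = 1 and ?l12.0 = 0 and ?l21.0 = 0 and ?l22.0 = 1 and ?w1.0 = w1 and ?w2.0 = w2 and
            ?m11.0 = 1 and ?m12.0 = 0 and ?m21.0 = 0 and ?m22.0 = 1 and ?v1.0 = "v $ 1" and ?v2.0 = "v $ 2"])
        (simp_all only: F, simp_all add: 1 quadratic_map_eq_vector)
  next
    case 2
    show ?thesis
      by (rule has_listed_form_transfer[OF listed_squares_sheared,
            where ?l11.0 = 1 and ?l12.0 = 0 and ?l21.0 = 0 and ?l22.0 = "1 / a4" and ?w1.0 = w1 and ?w2.0 = w2 and
            ?m11.0 = 1 and ?m12.0 = 0 and ?m21.0 = 0 and ?m22.0 = "1 / a4\<^sup>2" and ?v1.0 = "v $ 1" and ?v2.0 = "v $ 2"])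
        (simp_all only: F, simp_all add: 2 quadratic_map_eq_vector power_divide)
  next
    case 3
    show ?thesis
      by (rule has_listed_form_transfer[OF listed_squares_sheared,
            where ?l11.0 = 0 and ?l12.0 = "1 / b3" and ?l21.0 = 1 and ?l22.0 = 0 and ?w1.0 = w1 and ?w2.0 = w2 and
            ?m11.0 = 0 and ?m12.0 = "1 / b3\<^sup>2" and ?m21.0 = 1 and ?m22.0 = 0 and ?v1.0 = "v $ 1" and ?v2.0 = "v $ 2"])
        (simp_all only: F, simp_all add: 3 quadratic_map_eq_vector power_divide)
  next
    case 4
    define c where "c = root 3 (a4\<^sup>2 * b3 / 8)"
    have c3: "c ^ 3 = a4\<^sup>2 * b3 / 8"
      unfolding c_def by (rule odd_real_root_pow) simp
    then have c0: "c \<noteq> 0" using 4 by auto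
    define d where "d = 2 * c\<^sup>2 / a4"
    have d0: "d \<noteq> 0" using 4 c0 by (simp add: d_def)
    have e1: "a4 * d = 2 * c\<^sup>2" using 4 by (simp add: d_def)
    have "2 * d\<^sup>2 * a4\<^sup>2 = 8 * c ^ 3 * c"
      using 4 by (simp add: d_def power2_eq_square power3_eq_cube)
    then have "2 * d\<^sup>2 * a4\<^sup>2 = b3 * c * a4\<^sup>2" by (simp add: c3)
    then have e2: "b3 * c = 2 * d\<^sup>2" using 4 by simp
    have F': "?F (vector [c * x + 0 * y + w1, 0 * x + d * y + w2]) =
        vector [c\<^sup>2 * (x\<^sup>2 + 2 * y) + v $ 1, d\<^sup>2 * (y\<^sup>2 + 2 * x) + v $ 2]" for x y
      using F[of "c * x" "d * y"] e1 e2
      by (simp add: power_mult_distrib distrib_left mult.assoc[symmetric] mult.commute)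
    show ?thesis
      by (rule has_listed_form_transfer[OF listed_cuspidal_hyperbola,
            where ?l11.0 = c and ?l12.0 = 0 and ?l21.0 = 0 and ?l22.0 = d and ?w1.0 = w1 and ?w2.0 = w2 and
            ?m11.0 = "c\<^sup>2" and ?m12.0 = 0 and ?m21.0 = 0 and ?m22.0 = "d\<^sup>2" and ?v1.0 = "v $ 1" and ?v2.0 = "v $ 2"])
        (simp_all only: F', simp_all add: c0 d0 quadratic_map_eq_vector)
  qed
qed

text \<open>
  A translation turns the map into \<open>(x\<^sup>2 + e x + a4 y, x y)\<close>. If \<open>a4 \<noteq> 0\<close>, the shear
  \<open>y \<mapsto> y + k x\<close>, whose effect \<open>k x\<^sup>2\<close> on the second component is undone by subtracting \<open>k\<close> times the first
  component, removes the linear term \<open>e x\<close> for \<open>k = - e / (3 a4)\<close>, after a further translation.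
  If \<open>a4 = 0\<close>, the term \<open>e x\<close> can only be scaled.
\<close>

lemma listed_pencil_degenerate_monic:
  "has_listed_form (quadratic_map ((!) [1, 0, 0, a3, a4, a5]) ((!) [0, 1, 0, b3, b4, b5]))"
    (is "has_listed_form ?F")
proof (cases "a4 = 0")
  case False
  define e where "e = a3 - 2 * b4"
  define k where "k = - e / (3 * a4)"
  \<comment> \<open>The offsets \<open>k a4\<close> and \<open>- k\<^sup>2 a4\<close> cancel the terms in \<open>y\<close> and \<open>x\<close> that the shear and the subtraction leave.\<close>
  define w1 w2 where "w1 = k * a4 - b4" and "w2 = - k\<^sup>2 * a4 - b3"
  define v where "v = ?F (vector [w1, w2])"
  have e: "e = - (3 * a4 * k)" using False by (simp add: k_def)
  have a3: "a3 = 2 * b4 - 3 * a4 * k" using e by (simp add: e_def)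
  have F: "?F (vector [1 * x + 0 * y + w1, k * x + (1 / a4) * y + w2]) =
      vector [x\<^sup>2 + y + v $ 1, k * (x\<^sup>2 + y) + x * y / a4 + (v $ 2)]" for x y
    using False unfolding v_def plane_eq_iff quadratic_map_eq_vector vector_2 w1_def w2_def a3
    by (simp add: power2_eq_square field_simps)
  show ?thesis
    by (rule has_listed_form_transfer[OF listed_cuspidal_parabola,
          where ?l11.0 = 1 and ?l12.0 = 0 and ?l21.0 = k and ?l22.0 = "1 / a4" and ?w1.0 = w1 and ?w2.0 = w2 and
          ?m11.0 = 1 and ?m12.0 = 0 and ?m21.0 = k and ?m22.0 = "1 / a4" and ?v1.0 = "v $ 1" and ?v2.0 = "v $ 2"])
      (simp_all only: F, simp_all add: False quadratic_map_eq_vector)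
next
  case a4: True
  define e where "e = a3 - 2 * b4"
  have a3: "a3 = e + 2 * b4" by (simp add: e_def)
  define v where "v = ?F (vector [- b4, - b3])"
  have F: "?F (vector [x + - b4, y + - b3]) = vector [x\<^sup>2 + e * x + v $ 1, x * y + v $ 2]" for x y
    by (simp add: quadratic_map_eq_vector v_def plane_eq_iff a3 a4 power2_eq_square algebra_simps)
  show ?thesis
  proof (cases "e = 0")
    case True
    show ?thesis
      by (rule has_listed_form_transfer[OF listed_coincident_lines,
            where ?l11.0 = 1 and ?l12.0 = 0 and ?l21.0 = 0 and ?l22.0 = 1 and ?w1.0 = "- b4" and ?w2.0 = "- b3" and
            ?m11.0 = 1 and ?m12.0 = 0 and ?m21.0 = 0 and ?m22.0 = 1 and ?v1.0 = "v $ 1" and ?v2.0 = "v $ 2"])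
        (simp_all only: F, simp_all add: True quadratic_map_eq_vector)
  next
    case False
    show ?thesis
      by (rule has_listed_form_transfer[OF listed_parallel_lines,
            where ?l11.0 = e and ?l12.0 = 0 and ?l21.0 = 0 and ?l22.0 = 1 and ?w1.0 = "- b4" and ?w2.0 = "- b3" and
            ?m11.0 = "e\<^sup>2" and ?m12.0 = 0 and ?m21.0 = 0 and ?m22.0 = e and ?v1.0 = "v $ 1" and ?v2.0 = "v $ 2"])
        (simp_all only: F, simp_all add: False quadratic_map_eq_vector power2_eq_square algebra_simps)
  qed
qed

lemma listed_rank_one_elliptic:
  "has_listed_form (quadratic_map ((!) [1, 0, 1, a3, a4, a5]) ((!) [0, 0, 0, b3, b4, b5]))"
    (is "has_listed_form ?F")
proof -
  define w1 w2 where "w1 = - a3 / 2" and "w2 = - a4 / 2"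
  define v where "v = ?F (vector [w1, w2])"
  have F: "?F (vector [x + w1, y + w2]) = vector [x\<^sup>2 + y\<^sup>2 + v $ 1, b3 * x + b4 * y + v $ 2]" for x y
    by (simp add: quadratic_map_eq_vector v_def plane_eq_iff w1_def w2_def power2_eq_square field_simps)
  show ?thesis
  proof (cases "b3 = 0 \<and> b4 = 0")
    case True
    show ?thesis
      by (rule has_listed_form_transfer[OF listed_rank_one_plane(1),
            where ?l11.0 = 1 and ?l12.0 = 0 and ?l21.0 = 0 and ?l22.0 = 1 and ?w1.0 = w1 and ?w2.0 = w2 and
            ?m11.0 = 1 and ?m12.0 = 0 and ?m21.0 = 0 and ?m22.0 = 1 and ?v1.0 = "v $ 1" and ?v2.0 = "v $ 2"])
        (simp_all only: F, simp_all add: True quadratic_map_eq_vector)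
  next
    case False
    \<comment> \<open>A rotation scaled by the square root of \<open>n\<close> makes the affine component a multiple of \<open>y\<close>.\<close>
    define n where "n = b3\<^sup>2 + b4\<^sup>2"
    have n: "n \<noteq> 0" using False by (simp add: n_def sum_power2_eq_zero_iff)
    have det: "b4 * b4 - b3 * (- b3) = n"
      by (simp add: n_def power2_eq_square)
    have F': "?F (vector [b4 * x + b3 * y + w1, - b3 * x + b4 * y + w2]) =
        vector [n * (x\<^sup>2 + y\<^sup>2) + v $ 1, n * y + v $ 2]" for x y
      using F[of "b4 * x + b3 * y" "- b3 * x + b4 * y"]
      by (simp add: n_def power2_eq_square algebra_simps)
    show ?thesis
      by (rule has_listed_form_transfer[OF listed_rank_one_simple_line(1),
            where ?l11.0 = b4 and ?l12.0 = b3 and ?l21.0 = "- b3" and ?l22.0 = b4 and ?w1.0 = w1 and ?w2.0 = w2 and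
            ?m11.0 = n and ?m12.0 = 0 and ?m21.0 = 0 and ?m22.0 = n and ?v1.0 = "v $ 1" and ?v2.0 = "v $ 2"])
        (simp_all only: F' det, simp_all add: n quadratic_map_eq_vector)
  qed
qed

lemma listed_rank_one_hyperbolic:
  "has_listed_form (quadratic_map ((!) [0, 1, 0, a3, a4, a5]) ((!) [0, 0, 0, b3, b4, b5]))"
    (is "has_listed_form ?F")
proof -
  define v where "v = ?F (vector [- a4, - a3])"
  have F: "?F (vector [x + - a4, y + - a3]) = vector [x * y + v $ 1, b3 * x + b4 * y + v $ 2]" for x y
    by (simp add: quadratic_map_eq_vector v_def plane_eq_iff algebra_simps)
  consider "b3 = 0" "b4 = 0" | "b3 \<noteq> 0" "b4 = 0" | "b3 = 0" "b4 \<noteq> 0" | "b3 \<noteq> 0" "b4 \<noteq> 0" by blast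
  then show ?thesis
  proof cases
    case 1
    show ?thesis
      by (rule has_listed_form_transfer[OF listed_rank_one_plane(2),
            where ?l11.0 = 1 and ?l12.0 = 0 and ?l21.0 = 0 and ?l22.0 = 1 and ?w1.0 = "- a4" and ?w2.0 = "- a3" and
            ?m11.0 = 1 and ?m12.0 = 0 and ?m21.0 = 0 and ?m22.0 = 1 and ?v1.0 = "v $ 1" and ?v2.0 = "v $ 2"])
        (simp_all only: F, simp_all add: 1 quadratic_map_eq_vector)
  next
    case 2
    show ?thesis
      by (rule has_listed_form_transfer[OF listed_rank_one_simple_line(3),
            where ?l11.0 = 1 and ?l12.0 = 0 and ?l21.0 = 0 and ?l22.0 = 1 and ?w1.0 = "- a4" and ?w2.0 = "- a3" and
            ?m11.0 = 1 and ?m12.0 = 0 and ?m21.0 = 0 and ?m22.0 = b3 and ?v1.0 = "v $ 1" and ?v2.0 = "v $ 2"])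
        (simp_all only: F, simp_all add: 2 quadratic_map_eq_vector)
  next
    case 3
    show ?thesis
      by (rule has_listed_form_transfer[OF listed_rank_one_simple_line(3),
            where ?l11.0 = 0 and ?l12.0 = 1 and ?l21.0 = 1 and ?l22.0 = 0 and ?w1.0 = "- a4" and ?w2.0 = "- a3" and
            ?m11.0 = 1 and ?m12.0 = 0 and ?m21.0 = 0 and ?m22.0 = b4 and ?v1.0 = "v $ 1" and ?v2.0 = "v $ 2"])
        (simp_all only: F, simp_all add: 3 quadratic_map_eq_vector mult.commute)
  next
    case 4
    show ?thesis
      by (rule has_listed_form_transfer[OF listed_rank_one_simple_line(2),
            where ?l11.0 = "1 / b3" and ?l12.0 = 0 and ?l21.0 = 0 and ?l22.0 = "1 / b4" and ?w1.0 = "- a4" and ?w2.0 = "- a3" and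
            ?m11.0 = "1 / (b3 * b4)" and ?m12.0 = 0 and ?m21.0 = 0 and ?m22.0 = 1 and ?v1.0 = "v $ 1" and ?v2.0 = "v $ 2"])
        (simp_all only: F, simp_all add: 4 quadratic_map_eq_vector)
  qed
qed

lemma listed_rank_one_parabolic:
  "has_listed_form (quadratic_map ((!) [1, 0, 0, a3, a4, a5]) ((!) [0, 0, 0, b3, b4, b5]))"
    (is "has_listed_form ?F")
proof (cases "b4 = 0")
  case False
  \<comment> \<open>With the second component as new coordinate in place of \<open>y\<close>, the translation by \<open>w1\<close> completes the square in \<open>x\<close>.\<close>
  define w1 where "w1 = (a4 * b3 / b4 - a3) / 2"
  define w2 where "w2 = - b3 * w1 / b4"
  define v where "v = ?F (vector [w1, w2])"
  have a3: "a3 = a4 * b3 / b4 - 2 * w1" using False by (simp add: w1_def field_simps)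
  have F: "?F (vector [1 * x + 0 * y + w1, (- b3 / b4) * x + (1 / b4) * y + w2]) =
      vector [x\<^sup>2 + (a4 / b4) * y + v $ 1, y + v $ 2]" for x y
    using False unfolding v_def plane_eq_iff quadratic_map_eq_vector vector_2 a3
    by (simp add: power2_eq_square field_simps)
  show ?thesis
    by (rule has_listed_form_transfer[OF listed_rank_one_simple_line(4),
          where ?l11.0 = 1 and ?l12.0 = 0 and ?l21.0 = "- b3 / b4" and ?l22.0 = "1 / b4" and ?w1.0 = w1 and ?w2.0 = w2 and
          ?m11.0 = 1 and ?m12.0 = "a4 / b4" and ?m21.0 = 0 and ?m22.0 = 1 and ?v1.0 = "v $ 1" and ?v2.0 = "v $ 2"])
      (simp_all only: F, simp_all add: False quadratic_map_eq_vector)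
next
  case b4: True
  define w1 where "w1 = - a3 / 2"
  define v where "v = ?F (vector [w1, 0])"
  have F: "?F (vector [x + w1, y + 0]) = vector [x\<^sup>2 + a4 * y + v $ 1, b3 * x + v $ 2]" for x y
    by (simp add: quadratic_map_eq_vector v_def plane_eq_iff w1_def b4 power2_eq_square field_simps)
  consider "a4 = 0" "b3 = 0" | "a4 = 0" "b3 \<noteq> 0" | "a4 \<noteq> 0" "b3 = 0" | "a4 \<noteq> 0" "b3 \<noteq> 0" by blast
  then show ?thesis
  proof cases
    case 1
    show ?thesis
      by (rule has_listed_form_transfer[OF listed_rank_one_plane(4),
            where ?l11.0 = 1 and ?l12.0 = 0 and ?l21.0 = 0 and ?l22.0 = 1 and ?w1.0 = w1 and ?w2.0 = 0 and
            ?m11.0 = 1 and ?m12.0 = 0 and ?m21.0 = 0 and ?m22.0 = 1 and ?v1.0 = "v $ 1" and ?v2.0 = "v $ 2"])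
        (simp_all only: F, simp_all add: 1 quadratic_map_eq_vector)
  next
    case 2
    show ?thesis
      by (rule has_listed_form_transfer[OF listed_rank_one_plane(3),
            where ?l11.0 = 1 and ?l12.0 = 0 and ?l21.0 = 0 and ?l22.0 = 1 and ?w1.0 = w1 and ?w2.0 = 0 and
            ?m11.0 = 1 and ?m12.0 = 0 and ?m21.0 = 0 and ?m22.0 = b3 and ?v1.0 = "v $ 1" and ?v2.0 = "v $ 2"])
        (simp_all only: F, simp_all add: 2 quadratic_map_eq_vector)
  next
    case 3
    show ?thesis
      by (rule has_listed_form_transfer[OF listed_rank_one_plane(5),
            where ?l11.0 = 1 and ?l12.0 = 0 and ?l21.0 = 0 and ?l22.0 = "1 / a4" and ?w1.0 = w1 and ?w2.0 = 0 and
            ?m11.0 = 1 and ?m12.0 = 0 and ?m21.0 = 0 and ?m22.0 = 1 and ?v1.0 = "v $ 1" and ?v2.0 = "v $ 2"])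
        (simp_all only: F, simp_all add: 3 quadratic_map_eq_vector)
  next
    case 4
    show ?thesis
      by (rule has_listed_form_transfer[OF listed_regular_shear,
            where ?l11.0 = 1 and ?l12.0 = 0 and ?l21.0 = 0 and ?l22.0 = "1 / a4" and ?w1.0 = w1 and ?w2.0 = 0 and
            ?m11.0 = 1 and ?m12.0 = 0 and ?m21.0 = 0 and ?m22.0 = b3 and ?v1.0 = "v $ 1" and ?v2.0 = "v $ 2"])
        (simp_all only: F, simp_all add: 4 quadratic_map_eq_vector)
  qed
qed

text \<open>
  The numbers \<open>A'\<close>, \<open>B'\<close> and \<open>C'\<close> are the coefficients of the form after the substitution
  \<open>(x, y) \<mapsto> (p x + q y, r x + s y)\<close>. Complete the square, or, if the discriminant is positive, take
  the two real zeros of the form as the new basis vectors.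
\<close>

lemma binary_form_normal_form:
  fixes A B C :: real
  assumes "A \<noteq> 0 \<or> B \<noteq> 0 \<or> C \<noteq> 0"
  obtains p q r s k A' B' C' where "p * s - q * r \<noteq> 0" "k \<noteq> 0"
    and "A' = A * p\<^sup>2 + B * p * r + C * r\<^sup>2"
    and "B' = 2 * A * p * q + B * (p * s + q * r) + 2 * C * r * s"
    and "C' = A * q\<^sup>2 + B * q * s + C * s\<^sup>2"
    and "A' = k \<and> B' = 0 \<and> C' = k \<or> A' = 0 \<and> B' = k \<and> C' = 0 \<or> A' = k \<and> B' = 0 \<and> C' = 0"
proof -
  have main: "\<exists>p q r s k. p * s - q * r \<noteq> 0 \<and> k \<noteq> 0 \<and>
      (A * p\<^sup>2 + B * p * r + C * r\<^sup>2, 2 * A * p * q + B * (p * s + q * r) + 2 * C * r * s,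
        A * q\<^sup>2 + B * q * s + C * s\<^sup>2) \<in> {(k, 0, k), (0, k, 0), (k, 0, 0)}" if "A \<noteq> 0" for A B C :: real
  proof -
    define D where "D = B\<^sup>2 - 4 * A * C"
    consider "D < 0" | "D = 0" | "D > 0" by linarith
    then show ?thesis
    proof cases
      case 1
      define w where "w = sqrt (- D)"
      have w: "w \<noteq> 0" "w\<^sup>2 = 4 * A * C - B\<^sup>2" using 1 by (simp_all add: w_def D_def)
      have "A * (- B / w)\<^sup>2 + B * (- B / w) * (2 * A / w) + C * (2 * A / w)\<^sup>2 = A * (4 * A * C - B\<^sup>2) / w\<^sup>2"
        using w(1) by (simp add: power2_eq_square field_simps)
      also have "\<dots> = A" using w by (simp add: w(2)[symmetric])
      finally show ?thesis
        using that w(1)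
        by - (rule exI[of _ 1], rule exI[of _ "- B / w"], rule exI[of _ 0], rule exI[of _ "2 * A / w"], rule exI[of _ A], simp)
    next
      case 2
      have "A * (- B)\<^sup>2 + B * (- B) * (2 * A) + C * (2 * A)\<^sup>2 = - A * D"
        by (simp add: D_def power2_eq_square algebra_simps)
      with 2 that show ?thesis
        by - (rule exI[of _ 1], rule exI[of _ "- B"], rule exI[of _ 0], rule exI[of _ "2 * A"], rule exI[of _ A], simp)
    next
      case 3
      define w where "w = sqrt D"
      have w: "w \<noteq> 0" "w\<^sup>2 = B\<^sup>2 - 4 * A * C" using 3 by (simp_all add: w_def D_def)
      have "A * (w - B)\<^sup>2 + B * (w - B) * (2 * A) + C * (2 * A)\<^sup>2 = A * (w\<^sup>2 - (B\<^sup>2 - 4 * A * C))"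
        "A * (- w - B)\<^sup>2 + B * (- w - B) * (2 * A) + C * (2 * A)\<^sup>2 = A * (w\<^sup>2 - (B\<^sup>2 - 4 * A * C))"
        by (simp_all add: power2_eq_square algebra_simps)
      then have "A * (w - B)\<^sup>2 + B * (w - B) * (2 * A) + C * (2 * A)\<^sup>2 = 0"
        "A * (- w - B)\<^sup>2 + B * (- w - B) * (2 * A) + C * (2 * A)\<^sup>2 = 0"
        using w(2) by simp_all
      moreover have "2 * A * (w - B) * (- w - B) + B * ((w - B) * (2 * A) + (- w - B) * (2 * A)) + 2 * C * (2 * A) * (2 * A)
          = - 2 * A * (w\<^sup>2 + (B\<^sup>2 - 4 * A * C))"
        by (simp add: power2_eq_square algebra_simps)
      then have "2 * A * (w - B) * (- w - B) + B * ((w - B) * (2 * A) + (- w - B) * (2 * A)) + 2 * C * (2 * A) * (2 * A)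
          = - 4 * A * w\<^sup>2"
        unfolding w(2)[symmetric] by simp
      moreover have "(w - B) * (2 * A) - (- w - B) * (2 * A) = 4 * A * w"
        by (simp add: algebra_simps)
      ultimately show ?thesis
        using that w(1)
        by - (rule exI[of _ "w - B"], rule exI[of _ "- w - B"], rule exI[of _ "2 * A"], rule exI[of _ "2 * A"],
            rule exI[of _ "- 4 * A * w\<^sup>2"], simp only:, simp)
    qed
  qed
  have "\<exists>p q r s k. p * s - q * r \<noteq> 0 \<and> k \<noteq> 0 \<and>
      (A * p\<^sup>2 + B * p * r + C * r\<^sup>2, 2 * A * p * q + B * (p * s + q * r) + 2 * C * r * s,
        A * q\<^sup>2 + B * q * s + C * s\<^sup>2) \<in> {(k, 0, k), (0, k, 0), (k, 0, 0)}"
  proof (cases "A = 0")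
    case A: True
    show ?thesis
    proof (cases "C = 0")
      case True
      with A assms show ?thesis
        by - (rule exI[of _ 1], rule exI[of _ 0], rule exI[of _ 0], rule exI[of _ 1], rule exI[of _ B], simp)
    next
      case False
      from main[OF this, of B A] obtain p q r s k where "p * s - q * r \<noteq> 0" "k \<noteq> 0"
        "(C * p\<^sup>2 + B * p * r + A * r\<^sup>2, 2 * C * p * q + B * (p * s + q * r) + 2 * A * r * s,
        C * q\<^sup>2 + B * q * s + A * s\<^sup>2) \<in> {(k, 0, k), (0, k, 0), (k, 0, 0)}" by blast
      moreover from this(1) have "r * q - s * p \<noteq> 0" by (simp add: algebra_simps)
      ultimately show ?thesis
        by - (rule exI[of _ r], rule exI[of _ s], rule exI[of _ p], rule exI[of _ q], rule exI[of _ k],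
            simp add: algebra_simps)
    qed
  qed (rule main)
  then show ?thesis using that by blast
qed

text \<open>
  A change of the target is determined by what it does to the leading forms; the coefficients of
  the lower order terms follow by solving linear systems.
\<close>

lemma listed_linear_combination:
  assumes det: "m11 * m22 - m12 * m21 \<noteq> 0"
    and form: "\<And>c3 c4 c5 d3 d4 d5.
      has_listed_form (quadratic_map ((!) [c0, c1, c2, c3, c4, c5]) ((!) [d0, d1, d2, d3, d4, d5]))"
    and a: "a 0 = m11 * c0 + m12 * d0" "a 1 = m11 * c1 + m12 * d1" "a 2 = m11 * c2 + m12 * d2"
    and b: "b 0 = m21 * c0 + m22 * d0" "b 1 = m21 * c1 + m22 * d1" "b 2 = m21 * c2 + m22 * d2"
  shows "has_listed_form (quadratic_map a b)"
proof -
  obtain c3 d3 where 3: "m11 * c3 + m12 * d3 = a 3" "m21 * c3 + m22 * d3 = b 3"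
    by (rule linear_system_solvable[OF det])
  obtain c4 d4 where 4: "m11 * c4 + m12 * d4 = a 4" "m21 * c4 + m22 * d4 = b 4"
    by (rule linear_system_solvable[OF det])
  obtain c5 d5 where 5: "m11 * c5 + m12 * d5 = a 5" "m21 * c5 + m22 * d5 = b 5"
    by (rule linear_system_solvable[OF det])
  let ?G = "quadratic_map ((!) [c0, c1, c2, c3, c4, c5]) ((!) [d0, d1, d2, d3, d4, d5])"
  have "quadratic_map a b p $ 1 = m11 * ?G p $ 1 + m12 * ?G p $ 2"
    "quadratic_map a b p $ 2 = m21 * ?G p $ 1 + m22 * ?G p $ 2" for p
    unfolding quadratic_map_nth[of a b] a b 3[symmetric] 4[symmetric] 5[symmetric]
    by (simp_all add: quadratic_map_eq_vector algebra_simps)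
  then have F: "quadratic_map a b (vector [1 * p $ 1 + 0 * p $ 2 + 0, 0 * p $ 1 + 1 * p $ 2 + 0]) =
      vector [m11 * ?G p $ 1 + m12 * ?G p $ 2 + 0, m21 * ?G p $ 1 + m22 * ?G p $ 2 + 0]" for p
    by (simp add: plane_eta) (simp add: plane_eq_iff)
  show ?thesis
    by (rule has_listed_form_transfer[OF form _ det F]) simp
qed

lemma listed_linear_substitution:
  assumes l: "p * s - q * r \<noteq> 0"
    and form: "has_listed_form (quadratic_map
      ((!) [a 0 * p\<^sup>2 + a 1 * p * r + a 2 * r\<^sup>2, 2 * a 0 * p * q + a 1 * (p * s + q * r) + 2 * a 2 * r * s,
        a 0 * q\<^sup>2 + a 1 * q * s + a 2 * s\<^sup>2, a 3 * p + a 4 * r, a 3 * q + a 4 * s, a 5])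
      ((!) [b 0 * p\<^sup>2 + b 1 * p * r + b 2 * r\<^sup>2, 2 * b 0 * p * q + b 1 * (p * s + q * r) + 2 * b 2 * r * s,
        b 0 * q\<^sup>2 + b 1 * q * s + b 2 * s\<^sup>2, b 3 * p + b 4 * r, b 3 * q + b 4 * s, b 5]))"
      (is "has_listed_form ?G")
  shows "has_listed_form (quadratic_map a b)"
proof -
  have F: "quadratic_map a b (vector [p * z $ 1 + q * z $ 2 + 0, r * z $ 1 + s * z $ 2 + 0]) =
      vector [1 * ?G z $ 1 + 0 * ?G z $ 2 + 0, 0 * ?G z $ 1 + 1 * ?G z $ 2 + 0]" for z
    unfolding quadratic_map_eq_vector plane_eq_iff quadratic_map_nth vector_2
    by (simp add: algebra_simps power2_eq_square)
  show ?thesis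
    by (rule has_listed_form_transfer[OF form l _ F]) simp
qed

text \<open>
  The coefficients of the Jacobian of the two leading forms are, up to the factor \<open>2\<close>, the
  entries of their cross product, and a linear substitution transforms this Jacobian as a quadratic form,
  up to the determinant. In the coordinates that normalize it, the cross product is orthogonal to both
  coefficient vectors, which fixes the plane that they span.
\<close>

lemma listed_independent_leading_parts:
  assumes "a 0 * b 1 - a 1 * b 0 \<noteq> 0 \<or> 2 * (a 0 * b 2 - a 2 * b 0) \<noteq> 0 \<or> a 1 * b 2 - a 2 * b 1 \<noteq> 0"
  shows "has_listed_form (quadratic_map a b)"
proof -
  obtain p q r s k J0 J1 J2 where l: "p * s - q * r \<noteq> 0" and "k \<noteq> 0"
    and J: "J0 = (a 0 * b 1 - a 1 * b 0) * p\<^sup>2 + 2 * (a 0 * b 2 - a 2 * b 0) * p * r + (a 1 * b 2 - a 2 * b 1) * r\<^sup>2"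
      "J1 = 2 * (a 0 * b 1 - a 1 * b 0) * p * q + 2 * (a 0 * b 2 - a 2 * b 0) * (p * s + q * r) +
        2 * (a 1 * b 2 - a 2 * b 1) * r * s"
      "J2 = (a 0 * b 1 - a 1 * b 0) * q\<^sup>2 + 2 * (a 0 * b 2 - a 2 * b 0) * q * s + (a 1 * b 2 - a 2 * b 1) * s\<^sup>2"
    and normal: "J0 = k \<and> J1 = 0 \<and> J2 = k \<or> J0 = 0 \<and> J1 = k \<and> J2 = 0 \<or> J0 = k \<and> J1 = 0 \<and> J2 = 0"
    by (rule binary_form_normal_form[OF assms])
  define a0 a1 a2 where "a0 = a 0 * p\<^sup>2 + a 1 * p * r + a 2 * r\<^sup>2"
    and "a1 = 2 * a 0 * p * q + a 1 * (p * s + q * r) + 2 * a 2 * r * s"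
    and "a2 = a 0 * q\<^sup>2 + a 1 * q * s + a 2 * s\<^sup>2"
  define b0 b1 b2 where "b0 = b 0 * p\<^sup>2 + b 1 * p * r + b 2 * r\<^sup>2"
    and "b1 = 2 * b 0 * p * q + b 1 * (p * s + q * r) + 2 * b 2 * r * s"
    and "b2 = b 0 * q\<^sup>2 + b 1 * q * s + b 2 * s\<^sup>2"
  note coeffs = a0_def a1_def a2_def b0_def b1_def b2_def
  define \<delta> where "\<delta> = p * s - q * r"
  have \<delta>: "\<delta> \<noteq> 0" using l by (simp add: \<delta>_def)
  have jac: "a0 * b1 - a1 * b0 = \<delta> * J0" "2 * (a0 * b2 - a2 * b0) = \<delta> * J1" "a1 * b2 - a2 * b1 = \<delta> * J2"
    unfolding coeffs J \<delta>_def by (simp_all add: algebra_simps power2_eq_square)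
  \<comment> \<open>A triple product with a repeated factor vanishes.\<close>
  have apolar: "2 * a0 * (a1 * b2 - a2 * b1) - a1 * (2 * (a0 * b2 - a2 * b0)) + 2 * a2 * (a0 * b1 - a1 * b0) = 0"
    "2 * b0 * (a1 * b2 - a2 * b1) - b1 * (2 * (a0 * b2 - a2 * b0)) + 2 * b2 * (a0 * b1 - a1 * b0) = 0"
    by (simp_all add: algebra_simps)
  have "has_listed_form (quadratic_map ((!) [a0, a1, a2, a3, a4, a5]) ((!) [b0, b1, b2, b3, b4, b5]))"
    for a3 a4 a5 b3 b4 b5
    using normal
  proof (elim disjE conjE)
    assume *: "J0 = k" "J1 = 0" "J2 = k"
    have "(\<delta> * k) * (a0 + a2) = 0" "(\<delta> * k) * (b0 + b2) = 0"
      using apolar unfolding jac * by (simp_all add: algebra_simps)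
    then have "a2 = - a0" "b2 = - b0"
      using \<delta> \<open>k \<noteq> 0\<close> by simp_all
    moreover have "a0 * b1 - a1 * b0 \<noteq> 0"
      using jac(1) * \<delta> \<open>k \<noteq> 0\<close> by simp
    ultimately show ?thesis
      by - (rule listed_linear_combination[OF _ listed_pencil_elliptic_monic, of a0 b1 a1 b0], simp_all)
  next
    assume *: "J0 = 0" "J1 = k" "J2 = 0"
    have "(\<delta> * k) * a1 = 0" "(\<delta> * k) * b1 = 0"
      using apolar unfolding jac * by auto
    then have "a1 = 0" "b1 = 0"
      using \<delta> \<open>k \<noteq> 0\<close> by simp_all
    moreover have "a0 * b2 - a2 * b0 \<noteq> 0"
      using jac(2) * \<delta> \<open>k \<noteq> 0\<close> by auto
    ultimately show ?thesis
      by - (rule listed_linear_combination[OF _ listed_pencil_hyperbolic_monic, of a0 b2 a2 b0], simp_all)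
  next
    assume *: "J0 = k" "J1 = 0" "J2 = 0"
    have "(\<delta> * k) * a2 = 0" "(\<delta> * k) * b2 = 0"
      using apolar unfolding jac * by auto
    then have "a2 = 0" "b2 = 0"
      using \<delta> \<open>k \<noteq> 0\<close> by simp_all
    moreover have "a0 * b1 - a1 * b0 \<noteq> 0"
      using jac(1) * \<delta> \<open>k \<noteq> 0\<close> by simp
    ultimately show ?thesis
      by - (rule listed_linear_combination[OF _ listed_pencil_degenerate_monic, of a0 b1 a1 b0], simp_all)
  qed
  then show ?thesis
    using listed_linear_substitution[OF l, of a b] unfolding coeffs by blast
qed

text \<open>
  One leading form only: it is normalized directly, and the target is then scaled.
\<close>

lemma listed_single_leading_part:
  assumes "a 0 \<noteq> 0 \<or> a 1 \<noteq> 0 \<or> a 2 \<noteq> 0" and b: "b 0 = 0" "b 1 = 0" "b 2 = 0"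
  shows "has_listed_form (quadratic_map a b)"
proof -
  obtain p q r s k a0 a1 a2 where l: "p * s - q * r \<noteq> 0" and "k \<noteq> 0"
    and coeffs: "a0 = a 0 * p\<^sup>2 + a 1 * p * r + a 2 * r\<^sup>2"
      "a1 = 2 * a 0 * p * q + a 1 * (p * s + q * r) + 2 * a 2 * r * s"
      "a2 = a 0 * q\<^sup>2 + a 1 * q * s + a 2 * s\<^sup>2"
    and normal: "a0 = k \<and> a1 = 0 \<and> a2 = k \<or> a0 = 0 \<and> a1 = k \<and> a2 = 0 \<or> a0 = k \<and> a1 = 0 \<and> a2 = 0"
    by (rule binary_form_normal_form[OF assms(1)])
  have "has_listed_form (quadratic_map ((!) [a0, a1, a2, a3, a4, a5]) ((!) [0, 0, 0, b3, b4, b5]))"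
    for a3 a4 a5 b3 b4 b5
    using normal
  proof (elim disjE conjE)
    assume "a0 = k" "a1 = 0" "a2 = k"
    then show ?thesis using \<open>k \<noteq> 0\<close>
      by - (rule listed_linear_combination[OF _ listed_rank_one_elliptic, of k 1 0 0], simp_all)
  next
    assume "a0 = 0" "a1 = k" "a2 = 0"
    then show ?thesis using \<open>k \<noteq> 0\<close>
      by - (rule listed_linear_combination[OF _ listed_rank_one_hyperbolic, of k 1 0 0], simp_all)
  next
    assume "a0 = k" "a1 = 0" "a2 = 0"
    then show ?thesis using \<open>k \<noteq> 0\<close>
      by - (rule listed_linear_combination[OF _ listed_rank_one_parabolic, of k 1 0 0], simp_all)
  qed
  then show ?thesis
    by - (rule listed_linear_substitution[OF l], simp add: coeffs b b(2)[simplified])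
qed

text \<open>
  If the leading forms are dependent, one of them is a multiple \<open>\<mu>\<close> of the other and can be removed by a
  linear change of the target.
\<close>

lemma quadratic_map_has_listed_form:
  assumes "a 0 \<noteq> 0 \<or> a 1 \<noteq> 0 \<or> a 2 \<noteq> 0 \<or> b 0 \<noteq> 0 \<or> b 1 \<noteq> 0 \<or> b 2 \<noteq> 0"
  shows "has_listed_form (quadratic_map a b)"
proof (cases "a 0 * b 1 - a 1 * b 0 \<noteq> 0 \<or> 2 * (a 0 * b 2 - a 2 * b 0) \<noteq> 0 \<or> a 1 * b 2 - a 2 * b 1 \<noteq> 0")
  case True
  then show ?thesis by (rule listed_independent_leading_parts)
next
  case False
  then have dep: "a 0 * b 1 = a 1 * b 0" "a 0 * b 2 = a 2 * b 0" "a 1 * b 2 = a 2 * b 1"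
    by auto
  show ?thesis
  proof (cases "a 0 = 0 \<and> a 1 = 0 \<and> a 2 = 0")
    case True
    with assms have "b 0 \<noteq> 0 \<or> b 1 \<noteq> 0 \<or> b 2 \<noteq> 0" by blast
    then have form: "has_listed_form (quadratic_map ((!) [b 0, b 1, b 2, c3, c4, c5]) ((!) [0, 0, 0, d3, d4, d5]))"
      for c3 c4 c5 d3 d4 d5
      by (intro listed_single_leading_part) simp_all
    show ?thesis
      using True by - (rule listed_linear_combination[OF _ form, of 0 0 1 1], simp_all)
  next
    case False
    then obtain \<mu> where \<mu>: "b 0 = \<mu> * a 0" "b 1 = \<mu> * a 1" "b 2 = \<mu> * a 2"
    proof -
      consider "a 0 \<noteq> 0" | "a 1 \<noteq> 0" | "a 2 \<noteq> 0" using False by blast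
      then show thesis
      proof cases
        case 1 with dep that[of "b 0 / a 0"] show thesis by (simp add: field_simps)
      next
        case 2 with dep that[of "b 1 / a 1"] show thesis by (simp add: field_simps)
      next
        case 3 with dep that[of "b 2 / a 2"] show thesis by (simp add: field_simps)
      qed
    qed
    from False have form: "has_listed_form (quadratic_map ((!) [a 0, a 1, a 2, c3, c4, c5]) ((!) [0, 0, 0, d3, d4, d5]))"
      for c3 c4 c5 d3 d4 d5
      by (intro listed_single_leading_part) simp_all
    show ?thesis
      using \<mu> by - (rule listed_linear_combination[OF _ form, of 1 1 0 \<mu>], simp_all)
  qed
qed

theorem theorem1p1:
  fixes a b :: "nat \<Rightarrow> real" and F :: "real^2 \<Rightarrow> real^2" and J\<^sub>0 J\<^sub>1 :: "(real^2) set"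
  assumes F: "F = quadratic_map a b"
    and quadratic: "a 0 \<noteq> 0 \<or> a 1 \<noteq> 0 \<or> a 2 \<noteq> 0 \<or> b 0 \<noteq> 0 \<or> b 1 \<noteq> 0 \<or> b 2 \<noteq> 0"
    and J\<^sub>0: "J\<^sub>0 = critical_set F"
    and J\<^sub>1: "J\<^sub>1 = critical_image F"
  shows
    "(J\<^sub>0 = {} \<and> J\<^sub>1 = {}) \<or>
     ((\<exists>p. J\<^sub>0 = {p}) \<and> (\<exists>q. J\<^sub>1 = {q})) \<or>
     (is_ellipse J\<^sub>0 \<and> closed_image_curve closed_three_cusp_curve F J\<^sub>0) \<or>
     (is_hyperbola J\<^sub>0 \<and>
        (\<exists>B\<^sub>1 B\<^sub>2. components J\<^sub>0 = {B\<^sub>1, B\<^sub>2} \<and> B\<^sub>1 \<noteq> B\<^sub>2 \<and> J\<^sub>1 = F ` B\<^sub>1 \<union> F ` B\<^sub>2 \<and>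
           open_image_curve smooth_curve F B\<^sub>1 \<and> open_image_curve single_cusp_curve F B\<^sub>2)) \<or>
     ((\<exists>L\<^sub>1 L\<^sub>2. crosses_as_two_lines L\<^sub>1 L\<^sub>2 J\<^sub>0) \<and>
        ((\<exists>p R\<^sub>1 R\<^sub>2. is_ray_from p R\<^sub>1 \<and> is_ray_from p R\<^sub>2 \<and> R\<^sub>1 \<noteq> R\<^sub>2 \<and> J\<^sub>1 = R\<^sub>1 \<union> R\<^sub>2) \<or>
         (\<exists>R P p. is_ray R \<and> is_parabola P \<and> R \<inter> P = {p} \<and> J\<^sub>1 = R \<union> P))) \<or>
     (is_parabola J\<^sub>0 \<and> open_image_curve single_cusp_curve F J\<^sub>0) \<or>
     ((\<exists>L\<^sub>1 L\<^sub>2. parallel_as_two_lines L\<^sub>1 L\<^sub>2 J\<^sub>0 \<and>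
         (\<exists>L q. is_line L \<and> q \<notin> L \<and> F ` L\<^sub>1 = L \<and> F ` L\<^sub>2 = {q} \<and> J\<^sub>1 = L \<union> {q})) \<or>
      (zero_set_is_coincident_lines (jacobian_det F) \<and> (\<exists>q. J\<^sub>1 = {q}))) \<or>
     (zero_set_is_simple_line (jacobian_det F) \<and>
        ((\<exists>q. J\<^sub>1 = {q}) \<or> is_line J\<^sub>1 \<or> is_parabola J\<^sub>1)) \<or>
     (J\<^sub>0 = UNIV \<and> (is_line J\<^sub>1 \<or> is_ray J\<^sub>1 \<or> is_parabola J\<^sub>1))"
  unfolding J\<^sub>0 J\<^sub>1
  using quadratic_map_has_listed_form[OF quadratic] unfolding F[symmetric] has_listed_form_def Let_def .

end
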